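(* Let $\mathcal E\subset M^{(2)}$ be a third-order PDE. Then $\mathcal E$ is locally of the form $\mathcal E_{\mathcal D}=\{m^2\in M^{(2)} : L_{m^2}\cap\mathcal D_{m^1}\neq0\}$ for a 3-dimensional sub-distribution $\mathcal D\subset\mathcal C^1$ if and only if its characteristic cone $\mathcal V^{\mathcal E}$ contains an irreducible component $\mathcal V_{\mathrm I}^{\mathcal E}$ which is a 2-dimensional linear projective sub-bundle of $\mathbb P\mathcal C^1$ (i.e. $\mathcal V_{\mathrm I}^{\mathcal E}=\mathbb P\mathcal D$ for a 3-dimensional sub-distribution $\mathcal D\subset\mathcal C^1$).
   Context: Setting. Everything is smooth. $(M,\mathcal C)$ is a 5-dimensional contact manifold, locally $\mathcal C=\ker\theta$ with $\theta\wedge d\theta\wedge d\theta\neq0$. $\pi:M^{(1)}\to M$ is the bundle of Lagrangian (maximally $d\theta$-isotropic) 2-planes of the spaces $\mathcal C_m$; a point $m^1\in M^{(1)}$ viewed as a plane is denoted $L_{m^1}\subset\mathcal C_{\pi(m^1)}$. $M^{(1)}$ (dimension 8) carries the rank-5 distribution $\mathcal C^1_{m^1}=\{\nu\in T_{m^1}M^{(1)} : \pi_*\nu\in L_{m^1}\}$. $\pi_{2,1}:M^{(2)}\to M^{(1)}$ is the bundle of Lagrangian planes of $M^{(1)}$: the 2-dimensional $\pi$-horizontal subspaces $L_{m^2}\subset T_{m^1}M^{(1)}$ on which all forms in the differential ideal generated by the 1-forms vanishing on $\mathcal C^1$ vanish. In contact coordinates $(x^i,u,p_i)$ on $M$ ($\theta=du-p_idx^i$,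 $i=1,2$), $M^{(1)}$ has coordinates $(x^i,u,p_i,p_{11},p_{12},p_{22})$, $\mathcal C^1=\langle D_1,D_2,\partial_{p_{11}},\partial_{p_{12}},\partial_{p_{22}}\rangle$ with $D_i=\partial_{x^i}+p_i\partial_u+p_{ij}\partial_{p_j}$, and $M^{(2)}$ has further coordinates $p_{111},p_{112},p_{122},p_{222}$ with $L_{m^2}=\langle \xi_1,\xi_2\rangle$, $\xi_1=D_1+p_{111}\partial_{p_{11}}+p_{112}\partial_{p_{12}}+p_{122}\partial_{p_{22}}$, $\xi_2=D_2+p_{112}\partial_{p_{11}}+p_{122}\partial_{p_{12}}+p_{222}\partial_{p_{22}}$. Fibres of $\pi_{2,1}$ are affine spaces of dimension 4. When $m^1,m^2$ appear together, $m^1=\pi_{2,1}(m^2)$. Third-order PDE: a codimension-one sub-bundle $\mathcal E\subset M^{(2)}\to M^{(1)}$ (surjecting onto $M^{(1)}$, with connected fibres), locally $\{F=0\}$; fibres $\mathcal E_{m^1}$ may have singularities where the differential of $F$ vanishes, and one tacitly restricts to the open dense subset of smooth points. Characteristics. For a line $H\subset\mathcal C^1_{m^1}$ let $H^{(1)}=\{m^2\in M^{(2)}_{m^1} : L_{m^2}\supset H\}$. For $m^2\in\mathcal E_{m^1}$, a line $H\subset L_{m^2}$ is characteristic for $\mathcal E$ at $m^2$ if $H^{(1)}$ is tangent to $\mathcal E_{m^1}$ at $m^2$. The characteristic cone is $\mathcal V^{\mathcal E}=\{H\in\mathbb P\mathcal C^1 : \exists\, m^2\in\mathcal E,\ H\subset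 L_{m^2},\ H \text{ characteristic for }\mathcal E\text{ at }m^2\}\to M^{(1)}$. Sub-bundles of $\mathbb P\mathcal C^1$, in particular $\mathcal V^{\mathcal E}$ and its components, are regarded as families of projective subvarieties of the fibres (so in each fibre $\mathbb P\mathcal C^1_{m^1}$ the set of lines $H$ which are characteristic for $\mathcal E$ at some $m^2\in\mathcal E_{m^1}$, and likewise the set of lines defining a component of $\mathcal V^{\mathcal E}$ such as $\mathcal V_{\mathrm I}^{\mathcal E}$, is understood to be replaced by its closure); irreducible components are taken fibrewise. The component $\mathcal V_{\mathrm I}^{\mathcal E}$. For $\mathcal E=\{F=0\}$ the symbol at $m^2$ is $\sum_{i\le j\le k}\frac{\partial F}{\partial p_{ijk}}\xi_i\xi_j\xi_k\in S^3L_{m^2}$; as a real binary cubic it has a real linear factor, $\mathrm{Smbl}\,F=\mathrm{Smbl}_{\mathrm I}F\odot\mathrm{Smbl}_{\mathrm{II}}F$ with $\mathrm{Smbl}_{\mathrm I}F=k\xi_1+h\xi_2$. The line spanned by $k\xi_1+h\xi_2$ in $L_{m^2}$ is characteristic at $m^2$, and $\mathcal V_{\mathrm I}^{\mathcal E}\subset\mathcal V^{\mathcal E}$ is the family of all lines so obtained as $m^2$ ranges over $\mathcal E$ (for a fixed choice of linear factor). *)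

theory Defs
  imports "HOL-Analysis.Analysis" "HOL-Combinatorics.Permutations"
begin

subsection \<open>Smooth maps, differential forms, tangent vectors\<close>

(* C^k on an open subset of a Euclidean space, by iterated directional derivatives. *)
fun Ck_on :: "nat \<Rightarrow> 'a::euclidean_space set \<Rightarrow> ('a \<Rightarrow> 'b::real_normed_vector) \<Rightarrow> bool" where
  "Ck_on 0 S f \<longleftrightarrow> continuous_on S f"
| "Ck_on (Suc k) S f \<longleftrightarrow>
     (\<forall>x\<in>S. f differentiable (at x)) \<and> (\<forall>v. Ck_on k S (\<lambda>x. frechet_derivative f (at x) v))"

definition smooth_on :: "'a::euclidean_space set \<Rightarrow> ('a \<Rightarrow> 'b::real_normed_vector) \<Rightarrow> bool" where
  "smooth_on S f \<longleftrightarrow> (\<forall>k. Ck_on k S f)"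

(* A 1-form on an open subset of a Euclidean space is a field \<theta> of vectors, acting by
   v |-> \<theta> q \<bullet> v. *)
definition ext_deriv :: "('e::euclidean_space \<Rightarrow> 'e) \<Rightarrow> 'e \<Rightarrow> 'e \<Rightarrow> 'e \<Rightarrow> real" where
  "ext_deriv \<theta> q v w =
     frechet_derivative \<theta> (at q) v \<bullet> w - frechet_derivative \<theta> (at q) w \<bullet> v"

(* \<theta> \<and> d\<theta> \<and> d\<theta> evaluated on v 0, ..., v 4, up to a positive constant factor. *)
definition contact_volume :: "('e::euclidean_space \<Rightarrow> 'e) \<Rightarrow> 'e \<Rightarrow> (nat \<Rightarrow> 'e) \<Rightarrow> real" where
  "contact_volume \<theta> q v =
     (\<Sum>\<sigma> | \<sigma> permutes {..<5}. of_int (sign \<sigma>) * (\<theta> q \<bullet> v (\<sigma> 0))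
        * ext_deriv \<theta> q (v (\<sigma> 1)) (v (\<sigma> 2)) * ext_deriv \<theta> q (v (\<sigma> 3)) (v (\<sigma> 4)))"

definition tangent_vectors :: "'e::real_normed_vector set \<Rightarrow> 'e \<Rightarrow> 'e set" where
  "tangent_vectors S q = {v. \<exists>\<gamma> \<epsilon>. \<epsilon> > 0 \<and> smooth_on {-\<epsilon><..<\<epsilon>} \<gamma> \<and> \<gamma> 0 = q
     \<and> (\<forall>t\<in>{-\<epsilon><..<\<epsilon>}. \<gamma> t \<in> S) \<and> (\<gamma> has_vector_derivative v) (at (0::real))}"


subsection \<open>Charts and tangent spaces\<close>

type_synonym ('p, 'e) chart = "'p set \<times> ('p \<Rightarrow> 'e)"

definition transition :: "('p, 'e) chart \<Rightarrow> ('p, 'e) chart \<Rightarrow> 'e \<Rightarrow> 'e" where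
  "transition c c' = snd c' \<circ> inv_into (fst c) (snd c)"

definition is_chart :: "('m::topological_space, 'e::euclidean_space) chart \<Rightarrow> bool" where
  "is_chart c \<longleftrightarrow> open (fst c) \<and> open (snd c ` fst c)
     \<and> homeomorphism (fst c) (snd c ` fst c) (snd c) (inv_into (fst c) (snd c))"

definition smooth_transition ::
    "('m::topological_space, 'e::euclidean_space) chart \<Rightarrow> ('m, 'e) chart \<Rightarrow> bool" where
  "smooth_transition c c' \<longleftrightarrow> smooth_on (snd c ` (fst c \<inter> fst c')) (transition c c')"

definition smooth_atlas :: "('m::topological_space, 'e::euclidean_space) chart set \<Rightarrow> bool" where
  "smooth_atlas A \<longleftrightarrow> (\<forall>c\<in>A. is_chart c) \<and> \<Union>(fst ` A) = UNIV
     \<and> (\<forall>c\<in>A. \<forall>c'\<in>A. smooth_transition c c')"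

definition max_atlas ::
    "('m::topological_space, 'e::euclidean_space) chart set \<Rightarrow> ('m, 'e) chart set" where
  "max_atlas A = {c. is_chart c \<and> (\<forall>c'\<in>A. smooth_transition c c' \<and> smooth_transition c' c)}"

(* A tangent vector at p is the family of its components v c in the charts c around p (0 at
   the other arguments), transforming by the differentials of the transition maps. *)
type_synonym ('p, 'e) tvec = "('p, 'e) chart \<Rightarrow> 'e"

definition tangent_space :: "('p, 'e::euclidean_space) chart set \<Rightarrow> 'p \<Rightarrow> ('p, 'e) tvec set" where
  "tangent_space B p = {v.
     (\<forall>c\<in>B. \<forall>c'\<in>B. p \<in> fst c \<longrightarrow> p \<in> fst c' \<longrightarrow>
        v c' = frechet_derivative (transition c c') (at (snd c p)) (v c))
     \<and> (\<forall>c. c \<notin> B \<or> p \<notin> fst c \<longrightarrow> v c = 0)}"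


subsection \<open>Coordinates on M, M(1), M(2)\<close>

type_synonym j1 = "(real^2) \<times> real \<times> (real^2)"  (* (x, u, p) *)
type_synonym j2 = "j1 \<times> (real^3)"                (* further (p_11, p_12, p_22) *)
type_synonym j3 = "j2 \<times> (real^4)"                (* further (p_111, p_112, p_122, p_222) *)

(* du - p_1 dx^1 - p_2 dx^2 *)
fun canonical_form :: "j1 \<Rightarrow> j1" where
  "canonical_form (x, u, p) = (- p, 1, 0)"

(* The total derivatives D_1, D_2; they have no p_ij-components, so they are written as vectors
   in the coordinates of M. *)
fun D1 :: "j2 \<Rightarrow> j1" where
  "D1 ((x, u, p), a) = (axis 1 1, p$1, vector [a$1, a$2])"

fun D2 :: "j2 \<Rightarrow> j1" where
  "D2 ((x, u, p), a) = (axis 2 1, p$2, vector [a$2, a$3])"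

(* L_{m^1}, and C^1 = the vectors whose projection to M lies in L_{m^1} *)
definition Lag1 :: "j2 \<Rightarrow> j1 set" where
  "Lag1 z = span {D1 z, D2 z}"

definition C1 :: "j2 \<Rightarrow> j2 set" where
  "C1 z = {\<nu>. fst \<nu> \<in> Lag1 z}"

fun \<xi>1 :: "j3 \<Rightarrow> j2" where
  "\<xi>1 (z, b) = (D1 z, vector [b$1, b$2, b$3])"

fun \<xi>2 :: "j3 \<Rightarrow> j2" where
  "\<xi>2 (z, b) = (D2 z, vector [b$2, b$3, b$4])"

definition Lag2 :: "j3 \<Rightarrow> j2 set" where
  "Lag2 y = span {\<xi>1 y, \<xi>2 y}"


subsection \<open>Contact manifolds and the bundles M(1), M(2)\<close>

(* \<theta> is, in the chart c and over V, a contact form defining the hyperplane distribution C. *)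
definition contact_form_on ::
    "('m::topological_space, j1) chart set \<Rightarrow> ('m \<Rightarrow> ('m, j1) tvec set) \<Rightarrow> ('m, j1) chart
      \<Rightarrow> j1 set \<Rightarrow> (j1 \<Rightarrow> j1) \<Rightarrow> bool" where
  "contact_form_on A C c V \<theta> \<longleftrightarrow> c \<in> max_atlas A \<and> open V \<and> V \<subseteq> snd c ` fst c \<and> smooth_on V \<theta>
     \<and> (\<forall>m\<in>fst c. snd c m \<in> V \<longrightarrow>
          C m = {v \<in> tangent_space (max_atlas A) m. \<theta> (snd c m) \<bullet> v c = 0}
          \<and> (\<exists>v. contact_volume \<theta> (snd c m) v \<noteq> 0))"

(* M is the whole type 'm; the charts take values in the 5-dimensional space j1, but need not be
   contact coordinates. *)
definition contact_manifold ::
    "('m::{t2_space,second_countable_topology}, j1) chart set \<Rightarrow> ('m \<Rightarrow> ('m, j1) tvec set) \<Rightarrow> bool"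
  where
  "contact_manifold A C \<longleftrightarrow> smooth_atlas A
     \<and> (\<forall>m. \<exists>c V \<theta>. m \<in> fst c \<and> snd c m \<in> V \<and> contact_form_on A C c V \<theta>)"

definition contact_chart ::
    "('m::topological_space, j1) chart set \<Rightarrow> ('m \<Rightarrow> ('m, j1) tvec set) \<Rightarrow> ('m, j1) chart \<Rightarrow> bool"
  where
  "contact_chart A C c \<longleftrightarrow> contact_form_on A C c (snd c ` fst c) canonical_form"

type_synonym 'm pt1 = "'m \<times> ('m, j1) tvec set"
type_synonym 'm pt2 = "'m pt1 \<times> ('m pt1, j2) tvec set"

definition M1 ::
    "('m::topological_space, j1) chart set \<Rightarrow> ('m \<Rightarrow> ('m, j1) tvec set) \<Rightarrow> 'm pt1 set" where
  "M1 A C = {(m, L). L \<subseteq> C m \<and>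
     (\<exists>c V \<theta>. m \<in> fst c \<and> snd c m \<in> V \<and> contact_form_on A C c V \<theta>
        \<and> subspace ((\<lambda>v. v c) ` L) \<and> dim ((\<lambda>v. v c) ` L) = 2
        \<and> (\<forall>v\<in>L. \<forall>w\<in>L. ext_deriv \<theta> (snd c m) (v c) (w c) = 0))}"

definition dom1 :: "('m, j1) chart \<Rightarrow> j2 set" where
  "dom1 c = {z. fst z \<in> snd c ` fst c}"

definition point1 :: "('m::topological_space, j1) chart set \<Rightarrow> ('m, j1) chart \<Rightarrow> j2 \<Rightarrow> 'm pt1" where
  "point1 A c z = (let m = inv_into (fst c) (snd c) (fst z)
     in (m, {v \<in> tangent_space (max_atlas A) m. v c \<in> Lag1 z}))"

definition chart1 ::
    "('m::topological_space, j1) chart set \<Rightarrow> ('m, j1) chart \<Rightarrow> ('m pt1, j2) chart" where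
  "chart1 A c = (point1 A c ` dom1 c, inv_into (dom1 c) (point1 A c))"

definition atlas1 ::
    "('m::topological_space, j1) chart set \<Rightarrow> ('m \<Rightarrow> ('m, j1) tvec set) \<Rightarrow> ('m pt1, j2) chart set"
  where
  "atlas1 A C = chart1 A ` {c. contact_chart A C c}"

(* Planes tangent to M(1), in coordinates, that are horizontal over M and integral for the
   differential ideal generated by the 1-forms \<omega> annihilating C^1.  That ideal is generated
   algebraically by all such \<omega> and d\<omega>, so only these have to vanish on the plane. *)
definition lagrangian_plane :: "j2 \<Rightarrow> j2 set \<Rightarrow> bool" where
  "lagrangian_plane z P \<longleftrightarrow> subspace P \<and> dim P = 2 \<and> (\<forall>\<nu>\<in>P. fst \<nu> = 0 \<longrightarrow> \<nu> = 0)
     \<and> (\<forall>V \<omega>. open V \<and> z \<in> V \<and> smooth_on V \<omega> \<and> (\<forall>z'\<in>V. \<forall>\<nu>\<in>C1 z'. \<omega> z' \<bullet> \<nu> = 0) \<longrightarrow>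
          (\<forall>\<nu>\<in>P. \<omega> z \<bullet> \<nu> = 0) \<and> (\<forall>\<mu>\<in>P. \<forall>\<nu>\<in>P. ext_deriv \<omega> z \<mu> \<nu> = 0))"

definition M2 ::
    "('m::topological_space, j1) chart set \<Rightarrow> ('m \<Rightarrow> ('m, j1) tvec set) \<Rightarrow> 'm pt2 set" where
  "M2 A C = {(m1, L). m1 \<in> M1 A C \<and> L \<subseteq> tangent_space (atlas1 A C) m1 \<and>
     (\<exists>c\<in>atlas1 A C. m1 \<in> fst c \<and> lagrangian_plane (snd c m1) ((\<lambda>\<nu>. \<nu> c) ` L))}"

definition point2 ::
    "('m::topological_space, j1) chart set \<Rightarrow> ('m \<Rightarrow> ('m, j1) tvec set) \<Rightarrow> ('m, j1) chart
      \<Rightarrow> j3 \<Rightarrow> 'm pt2" where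
  "point2 A C c y = (let m1 = point1 A c (fst y)
     in (m1, {\<nu> \<in> tangent_space (atlas1 A C) m1. \<nu> (chart1 A c) \<in> Lag2 y}))"

definition in_coords ::
    "('m::topological_space, j1) chart set \<Rightarrow> ('m \<Rightarrow> ('m, j1) tvec set) \<Rightarrow> ('m, j1) chart
      \<Rightarrow> 'm pt2 set \<Rightarrow> j3 set" where
  "in_coords A C c E = {y. fst y \<in> dom1 c \<and> point2 A C c y \<in> E}"


subsection \<open>Third-order PDEs\<close>

definition fibre :: "j3 set \<Rightarrow> j2 \<Rightarrow> (real^4) set" where
  "fibre E z = {b. (z, b) \<in> E}"

definition local_equation :: "j3 set \<Rightarrow> j3 set \<Rightarrow> (j3 \<Rightarrow> real) \<Rightarrow> bool" where
  "local_equation E W F \<longleftrightarrow> open W \<and> smooth_on W F \<and> E \<inter> W = {y \<in> W. F y = 0}"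

definition fibre_deriv :: "(j3 \<Rightarrow> real) \<Rightarrow> j3 \<Rightarrow> 4 \<Rightarrow> real" where
  "fibre_deriv F y i = frechet_derivative F (at y) (0, axis i 1)"

definition smooth_points :: "j3 set \<Rightarrow> j3 set" where
  "smooth_points E = {y \<in> E. \<exists>W F. y \<in> W \<and> local_equation E W F \<and> (\<exists>i. fibre_deriv F y i \<noteq> 0)}"

definition PDE_over :: "j2 set \<Rightarrow> j3 set \<Rightarrow> bool" where
  "PDE_over \<Omega> E \<longleftrightarrow> E \<subseteq> \<Omega> \<times> UNIV
     \<and> (\<forall>y\<in>E. \<exists>W F. y \<in> W \<and> local_equation E W F)
     \<and> (\<forall>z\<in>\<Omega>. fibre E z \<noteq> {} \<and> connected (fibre E z)
          \<and> fibre E z \<subseteq> closure (fibre (smooth_points E) z))"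

definition third_order_PDE ::
    "('m::topological_space, j1) chart set \<Rightarrow> ('m \<Rightarrow> ('m, j1) tvec set) \<Rightarrow> 'm pt2 set \<Rightarrow> bool" where
  "third_order_PDE A C E \<longleftrightarrow> E \<subseteq> M2 A C
     \<and> (\<forall>c. contact_chart A C c \<longrightarrow> PDE_over (dom1 c) (in_coords A C c E))"

definition distribution3 :: "j2 set \<Rightarrow> (j2 \<Rightarrow> j2 set) \<Rightarrow> bool" where
  "distribution3 U D \<longleftrightarrow> (\<forall>z\<in>U. subspace (D z) \<and> dim (D z) = 3 \<and> D z \<subseteq> C1 z)
     \<and> (\<forall>z\<in>U. \<exists>V X Y Z. open V \<and> z \<in> V \<and> V \<subseteq> U
          \<and> smooth_on V X \<and> smooth_on V Y \<and> smooth_on V Z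
          \<and> (\<forall>z'\<in>V. D z' = span {X z', Y z', Z z'}))"

definition E_of :: "j2 set \<Rightarrow> (j2 \<Rightarrow> j2 set) \<Rightarrow> j3 set" where
  "E_of U D = {y. fst y \<in> U \<and> Lag2 y \<inter> D (fst y) \<noteq> {0}}"


subsection \<open>Characteristics and symbol\<close>

definition proj_space :: "'e::euclidean_space set \<Rightarrow> 'e set set" where
  "proj_space S = {H. subspace H \<and> dim H = 1 \<and> H \<subseteq> S}"

definition prolong_line :: "j2 \<Rightarrow> j2 set \<Rightarrow> (real^4) set" where
  "prolong_line z H = {b. H \<subseteq> Lag2 (z, b)}"

definition characteristic :: "j3 set \<Rightarrow> j3 \<Rightarrow> j2 set \<Rightarrow> bool" where
  "characteristic E y H \<longleftrightarrow> H \<in> proj_space (Lag2 y)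
     \<and> tangent_vectors (prolong_line (fst y) H) (snd y) \<subseteq> tangent_vectors (fibre E (fst y)) (snd y)"

definition char_lines :: "j3 set \<Rightarrow> j2 \<Rightarrow> j2 set set" where
  "char_lines E z = {H \<in> proj_space (C1 z). \<exists>b. (z, b) \<in> smooth_points E \<and> characteristic E (z, b) H}"

(* The symbol as the binary cubic form in the two indeterminates \<xi>_1 = s, \<xi>_2 = t. *)
definition symbol :: "(j3 \<Rightarrow> real) \<Rightarrow> j3 \<Rightarrow> real \<Rightarrow> real \<Rightarrow> real" where
  "symbol F y s t = fibre_deriv F y 1 * s^3 + fibre_deriv F y 2 * s^2 * t
     + fibre_deriv F y 3 * s * t^2 + fibre_deriv F y 4 * t^3"

(* A smooth choice, over U, of a linear factor k \<xi>_1 + h \<xi>_2 of the symbol, recorded by the line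
   \<Lambda> y which it spans in Lag2 y; the functions k, h exist only locally because the line bundle
   \<Lambda> need not be trivial. *)
definition linear_factor :: "j3 set \<Rightarrow> j2 set \<Rightarrow> (j3 \<Rightarrow> j2 set) \<Rightarrow> bool" where
  "linear_factor E U \<Lambda> \<longleftrightarrow> (\<forall>y0\<in>smooth_points E. fst y0 \<in> U \<longrightarrow>
     (\<exists>W F k h. y0 \<in> W \<and> local_equation E W F \<and> smooth_on W k \<and> smooth_on W h \<and>
        (\<forall>y\<in>E \<inter> W. (\<exists>i. fibre_deriv F y i \<noteq> 0) \<and> (k y \<noteq> 0 \<or> h y \<noteq> 0)
           \<and> (\<exists>\<alpha> \<beta> \<gamma>. \<forall>s t. symbol F y s t =
                 (k y * s + h y * t) * (\<alpha> * s^2 + \<beta> * s * t + \<gamma> * t^2))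
           \<and> \<Lambda> y = span {k y *\<^sub>R \<xi>1 y + h y *\<^sub>R \<xi>2 y})))"

definition factor_lines :: "j3 set \<Rightarrow> (j3 \<Rightarrow> j2 set) \<Rightarrow> j2 \<Rightarrow> j2 set set" where
  "factor_lines E \<Lambda> z = {\<Lambda> (z, b) | b. (z, b) \<in> smooth_points E}"


subsection \<open>Projective subvarieties\<close>

definition homogeneous_polynomial :: "('e::euclidean_space \<Rightarrow> real) \<Rightarrow> bool" where
  "homogeneous_polynomial f \<longleftrightarrow>
     real_polynomial_function f \<and> (\<exists>d. \<forall>t v. f (t *\<^sub>R v) = t ^ d * f v)"

(* Families of lines in S cut out by homogeneous polynomials.  Components and closures are taken
   in this (Zariski) topology, since the cones are regarded as projective subvarieties. *)
definition proj_variety :: "'e::euclidean_space set \<Rightarrow> 'e set set \<Rightarrow> bool" where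
  "proj_variety S X \<longleftrightarrow> (\<exists>Q. (\<forall>f\<in>Q. homogeneous_polynomial f)
     \<and> X = {H \<in> proj_space S. \<forall>f\<in>Q. \<forall>v\<in>H. f v = 0})"

definition zariski_closure :: "'e::euclidean_space set \<Rightarrow> 'e set set \<Rightarrow> 'e set set" where
  "zariski_closure S X = \<Inter>{Y. proj_variety S Y \<and> X \<subseteq> Y}"

definition irreducible_variety :: "'e::euclidean_space set \<Rightarrow> 'e set set \<Rightarrow> bool" where
  "irreducible_variety S X \<longleftrightarrow> proj_variety S X \<and> X \<noteq> {}
     \<and> (\<forall>Y Z. proj_variety S Y \<and> proj_variety S Z \<and> X = Y \<union> Z \<longrightarrow> X = Y \<or> X = Z)"

definition irreducible_component :: "'e::euclidean_space set \<Rightarrow> 'e set set \<Rightarrow> 'e set set \<Rightarrow> bool" where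
  "irreducible_component S Y X \<longleftrightarrow> irreducible_variety S X \<and> X \<subseteq> Y
     \<and> (\<forall>X'. irreducible_variety S X' \<and> X \<subseteq> X' \<and> X' \<subseteq> Y \<longrightarrow> X' = X)"

definition char_cone :: "j3 set \<Rightarrow> j2 \<Rightarrow> j2 set set" where
  "char_cone E z = zariski_closure (C1 z) (char_lines E z)"

definition V_I :: "j3 set \<Rightarrow> (j3 \<Rightarrow> j2 set) \<Rightarrow> j2 \<Rightarrow> j2 set set" where
  "V_I E \<Lambda> z = zariski_closure (C1 z) (factor_lines E \<Lambda> z)"


subsection \<open>The two local properties\<close>

(* The distribution D lives on a neighbourhood U of m1, given in contact coordinates.  Fibres of
   E may be proper open parts of fibres of E_D (or, at singular points, only one of several
   sheets), hence the comparison near each smooth point of E over U. *)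
definition locally_E_D ::
    "('m::topological_space, j1) chart set \<Rightarrow> ('m \<Rightarrow> ('m, j1) tvec set) \<Rightarrow> 'm pt2 set \<Rightarrow> bool" where
  "locally_E_D A C E \<longleftrightarrow> (\<forall>m1\<in>M1 A C. \<exists>c z U D.
     contact_chart A C c \<and> z \<in> dom1 c \<and> point1 A c z = m1
     \<and> open U \<and> z \<in> U \<and> U \<subseteq> dom1 c \<and> distribution3 U D
     \<and> (\<forall>y\<in>smooth_points (in_coords A C c E). fst y \<in> U \<longrightarrow>
          (\<exists>W. open W \<and> y \<in> W \<and> in_coords A C c E \<inter> W = E_of U D \<inter> W)))"

definition char_cone_has_linear_component ::
    "('m::topological_space, j1) chart set \<Rightarrow> ('m \<Rightarrow> ('m, j1) tvec set) \<Rightarrow> 'm pt2 set \<Rightarrow> bool" where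
  "char_cone_has_linear_component A C E \<longleftrightarrow> (\<forall>m1\<in>M1 A C. \<exists>c z U \<Lambda> D.
     contact_chart A C c \<and> z \<in> dom1 c \<and> point1 A c z = m1
     \<and> open U \<and> z \<in> U \<and> U \<subseteq> dom1 c
     \<and> linear_factor (in_coords A C c E) U \<Lambda> \<and> distribution3 U D
     \<and> (\<forall>z'\<in>U. irreducible_component (C1 z') (char_cone (in_coords A C c E) z')
                    (V_I (in_coords A C c E) \<Lambda> z')
          \<and> V_I (in_coords A C c E) \<Lambda> z' = proj_space (D z')))"

end

theory Submission
  imports Defs
begin

text \<open>In contact coordinates a 3-dimensional D is the common kernel of two covectors \<open>\<phi>, \<psi>\<close> on C1, and
  the plane at b meets D iff the determinant \<open>\<phi>(\<xi>1) \<psi>(\<xi>2) - \<phi>(\<xi>2) \<psi>(\<xi>1)\<close>, a quadratic polynomial in the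
  fibre coordinates, vanishes. At a smooth point the plane is not contained in D, because otherwise the
  fibre of the determinant would be a quadric cone containing no hyperplane; hence the
  determinant is a regular local equation there, and its symbol has the line cut out by D as a linear factor.

  If the lines \<open>\<Lambda> y\<close> fill P(D), they lie in D, so E is contained in E_D near a smooth point, and two regular
  hypersurfaces one of which contains the other agree. Conversely, every line of D close to one cut out at a smooth point is
  cut out at a nearby point of E, so these lines are Zariski dense in P(D). The remaining characteristic
  lines off P(D) satisfy a homogeneous equation that does not vanish on D, so P(D) is not
  absorbed by a larger irreducible subvariety of the characteristic cone.\<close>

subsection \<open>Smooth maps and zero sets\<close>

text \<open>At a smooth point the 2 by 2 matrix of values of the two covectors on
  \<open>\<xi>1\<close>, \<open>\<xi>2\<close> has rank exactly one. If (k, h) spans its kernel, a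
  nonzero combination of the covectors kills the whole plane; let m be its vertical part. The
  derivative of the determinant is then m applied to
  \<open>k lower \<delta> + h upper \<delta>\<close>, so the symbol is (k X + h Y)(m1 X^2 + m2 X Y +
  m3 Y^2), and the quadratic factor m carries all remaining characteristic lines. The obstacle is
  that these lines come from a three-dimensional fibre of E, while P(D) has dimension two: no
  dimension count stops their closure from swallowing P(D). An explicit polynomial has to separate
  them, and its shape depends on the position of D. The equation F of E is arbitrary, so nothing is
  known at first about the derivative of the determinant. What is known is a one-sided inclusion of
  zero sets, and this is why zero sets are compared by monotonicity and intermediate values along
  segments. Density in P(D) is likewise tested along lines in D, on which a polynomial with
  infinitely many zeros vanishes.\<close>

lemma Ck_on_cong:
  assumes "open S" "\<And>x. x \<in> S \<Longrightarrow> f x = g x"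
  shows "Ck_on k S f \<longleftrightarrow> Ck_on k S g"
  using assms(2)
proof (induction k arbitrary: f g)
  case 0
  then show ?case by (auto intro: continuous_on_cong)
next
  case (Suc k)
  have der: "(f has_derivative D) (at x) \<longleftrightarrow> (g has_derivative D) (at x)" if "x \<in> S" for x D
    using Suc.prems that assms(1)
    by (metis has_derivative_transform_within_open)
  then have "f differentiable (at x) \<longleftrightarrow> g differentiable (at x)"
    "frechet_derivative f (at x) = frechet_derivative g (at x)" if "x \<in> S" for x
    using that by (auto simp: differentiable_def frechet_derivative_def)
  then show ?case
    using Suc.IH by (metis (no_types, lifting) Ck_on.simps(2))
qed

lemma Ck_on_Suc_imp: "Ck_on (Suc k) S f \<Longrightarrow> Ck_on k S f"
proof (induction k arbitrary: f)
  case 0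
  then show ?case
    by (metis Ck_on.simps differentiable_at_withinI differentiable_imp_continuous_on differentiable_on_def)
next
  case (Suc k)
  then show ?case by (metis Ck_on.simps(2))
qed

lemma Ck_on_subset: "Ck_on k S f \<Longrightarrow> T \<subseteq> S \<Longrightarrow> Ck_on k T f"
  by (induction k arbitrary: f) (auto intro: continuous_on_subset)

lemma Ck_on_const: "Ck_on k S (\<lambda>x. c)"
  by (induction k arbitrary: c) auto

lemma Ck_on_linear:
  assumes "bounded_linear f"
  shows "Ck_on k S f"
proof (cases k)
  case 0
  then show ?thesis
    using assms by (auto intro: linear_continuous_on)
next
  case (Suc n)
  have "frechet_derivative f (at x) = f" for x
    using assms by (metis bounded_linear_imp_has_derivative frechet_derivative_at)
  then show ?thesis
    using assms Suc
    by (auto intro: Ck_on_const bounded_linear_imp_differentiable)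
qed

text \<open>For linear g the chain rule gives the derivative of f in the direction g v, which does
  not depend on x, so the induction closes on directional derivatives. This pulls fields on M(1)
  back to M(2) along \<open>fst\<close>.\<close>

lemma Ck_on_compose_linear:
  assumes "open S" "bounded_linear g" "Ck_on k S f"
  shows "Ck_on k (g -` S) (\<lambda>x. f (g x))"
  using assms(3)
proof (induction k arbitrary: f)
  case 0
  then show ?case
    using continuous_on_compose2[of S f "g -` S" g] linear_continuous_on[OF assms(2)] by auto
next
  case (Suc k)
  have opn: "open (g -` S)"
    using assms by (simp add: continuous_open_vimage linear_continuous_at)
  have der: "((\<lambda>x. f (g x)) has_derivative (\<lambda>v. frechet_derivative f (at (g x)) (g v))) (at x)"
    if "x \<in> g -` S" for x
  proof -
    have "(f has_derivative frechet_derivative f (at (g x))) (at (g x))"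
      using Suc.prems that frechet_derivative_works by auto
    then show ?thesis
      by (rule has_derivative_compose[OF bounded_linear_imp_has_derivative[OF assms(2)]])
  qed
  have "Ck_on k (g -` S) (\<lambda>x. frechet_derivative (\<lambda>x. f (g x)) (at x) v)" for v
  proof -
    have "Ck_on k (g -` S) (\<lambda>x. frechet_derivative f (at (g x)) (g v))"
      using Suc by auto
    then show ?thesis
      by (subst Ck_on_cong[OF opn]) (auto simp: frechet_derivative_at[OF der, symmetric])
  qed
  with der show ?case
    by (auto simp: differentiable_def)
qed

lemma (in bounded_linear) Ck_on_bounded_linear:
  assumes "open S" "Ck_on k S g"
  shows "Ck_on k S (\<lambda>x. f (g x))"
  using assms(2)
proof (induction k arbitrary: g)
  case 0
  then show ?case by (auto intro: continuous_on)
next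
  case (Suc k)
  have der: "((\<lambda>x. f (g x)) has_derivative (\<lambda>v. f (frechet_derivative g (at x) v))) (at x)"
    if "x \<in> S" for x
    using Suc.prems that by (auto intro!: has_derivative simp: frechet_derivative_works)
  have "Ck_on k S (\<lambda>x. frechet_derivative (\<lambda>x. f (g x)) (at x) v)" for v
    using Suc by (subst Ck_on_cong[OF assms(1)]) (auto simp: frechet_derivative_at[OF der, symmetric])
  with der show ?case
    by (auto simp: differentiable_def)
qed

lemma Ck_on_add:
  assumes "open S" "Ck_on k S f" "Ck_on k S g"
  shows "Ck_on k S (\<lambda>x. f x + g x)"
  using assms(2,3)
proof (induction k arbitrary: f g)
  case 0
  then show ?case by (auto intro: continuous_on_add)
next
  case (Suc k)
  have der: "((\<lambda>x. f x + g x) has_derivative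
      (\<lambda>v. frechet_derivative f (at x) v + frechet_derivative g (at x) v)) (at x)"
    if "x \<in> S" for x
    using Suc.prems that by (auto intro!: derivative_intros simp: frechet_derivative_works)
  have "Ck_on k S (\<lambda>x. frechet_derivative (\<lambda>x. f x + g x) (at x) v)" for v
    using Suc by (subst Ck_on_cong[OF assms(1)]) (auto simp: frechet_derivative_at[OF der, symmetric])
  with der show ?case
    by (auto simp: differentiable_def)
qed

text \<open>The Leibniz rule pairs each factor with a derivative of the other, so one order of
  smoothness of the undifferentiated factor is given up before the induction hypothesis
  applies.\<close>

lemma (in bounded_bilinear) Ck_on_bilinear:
  assumes "open S" "Ck_on k S f" "Ck_on k S g"
  shows "Ck_on k S (\<lambda>x. prod (f x) (g x))"
  using assms(2,3)
proof (induction k arbitrary: f g)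
  case 0
  then show ?case by (auto intro: continuous_on)
next
  case (Suc k)
  have der: "((\<lambda>x. prod (f x) (g x)) has_derivative
      (\<lambda>v. prod (f x) (frechet_derivative g (at x) v) + prod (frechet_derivative f (at x) v) (g x))) (at x)"
    if "x \<in> S" for x
    using Suc.prems that by (auto intro!: FDERIV simp: frechet_derivative_works)
  have "Ck_on k S (\<lambda>x. prod (f x) (frechet_derivative g (at x) v) + prod (frechet_derivative f (at x) v) (g x))" for v
    using Suc.prems Ck_on_Suc_imp[OF Suc.prems(1)] Ck_on_Suc_imp[OF Suc.prems(2)]
    by (intro Ck_on_add assms(1) Suc.IH) (simp_all only: Ck_on.simps)
  then have "Ck_on k S (\<lambda>x. frechet_derivative (\<lambda>x. prod (f x) (g x)) (at x) v)" for v
    by (subst Ck_on_cong[OF assms(1)]) (auto simp: frechet_derivative_at[OF der, symmetric])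
  with der show ?case
    by (auto simp: differentiable_def)
qed

named_theorems smooth_intros

lemma smooth_on_const [smooth_intros]: "smooth_on S (\<lambda>x. c)"
  by (simp add: smooth_on_def Ck_on_const)

lemma smooth_on_linear: "bounded_linear f \<Longrightarrow> smooth_on S f"
  by (simp add: smooth_on_def Ck_on_linear)

lemma smooth_on_subset: "smooth_on S f \<Longrightarrow> T \<subseteq> S \<Longrightarrow> smooth_on T f"
  by (auto simp: smooth_on_def intro: Ck_on_subset)

lemma smooth_on_compose_linear:
  "open S \<Longrightarrow> bounded_linear g \<Longrightarrow> smooth_on S f \<Longrightarrow> smooth_on (g -` S) (\<lambda>x. f (g x))"
  by (simp add: smooth_on_def Ck_on_compose_linear)

lemma smooth_on_bounded_linear:
  "open S \<Longrightarrow> bounded_linear f \<Longrightarrow> smooth_on S g \<Longrightarrow> smooth_on S (\<lambda>x. f (g x))"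
  by (simp add: smooth_on_def bounded_linear.Ck_on_bounded_linear)

lemma smooth_on_add [smooth_intros]:
  "open S \<Longrightarrow> smooth_on S f \<Longrightarrow> smooth_on S g \<Longrightarrow> smooth_on S (\<lambda>x. f x + g x)"
  by (simp add: smooth_on_def Ck_on_add)

lemma smooth_on_scaleR [smooth_intros]:
  "open S \<Longrightarrow> smooth_on S f \<Longrightarrow> smooth_on S g \<Longrightarrow> smooth_on S (\<lambda>x. f x *\<^sub>R g x)"
  by (simp add: smooth_on_def bounded_bilinear.Ck_on_bilinear[OF bounded_bilinear_scaleR])

lemma smooth_on_inner [smooth_intros]:
  "open S \<Longrightarrow> smooth_on S f \<Longrightarrow> smooth_on S g \<Longrightarrow> smooth_on S (\<lambda>x. f x \<bullet> g x)"
  by (simp add: smooth_on_def bounded_bilinear.Ck_on_bilinear[OF bounded_bilinear_inner])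

lemma smooth_on_mult [smooth_intros]:
  fixes f g :: "'a::euclidean_space \<Rightarrow> real"
  shows "open S \<Longrightarrow> smooth_on S f \<Longrightarrow> smooth_on S g \<Longrightarrow> smooth_on S (\<lambda>x. f x * g x)"
  by (simp add: smooth_on_def bounded_bilinear.Ck_on_bilinear[OF bounded_bilinear_mult])

lemma smooth_on_minus [smooth_intros]:
  "open S \<Longrightarrow> smooth_on S f \<Longrightarrow> smooth_on S (\<lambda>x. - f x)"
  using smooth_on_scaleR[of S "\<lambda>x. -1" f] by (simp add: smooth_on_const)

lemma smooth_on_diff [smooth_intros]:
  "open S \<Longrightarrow> smooth_on S f \<Longrightarrow> smooth_on S g \<Longrightarrow> smooth_on S (\<lambda>x. f x - g x)"
  using smooth_on_add[of S f "\<lambda>x. - g x"] smooth_on_minus[of S g] by simp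

lemma smooth_on_imp_continuous_on: "smooth_on S f \<Longrightarrow> continuous_on S f"
  unfolding smooth_on_def by (metis Ck_on.simps(1))

lemma smooth_on_imp_differentiable: "smooth_on S f \<Longrightarrow> x \<in> S \<Longrightarrow> f differentiable (at x)"
  unfolding smooth_on_def by (metis Ck_on.simps(2))

lemma smooth_on_imp_continuous_derivative:
  "smooth_on S f \<Longrightarrow> continuous_on S (\<lambda>x. frechet_derivative f (at x) v)"
  unfolding smooth_on_def by (metis Ck_on.simps)

section \<open>Zero sets of functions with nonvanishing derivative\<close>

lemma directional_derivative:
  fixes f :: "'a::real_normed_vector \<Rightarrow> real"
  assumes "f differentiable (at (x + t *\<^sub>R v))"
  shows "((\<lambda>s. f (x + s *\<^sub>R v)) has_real_derivative frechet_derivative f (at (x + t *\<^sub>R v)) v) (at t)"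
proof -
  have "(f has_derivative frechet_derivative f (at (x + t *\<^sub>R v))) (at (x + t *\<^sub>R v))"
    using assms frechet_derivative_works by blast
  moreover have "((\<lambda>s. x + s *\<^sub>R v) has_derivative (\<lambda>s. s *\<^sub>R v)) (at t)"
    by (auto intro!: derivative_eq_intros)
  ultimately have "((\<lambda>s. f (x + s *\<^sub>R v)) has_derivative
      (\<lambda>s. frechet_derivative f (at (x + t *\<^sub>R v)) (s *\<^sub>R v))) (at t)"
    by (metis (no_types) has_derivative_compose)
  then show ?thesis
    using assms
    by (simp add: has_field_derivative_def linear_frechet_derivative linear_scale mult_commute_abs)
qed

text \<open>Near y0 both functions are strictly monotone along v. On a short segment through a zero
  y of G, F changes sign and so has a zero; this is also a zero of G, and G has only one zero on the
  segment, namely y.\<close>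

lemma zero_set_comparison:
  fixes F G :: "'a::euclidean_space \<Rightarrow> real"
  assumes W: "open W" "y0 \<in> W" and F: "smooth_on W F" and G: "smooth_on W G"
    and F0: "F y0 = 0"
    and imp: "\<And>y. y \<in> W \<Longrightarrow> F y = 0 \<Longrightarrow> G y = 0"
    and dF: "frechet_derivative F (at y0) v \<noteq> 0" and dG: "frechet_derivative G (at y0) v \<noteq> 0"
  shows "\<exists>W'. open W' \<and> y0 \<in> W' \<and> W' \<subseteq> W \<and> (\<forall>y\<in>W'. G y = 0 \<longrightarrow> F y = 0)"
proof -
  have v0: "v \<noteq> 0"
    using dF F W by (metis linear_0 linear_frechet_derivative smooth_on_imp_differentiable)
  have opn: "open {y\<in>W. frechet_derivative f (at y) v * frechet_derivative f (at y0) v > 0}"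
    if "smooth_on W f" for f :: "'a \<Rightarrow> real"
    using continuous_open_preimage[of W "\<lambda>y. frechet_derivative f (at y) v * frechet_derivative f (at y0) v" "{0<..}"]
      W smooth_on_imp_continuous_derivative[OF that, of v]
    by (simp add: vimage_def Int_def continuous_on_mult continuous_on_const)
  define S where "S = {y\<in>W. frechet_derivative F (at y) v * frechet_derivative F (at y0) v > 0}
    \<inter> {y\<in>W. frechet_derivative G (at y) v * frechet_derivative G (at y0) v > 0}"
  have "open S" "y0 \<in> S"
    using opn[OF F] opn[OF G] W dF dG by (auto simp: S_def zero_less_mult_iff)
  then obtain r where r: "r > 0" "ball y0 r \<subseteq> S"
    by (auto simp: open_contains_ball)
  then have rW: "ball y0 r \<subseteq> W" by (auto simp: S_def)
  \<comment> \<open>Multiplying f by its own derivative at y0 normalises the sign, so that F and G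
    both increase along v.\<close>
  have mono: "frechet_derivative f (at y0) v * f (y + s *\<^sub>R v) < frechet_derivative f (at y0) v * f (y + s' *\<^sub>R v)"
    if "s < s'" "smooth_on W f"
      and f: "\<And>y. y \<in> S \<Longrightarrow> frechet_derivative f (at y) v * frechet_derivative f (at y0) v > 0"
      and b: "\<And>t. s \<le> t \<Longrightarrow> t \<le> s' \<Longrightarrow> y + t *\<^sub>R v \<in> ball y0 r" for f :: "'a \<Rightarrow> real" and y s s'
  proof (rule DERIV_pos_imp_increasing[OF that(1)])
    fix t assume "s \<le> t" "t \<le> s'"
    then have t: "y + t *\<^sub>R v \<in> W" "y + t *\<^sub>R v \<in> S" using b r rW by auto
    show "\<exists>d. DERIV (\<lambda>t. frechet_derivative f (at y0) v * f (y + t *\<^sub>R v)) t :> d \<and> 0 < d"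
      using f[OF t(2)] DERIV_cmult[OF directional_derivative[OF smooth_on_imp_differentiable[OF that(2) t(1)]]]
      by (metis mult.commute)
  qed
  \<comment> \<open>Half of the radius is spent on y and half on the segment, so the segment stays
    in the ball.\<close>
  define \<tau> where "\<tau> = r / (2 * norm v)"
  have \<tau>: "\<tau> > 0" using r v0 by (simp add: \<tau>_def)
  have inb: "y + t *\<^sub>R v \<in> ball y0 r" if "y \<in> ball y0 (r/2)" "-\<tau> \<le> t" "t \<le> \<tau>" for y t
  proof -
    have "\<bar>t\<bar> * norm v \<le> \<tau> * norm v"
      using that(2,3) by (intro mult_right_mono) auto
    also have "\<dots> = r / 2" using v0 by (simp add: \<tau>_def)
    finally show ?thesis
      using that(1) norm_triangle_ineq4[of "y0 - y" "t *\<^sub>R v"] by (simp add: dist_norm diff_diff_eq)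
  qed
  have y0b: "y0 \<in> ball y0 (r/2)" using r by simp
  let ?f = "\<lambda>y. frechet_derivative F (at y0) v * F y"
  have contF: "continuous_on W ?f"
    by (intro continuous_intros smooth_on_imp_continuous_on F)
  have P0: "?f (y0 + \<tau> *\<^sub>R v) > 0" "?f (y0 + (-\<tau>) *\<^sub>R v) < 0"
    using mono[of 0 \<tau> F y0] mono[of "-\<tau>" 0 F y0] inb[OF y0b] F F0 \<tau> by (auto simp: S_def)
  \<comment> \<open>The opposite signs of F at the two ends of the segment hold for y0 and are open
    conditions on y.\<close>
  define W' where "W' = ball y0 (r/2) \<inter> {y\<in>ball y0 (r/2). ?f (y + \<tau> *\<^sub>R v) > 0}
    \<inter> {y\<in>ball y0 (r/2). ?f (y + (-\<tau>) *\<^sub>R v) < 0}"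
  have cont: "continuous_on (ball y0 (r/2)) (\<lambda>y. ?f (y + t *\<^sub>R v))" if "-\<tau> \<le> t" "t \<le> \<tau>" for t
    using inb that rW by (intro continuous_on_compose2[OF contF]) (auto intro!: continuous_intros)
  have "open W'" unfolding W'_def
    using continuous_open_preimage[OF cont[of \<tau>], of "{0<..}"]
      continuous_open_preimage[OF cont[of "-\<tau>"], of "{..<0}"] \<tau>
    by (intro open_Int) (auto simp: vimage_def Int_def)
  moreover have "y0 \<in> W'"
    using P0 y0b continuous_open_preimage[OF cont[of \<tau>], of "{0<..}"]
      continuous_open_preimage[OF cont[of "-\<tau>"], of "{..<0}"] \<tau>
    by (auto simp: W'_def vimage_def Int_def)
  moreover have "F y = 0" if y: "y \<in> W'" and Gy: "G y = 0" for y
  proof -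
    have yb: "y \<in> ball y0 (r/2)" using y by (auto simp: W'_def)
    have "continuous_on {-\<tau>..\<tau>} (\<lambda>s. ?f (y + s *\<^sub>R v))"
      using inb[OF yb] rW by (intro continuous_on_compose2[OF contF]) (auto intro!: continuous_intros)
    then have "\<exists>s\<ge>-\<tau>. s \<le> \<tau> \<and> ?f (y + s *\<^sub>R v) = 0"
      using y \<tau> by (intro IVT') (auto simp: W'_def)
    then obtain s where s: "-\<tau> \<le> s" "s \<le> \<tau>" "F (y + s *\<^sub>R v) = 0" using dF by auto
    then have Gs: "G (y + s *\<^sub>R v) = 0"
      using imp inb[OF yb] rW by blast
    have "s = 0"
      using mono[of s 0 G y] mono[of 0 s G y] inb[OF yb] G s Gs Gy \<tau>
      by (cases s "0::real" rule: linorder_cases) (auto simp: S_def)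
    then show ?thesis using s by simp
  qed
  moreover have "W' \<subseteq> W" using rW r by (auto simp: W'_def subset_iff)
  ultimately show ?thesis by blast
qed

text \<open>If q did not vanish at the tangent vector \<open>\<delta>\<close>, it would not vanish
  on a short segment through \<open>\<delta>\<close> in a transversal direction. Scaled by a small t
  and moved to b, this segment crosses the zero set of f, since f has opposite signs at its ends; q
  vanishes at the crossing, and homogeneity carries this back to the segment.\<close>

lemma zero_set_tangent_cone:
  fixes f :: "'a::euclidean_space \<Rightarrow> real"
  assumes W: "open W" "b \<in> W" and f: "continuous_on W f" "f differentiable (at b)" and f0: "f b = 0"
    and n: "frechet_derivative f (at b) n \<noteq> 0"
    and q: "continuous_on UNIV q" "\<And>t \<delta>. t > 0 \<Longrightarrow> q (t *\<^sub>R \<delta>) = 0 \<Longrightarrow> q \<delta> = (0::real)"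
    and imp: "\<And>\<delta>. b + \<delta> \<in> W \<Longrightarrow> f (b + \<delta>) = 0 \<Longrightarrow> q \<delta> = 0"
    and \<delta>: "frechet_derivative f (at b) \<delta> = 0"
  shows "q \<delta> = 0"
proof (rule ccontr)
  assume q0: "q \<delta> \<noteq> 0"
  \<comment> \<open>This rescaling makes the derivative of f along the transversal direction
    positive.\<close>
  define n' where "n' = (frechet_derivative f (at b) n) *\<^sub>R n"
  have lin: "linear (frechet_derivative f (at b))" using f linear_frechet_derivative by blast
  then have n': "frechet_derivative f (at b) n' > 0"
    using n by (auto simp: n'_def linear_scale zero_less_mult_iff)
  have "isCont (\<lambda>s. q (\<delta> + s *\<^sub>R n')) 0"
    using q(1) by (intro continuous_on_interior[of UNIV] continuous_on_compose2[OF q(1)])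
      (auto intro!: continuous_intros)
  then have "\<forall>\<^sub>F s in nhds 0. q (\<delta> + s *\<^sub>R n') \<noteq> 0"
    using q0 by (auto simp: isCont_def eventually_nhds_conv_at intro: tendsto_imp_eventually_ne)
  then obtain \<epsilon>' where e: "\<epsilon>' > 0" "\<And>s. \<bar>s\<bar> < \<epsilon>' \<Longrightarrow> q (\<delta> + s *\<^sub>R n') \<noteq> 0"
    by (auto simp: eventually_nhds_metric)
  define \<epsilon> where "\<epsilon> = \<epsilon>' / 2"
  have \<epsilon>: "\<epsilon> > 0" using e by (simp add: \<epsilon>_def)
  have der: "((\<lambda>t. f (b + t *\<^sub>R (\<delta> + s *\<^sub>R n'))) has_real_derivative s * frechet_derivative f (at b) n') (at 0)" for s
    using directional_derivative[of f b 0 "\<delta> + s *\<^sub>R n'"] f(2) \<delta> lin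
    by (simp add: linear_add linear_scale)
  obtain d1 where d1: "d1 > 0" "\<And>t. 0 < t \<Longrightarrow> t < d1 \<Longrightarrow> f (b + t *\<^sub>R (\<delta> + \<epsilon> *\<^sub>R n')) > 0"
    using DERIV_pos_inc_right[OF der[of \<epsilon>]] \<epsilon> n' f0 by auto
  obtain d2 where d2: "d2 > 0" "\<And>t. 0 < t \<Longrightarrow> t < d2 \<Longrightarrow> f (b + t *\<^sub>R (\<delta> + (-\<epsilon>) *\<^sub>R n')) < 0"
    using DERIV_neg_dec_right[OF der[of "-\<epsilon>"]] \<epsilon> n' f0 by auto
  obtain r where r: "r > 0" "ball b r \<subseteq> W" using W open_contains_ball by blast
  \<comment> \<open>N bounds the norm of every point of the segment; the summand 1 makes it
    positive, so that one t keeps the whole scaled segment inside W.\<close>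
  define N where "N = norm \<delta> + \<epsilon> * norm n' + 1"
  have N: "N > 0" using \<epsilon> by (auto simp: N_def intro!: add_nonneg_pos)
  define t where "t = min (min d1 d2) (r / N) / 2"
  have t: "0 < t" "t < d1" "t < d2" "t * N < r"
  proof -
    have "0 < min (min d1 d2) (r / N)" using d1 d2 r N by simp
    then have "0 < t" "t < min (min d1 d2) (r / N)"
      unfolding t_def by (smt (verit) field_sum_of_halves)+
    then show "0 < t" "t < d1" "t < d2" "t * N < r" using N by (auto simp: pos_less_divide_eq)
  qed
  have inW: "b + t *\<^sub>R (\<delta> + s *\<^sub>R n') \<in> W" if "-\<epsilon> \<le> s" "s \<le> \<epsilon>" for s
  proof -
    have "norm (\<delta> + s *\<^sub>R n') \<le> norm \<delta> + \<bar>s\<bar> * norm n'" by (metis norm_scaleR norm_triangle_ineq)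
    also have "\<dots> \<le> N" using that by (auto simp: N_def intro!: mult_right_mono add_increasing2)
    finally have "t * norm (\<delta> + s *\<^sub>R n') < r"
      using t by (smt (verit) mult_left_mono)
    then have "b + t *\<^sub>R (\<delta> + s *\<^sub>R n') \<in> ball b r" using t by (simp add: dist_norm)
    then show ?thesis using r by blast
  qed
  have "\<exists>s\<ge>-\<epsilon>. s \<le> \<epsilon> \<and> f (b + t *\<^sub>R (\<delta> + s *\<^sub>R n')) = 0"
    using d1(2)[OF t(1,2)] d2(2)[OF t(1,3)] \<epsilon> inW
    by (intro IVT') (auto intro!: continuous_on_compose2[OF f(1)] continuous_intros)
  then obtain s where s: "-\<epsilon> \<le> s" "s \<le> \<epsilon>" "f (b + t *\<^sub>R (\<delta> + s *\<^sub>R n')) = 0" by blast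
  then have "q (\<delta> + s *\<^sub>R n') = 0" using imp inW q(2) t(1) by blast
  moreover have "\<bar>s\<bar> < \<epsilon>'" using s e(1) by (simp add: \<epsilon>_def)
  ultimately show False using e(2) by blast
qed

subsection \<open>Annihilators of the distribution in contact coordinates\<close>

text \<open>The component of v orthogonal to x, multiplied by \<open>x \<bullet> x\<close>. Without
  the division it is polynomial in both arguments, so smoothness is immediate.\<close>

definition reject :: "'a::real_inner \<Rightarrow> 'a \<Rightarrow> 'a" where
  "reject x v = (x \<bullet> x) *\<^sub>R v - (x \<bullet> v) *\<^sub>R x"

lemma reject_orthogonal: "reject x v \<bullet> x = 0" "x \<bullet> reject x v = 0"
  by (simp_all add: reject_def inner_diff_left inner_diff_right inner_commute)

lemma inner_reject: "x \<bullet> w = 0 \<Longrightarrow> reject x v \<bullet> w = (x \<bullet> x) * (v \<bullet> w)"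
  by (simp add: reject_def inner_diff_left inner_diff_right inner_commute)

lemma reject_orthogonal_arg: "x \<bullet> v = 0 \<Longrightarrow> reject x v = (x \<bullet> x) *\<^sub>R v"
  by (simp add: reject_def)

lemma reject_eq_0: "x \<noteq> 0 \<Longrightarrow> reject x v = 0 \<Longrightarrow> v \<in> span {x}"
  by (auto simp: reject_def span_singleton eq_vector_fraction_iff
      intro!: image_eqI[of _ _ "(x \<bullet> v) / (x \<bullet> x)"])

lemma smooth_on_reject:
  "open S \<Longrightarrow> smooth_on S f \<Longrightarrow> smooth_on S g \<Longrightarrow> smooth_on S (\<lambda>x. reject (f x) (g x))"
  unfolding reject_def by (intro smooth_intros)

lemma dim_span_insert_redundant:
  assumes "a \<in> span {b, c}" shows "dim {a, b, c :: 'a::euclidean_space} \<le> 2"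
proof -
  have "dim {a, b, c} = dim {b, c}"
    using assms by (metis dim_span span_redundant)
  also have "\<dots> \<le> card {b, c}" by (intro dim_le_card') auto
  also have "\<dots> \<le> 2" by (simp add: card_insert_if)
  finally show ?thesis .
qed

text \<open>Division-free Gram-Schmidt turns the frame into nowhere vanishing orthogonal fields;
  projecting constant vectors off them gives smooth annihilators. Two constants that are orthonormal
  and orthogonal to the frame at z0 have independent projections at z0, hence nearby, and 5 - 2 = 3
  identifies the common kernel.\<close>

lemma smooth_annihilators:
  fixes X Y Z :: "'a::euclidean_space \<Rightarrow> 'b::euclidean_space"
  assumes dimb: "DIM('b) = 5" and V: "open V" "z0 \<in> V"
    and sm: "smooth_on V X" "smooth_on V Y" "smooth_on V Z"
    and dim3: "\<And>z. z \<in> V \<Longrightarrow> dim {X z, Y z, Z z} = 3"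
  obtains V' \<Phi> \<Psi> where "open V'" "z0 \<in> V'" "V' \<subseteq> V" "smooth_on V' \<Phi>" "smooth_on V' \<Psi>"
    "\<And>z. z \<in> V' \<Longrightarrow> span {X z, Y z, Z z} = {w. \<Phi> z \<bullet> w = 0 \<and> \<Psi> z \<bullet> w = 0}"
    "\<And>z s t. z \<in> V' \<Longrightarrow> s *\<^sub>R \<Phi> z + t *\<^sub>R \<Psi> z = 0 \<Longrightarrow> s = 0 \<and> t = 0"
proof -
  define Y1 where "Y1 z = reject (X z) (Y z)" for z
  define Z1 where "Z1 z = reject (Y1 z) (reject (X z) (Z z))" for z
  define P where "P e z = reject (Z1 z) (reject (Y1 z) (reject (X z) e))" for e z
  have smP: "smooth_on V (P e)" for e
    unfolding P_def Z1_def Y1_def by (intro smooth_on_reject smooth_on_const V sm)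
  have Xn: "X z \<noteq> 0" if "z \<in> V" for z
    using dim3[OF that] dim_span_insert_redundant[of "X z" "Y z" "Z z"] by (auto simp: span_0)
  have Yn: "Y1 z \<noteq> 0" if "z \<in> V" for z
  proof
    assume "Y1 z = 0"
    then have "Y z \<in> span {X z}" using Xn[OF that] reject_eq_0 by (auto simp: Y1_def)
    then have "Y z \<in> span {X z, Z z}" by (meson span_mono subsetD subset_insertI insert_mono empty_subsetI)
    then show False
      using dim3[OF that] dim_span_insert_redundant[of "Y z" "X z" "Z z"] by (simp add: insert_commute)
  qed
  have Y_in: "Y1 z \<in> span {X z, Y z}" for z
    unfolding Y1_def reject_def by (intro span_diff span_scale span_base) auto
  have Zn: "Z1 z \<noteq> 0" if "z \<in> V" for z
  proof
    assume "Z1 z = 0"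
    then have "reject (X z) (Z z) \<in> span {Y1 z}"
      using Yn[OF that] reject_eq_0 by (auto simp: Z1_def)
    also have "span {Y1 z} \<subseteq> span {X z, Y z}"
      using Y_in by (simp add: span_minimal)
    finally have "reject (X z) (Z z) + (X z \<bullet> Z z) *\<^sub>R X z \<in> span {X z, Y z}"
      by (intro span_add span_scale) (auto intro: span_base)
    moreover have "reject (X z) (Z z) + (X z \<bullet> Z z) *\<^sub>R X z = (X z \<bullet> X z) *\<^sub>R Z z"
      by (simp add: reject_def)
    ultimately have "(X z \<bullet> X z) *\<^sub>R Z z \<in> span {X z, Y z}" by metis
    then have "Z z \<in> span {X z, Y z}"
      using Xn[OF that] span_scale[of _ "{X z, Y z}" "inverse (X z \<bullet> X z)"] by fastforce
    then show False
      using dim3[OF that] dim_span_insert_redundant[of "Z z" "X z" "Y z"] by (simp add: insert_commute)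
  qed
  have Z1X: "Z1 z \<bullet> X z = 0" and Y1X: "Y1 z \<bullet> X z = 0" for z
    by (simp_all add: Z1_def Y1_def inner_reject reject_orthogonal)
  have Z1Y: "Z1 z \<bullet> Y1 z = 0" for z by (simp add: Z1_def reject_orthogonal)
  have PX: "P e z \<bullet> X z = 0" for e z
    by (simp add: P_def inner_reject reject_orthogonal Z1X Y1X)
  have PY1: "P e z \<bullet> Y1 z = 0" for e z
    by (simp add: P_def inner_reject reject_orthogonal Z1Y)
  have PZ1: "P e z \<bullet> Z1 z = 0" for e z by (simp add: P_def reject_orthogonal)
  have PY: "P e z \<bullet> Y z = 0" if "z \<in> V" for e z
    \<comment> \<open>\<open>Y1\<close> is a nonzero multiple of \<open>Y\<close> plus a multiple of
      \<open>X\<close>, so orthogonality to \<open>X\<close> and \<open>Y1\<close> passes to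
      \<open>Y\<close>; the same happens for \<open>Z\<close> below.\<close>
    using PY1[of e z] PX[of e z] Xn[OF that] by (simp add: Y1_def reject_def inner_diff_right)
  have PZ: "P e z \<bullet> Z z = 0" if "z \<in> V" for e z
    using PZ1[of e z] PY1[of e z] PX[of e z] Xn[OF that] Yn[OF that]
    by (simp add: Z1_def reject_def[of "Y1 z"] reject_def[of "X z"] inner_diff_right)
  define S where "S = {w. \<forall>x\<in>span {X z0, Y z0, Z z0}. orthogonal x w}"
  have subS: "subspace S" unfolding S_def
    by (auto simp: subspace_def orthogonal_def inner_add_right)
  have "dim S + dim (span {X z0, Y z0, Z z0}) = dim (UNIV :: 'b set)"
    using dim_subspace_orthogonal_to_vectors[of "span {X z0, Y z0, Z z0}" UNIV] by (simp add: S_def)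
  then have "dim S = 2" using dim3[OF V(2)] dimb by simp
  then obtain B where B: "B \<subseteq> S" "pairwise orthogonal B" "\<And>x. x \<in> B \<Longrightarrow> norm x = 1" "card B = 2"
    using orthonormal_basis_subspace[OF subS] by metis
  then obtain e1 e2 where e: "B = {e1, e2}" "e1 \<noteq> e2" by (meson card_2_iff)
  then have e12: "e1 \<bullet> e2 = 0" "e1 \<bullet> e1 = 1" "e2 \<bullet> e2 = 1"
    using B by (auto simp: pairwise_def orthogonal_def norm_eq_1)
  define c where "c = (Z1 z0 \<bullet> Z1 z0) * ((Y1 z0 \<bullet> Y1 z0) * (X z0 \<bullet> X z0))"
  have P0: "P e z0 = c *\<^sub>R e" if "e \<in> S" for e
  proof -
    have o: "X z0 \<bullet> e = 0" "Y z0 \<bullet> e = 0" "Z z0 \<bullet> e = 0"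
      using that span_base[of _ "{X z0, Y z0, Z z0}"] by (auto simp: S_def orthogonal_def)
    then have "Y1 z0 \<bullet> e = 0" by (simp add: Y1_def inner_reject)
    moreover from this o have "Z1 z0 \<bullet> e = 0"
      by (simp add: Z1_def inner_reject)
    ultimately show ?thesis
      using o by (simp add: P_def reject_orthogonal_arg c_def)
  qed
  have c: "c \<noteq> 0" using Xn Yn Zn V by (simp add: c_def)
  \<comment> \<open>The Gram determinant of the two projections. At z0 they are the c-fold multiples
    of orthonormal vectors, so its value there is c^4.\<close>
  define g where "g z = (P e1 z \<bullet> P e1 z) * (P e2 z \<bullet> P e2 z) - (P e1 z \<bullet> P e2 z) * (P e1 z \<bullet> P e2 z)" for z
  have "g z0 = c^4"
    using P0 B(1) e e12 by (simp add: g_def power4_eq_xxxx)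
  then have g0: "g z0 \<noteq> 0" using c by simp
  have "continuous_on V g"
    unfolding g_def by (intro smooth_on_imp_continuous_on smooth_intros V smP)
  then have opn: "open {z\<in>V. g z \<noteq> 0}"
    using continuous_open_preimage[of V g "- {0}"] V by (simp add: vimage_def Int_def open_Compl)
  have indep: "s = 0 \<and> t = 0" if "z \<in> V" "g z \<noteq> 0" "s *\<^sub>R P e1 z + t *\<^sub>R P e2 z = 0" for z s t
  proof -
    have "(s *\<^sub>R P e1 z + t *\<^sub>R P e2 z) \<bullet> P e1 z = 0" "(s *\<^sub>R P e1 z + t *\<^sub>R P e2 z) \<bullet> P e2 z = 0"
      using that by simp_all
    then have *: "s * (P e1 z \<bullet> P e1 z) + t * (P e1 z \<bullet> P e2 z) = 0" "s * (P e1 z \<bullet> P e2 z) + t * (P e2 z \<bullet> P e2 z) = 0"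
      by (simp_all add: inner_add_left inner_commute[of "P e2 z" "P e1 z"])
    have "s * g z = 0" "t * g z = 0" using * unfolding g_def by algebra+
    then show ?thesis using that by simp
  qed
  have span_eq: "span {X z, Y z, Z z} = {w. P e1 z \<bullet> w = 0 \<and> P e2 z \<bullet> w = 0}" (is "?L = ?R")
    if z: "z \<in> V" "g z \<noteq> 0" for z
  proof (rule subspace_dim_equal)
    show sub: "subspace ?R" by (auto simp: subspace_def inner_add_right)
    show "?L \<subseteq> ?R" using sub PX PY PZ z by (intro span_minimal) auto
    have "?R = {w. \<forall>x\<in>span {P e1 z, P e2 z}. orthogonal x w}" (is "_ = ?R'")
    proof
      show "?R' \<subseteq> ?R" using span_base[of _ "{P e1 z, P e2 z}"] by (auto simp: orthogonal_def)
      show "?R \<subseteq> ?R'"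
      proof
        fix w assume "w \<in> ?R"
        then have "span {P e1 z, P e2 z} \<subseteq> {x. x \<bullet> w = 0}"
          by (intro span_minimal) (auto simp: subspace_def inner_add_left)
        then show "w \<in> ?R'" by (auto simp: orthogonal_def)
      qed
    qed
    then have "dim ?R + dim (span {P e1 z, P e2 z}) = dim (UNIV :: 'b set)"
      using dim_subspace_orthogonal_to_vectors[of "span {P e1 z, P e2 z}" UNIV] by simp
    moreover have "dim (span {P e1 z, P e2 z}) = 2"
    proof -
      have ne: "P e1 z \<noteq> P e2 z" using indep[OF z, of 1 "-1"] by auto
      have "independent {P e1 z, P e2 z}"
        using indep[OF z, of 0 1] indep[OF z, of 1 "- k" for k]
        by (auto simp: independent_insert span_singleton)
      then have "dim {P e1 z, P e2 z} = card {P e1 z, P e2 z}" by (rule dim_eq_card_independent)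
      then show ?thesis using ne by simp
    qed
    ultimately show "dim ?R \<le> dim ?L" using dim3[OF z(1)] dimb by simp
  qed auto
  show thesis
  proof (rule that[OF opn])
    show "smooth_on {z\<in>V. g z \<noteq> 0} (P e1)" "smooth_on {z\<in>V. g z \<noteq> 0} (P e2)"
      by (rule smooth_on_subset[OF smP], blast)+
    show "z0 \<in> {z\<in>V. g z \<noteq> 0}" "{z\<in>V. g z \<noteq> 0} \<subseteq> V" using V(2) g0 by auto
    show "span {X z, Y z, Z z} = {w. P e1 z \<bullet> w = 0 \<and> P e2 z \<bullet> w = 0}" if "z \<in> {z\<in>V. g z \<noteq> 0}" for z
      using that by (intro span_eq) simp_all
    show "s = 0 \<and> t = 0" if "z \<in> {z\<in>V. g z \<noteq> 0}" "s *\<^sub>R P e1 z + t *\<^sub>R P e2 z = 0" for z s t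
      using that indep[of z s t] by simp
  qed
qed

text \<open>The pair \<open>(vector [k, h], a)\<close> stands for the vector \<open>k D1 + h D2 + a\<close> of C1; via the inner product,
  pairs also serve as covectors on C1.\<close>

type_synonym c5 = "(real^2) \<times> (real^3)"

text \<open>With \<open>upper\<close>, the vertical components of \<open>\<xi>1\<close> and
  \<open>\<xi>2\<close>: the two rows of the 2 by 3 Hankel matrix of b. Their overlap expresses that
  the plane is Lagrangian.\<close>

definition lower :: "real^4 \<Rightarrow> real^3" where "lower b = vector [b$1, b$2, b$3]"
definition upper :: "real^4 \<Rightarrow> real^3" where "upper b = vector [b$2, b$3, b$4]"

definition coords :: "j2 \<Rightarrow> c5" where "coords \<nu> = (fst (fst \<nu>), snd \<nu>)"

definition lift :: "j2 \<Rightarrow> c5 \<Rightarrow> j2" where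
  "lift z v = (fst v $ 1 *\<^sub>R D1 z + fst v $ 2 *\<^sub>R D2 z, snd v)"

lemma lower_nth [simp]: "lower b $ 1 = b$1" "lower b $ 2 = b$2" "lower b $ 3 = b$3"
  and upper_nth [simp]: "upper b $ 1 = b$2" "upper b $ 2 = b$3" "upper b $ 3 = b$4"
  by (simp_all add: lower_def upper_def)

lemma linear_lower: "linear lower" and linear_upper: "linear upper"
  by (intro linearI; simp add: vec_eq_iff forall_3)+

lemma linear_coords: "linear coords" by (intro linearI) (auto simp: coords_def)
lemma linear_lift: "linear (lift z)"
  by (intro linearI) (auto simp: lift_def scaleR_add_left scaleR_add_right)

lemma fst_D [simp]: "fst (D1 z) = axis 1 1" "fst (D2 z) = axis 2 1"
  by (cases z rule: D1.cases; simp)+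

lemma coords_lift [simp]: "coords (lift z v) = v"
  by (cases v) (simp add: coords_def lift_def vec_eq_iff forall_2 axis_def)

lemma C1_eq_range_lift: "C1 z = range (lift z)"
proof -
  have "\<nu> \<in> range (lift z)" if "fst \<nu> = s *\<^sub>R D1 z + t *\<^sub>R D2 z" for \<nu> s t
    using that by (intro image_eqI[of _ _ "(vector [s, t], snd \<nu>)"]) (auto simp: lift_def prod_eq_iff)
  moreover have "x - k *\<^sub>R a = t *\<^sub>R b \<longleftrightarrow> x = k *\<^sub>R a + t *\<^sub>R b" for x a b :: j1 and k t
    by (auto simp: algebra_simps)
  ultimately show ?thesis
    by (auto simp: C1_def Lag1_def span_insert span_singleton) (auto simp: lift_def)
qed

lemma lift_coords: "\<nu> \<in> C1 z \<Longrightarrow> lift z (coords \<nu>) = \<nu>"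
  by (auto simp: C1_eq_range_lift)

lemma subspace_C1: "subspace (C1 z)"
  by (simp add: C1_eq_range_lift linear_lift linear_subspace_image)

lemma coords_inj_on_C1: "inj_on coords (C1 z)"
  by (metis inj_onI lift_coords)

lemma coords_xi [simp]: "coords (\<xi>1 y) = (axis 1 1, lower (snd y))" "coords (\<xi>2 y) = (axis 2 1, upper (snd y))"
  by (cases y; simp add: coords_def lower_def upper_def)+

lemma xi_in_C1: "\<xi>1 y \<in> C1 (fst y)" "\<xi>2 y \<in> C1 (fst y)"
  by (cases y; auto simp: C1_def Lag1_def intro: span_base)+

lemma mem_Lag2: "\<nu> \<in> Lag2 y \<longleftrightarrow> (\<exists>k h. \<nu> = k *\<^sub>R \<xi>1 y + h *\<^sub>R \<xi>2 y)"
  by (auto simp: Lag2_def span_insert span_singleton) (metis diff_add_cancel add.commute, metis add_diff_cancel_left')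

lemma Lag2_subset_C1: "Lag2 y \<subseteq> C1 (fst y)"
  by (simp add: Lag2_def span_minimal subspace_C1 xi_in_C1)

lemma coords_Lag2: "coords (k *\<^sub>R \<xi>1 y + h *\<^sub>R \<xi>2 y) = (vector [k, h], k *\<^sub>R lower (snd y) + h *\<^sub>R upper (snd y))"
  by (simp add: linear_add[OF linear_coords] linear_scale[OF linear_coords] vec_eq_iff forall_2 axis_def)

lemma xi_comb_eq_0: "k *\<^sub>R \<xi>1 y + h *\<^sub>R \<xi>2 y = 0 \<longleftrightarrow> k = 0 \<and> h = 0"
proof
  assume "k *\<^sub>R \<xi>1 y + h *\<^sub>R \<xi>2 y = 0"
  then have "vector [k, h] = (0 :: real^2)"
    using coords_Lag2[of k y h] linear_0[OF linear_coords] by (metis fst_conv fst_zero)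
  then show "k = 0 \<and> h = 0" by (simp add: vec_eq_iff forall_2)
qed auto

text \<open>\<open>coords\<close> forgets the components along u and p and is faithful only on C1,
  so the two equations have to be imposed inside C1.\<close>

definition annihilates :: "c5 \<Rightarrow> c5 \<Rightarrow> j2 \<Rightarrow> j2 set \<Rightarrow> bool" where
  "annihilates \<phi> \<psi> z Dz \<longleftrightarrow> Dz = {\<nu>\<in>C1 z. \<phi> \<bullet> coords \<nu> = 0 \<and> \<psi> \<bullet> coords \<nu> = 0}
     \<and> (\<forall>s t. s *\<^sub>R \<phi> + t *\<^sub>R \<psi> = 0 \<longrightarrow> s = 0 \<and> t = 0)"

lemma distribution3_annihilators:
  assumes "distribution3 U D" "z0 \<in> U"
  obtains V \<Phi> \<Psi> where "open V" "z0 \<in> V" "V \<subseteq> U" "smooth_on V \<Phi>" "smooth_on V \<Psi>"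
    "\<And>z. z \<in> V \<Longrightarrow> annihilates (\<Phi> z) (\<Psi> z) z (D z)"
proof -
  obtain V X Y Z where V: "open V" "z0 \<in> V" "V \<subseteq> U" and sm: "smooth_on V X" "smooth_on V Y" "smooth_on V Z"
    and span: "\<And>z. z \<in> V \<Longrightarrow> D z = span {X z, Y z, Z z}"
    using assms unfolding distribution3_def by metis
  have D: "subspace (D z)" "dim (D z) = 3" "D z \<subseteq> C1 z" if "z \<in> V" for z
    using assms that V(3) unfolding distribution3_def by auto
  have img: "coords ` D z = span {coords (X z), coords (Y z), coords (Z z)}" if "z \<in> V" for z
    using span[OF that] linear_span_image[OF linear_coords, of "{X z, Y z, Z z}"] by simp
  have sm': "smooth_on V (\<lambda>z. coords (f z))" if "smooth_on V f" for f :: "j2 \<Rightarrow> j2"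
    using smooth_on_bounded_linear[OF V(1) _ that] linear_coords by (simp add: linear_linear)
  have dim3: "dim {coords (X z), coords (Y z), coords (Z z)} = 3" if "z \<in> V" for z
    using dim_image_eq[OF linear_coords, of "D z"] D[OF that] img[OF that] inj_on_subset[OF coords_inj_on_C1]
    by (metis dim_span span_eq_iff)
  have "DIM(c5) = 5" by simp
  then show thesis
  proof (rule smooth_annihilators[OF _ V(1,2) sm'[OF sm(1)] sm'[OF sm(2)] sm'[OF sm(3)] dim3])
    fix V' and \<Phi> \<Psi> :: "j2 \<Rightarrow> c5"
    assume V': "open V'" "z0 \<in> V'" "V' \<subseteq> V" "smooth_on V' \<Phi>" "smooth_on V' \<Psi>"
      and *: "\<And>z. z \<in> V' \<Longrightarrow> span {coords (X z), coords (Y z), coords (Z z)} = {w. \<Phi> z \<bullet> w = 0 \<and> \<Psi> z \<bullet> w = 0}"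
      and ind: "\<And>z s t. z \<in> V' \<Longrightarrow> s *\<^sub>R \<Phi> z + t *\<^sub>R \<Psi> z = 0 \<Longrightarrow> s = 0 \<and> t = 0"
    have "annihilates (\<Phi> z) (\<Psi> z) z (D z)" if "z \<in> V'" for z
    proof -
      have zV: "z \<in> V" using that V'(3) by blast
      have "\<nu> \<in> D z \<longleftrightarrow> coords \<nu> \<in> coords ` D z" if "\<nu> \<in> C1 z" for \<nu>
        by (rule inj_on_image_mem_iff[OF coords_inj_on_C1 that D(3)[OF zV], symmetric])
      moreover have "coords ` D z = {w. \<Phi> z \<bullet> w = 0 \<and> \<Psi> z \<bullet> w = 0}"
        unfolding img[OF zV] by (rule *[OF that])
      ultimately have "D z = {\<nu>\<in>C1 z. \<Phi> z \<bullet> coords \<nu> = 0 \<and> \<Psi> z \<bullet> coords \<nu> = 0}"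
        using D(3)[OF zV] by auto
      then show ?thesis using ind[OF that] unfolding annihilates_def by blast
    qed
    then show thesis using V' V(3) by (intro that[of V' \<Phi> \<Psi>]) auto
  qed
qed

subsection \<open>The algebra of Monge-Ampere equations in one fibre\<close>

text \<open>The values of a covector on \<open>\<xi>1\<close> and \<open>\<xi>2\<close>.\<close>

definition ev1 :: "c5 \<Rightarrow> real^4 \<Rightarrow> real" where "ev1 \<phi> b = fst \<phi> $ 1 + snd \<phi> \<bullet> lower b"
definition ev2 :: "c5 \<Rightarrow> real^4 \<Rightarrow> real" where "ev2 \<phi> b = fst \<phi> $ 2 + snd \<phi> \<bullet> upper b"

definition ma :: "c5 \<Rightarrow> c5 \<Rightarrow> real^4 \<Rightarrow> real" where
  "ma \<phi> \<psi> b = ev1 \<phi> b * ev2 \<psi> b - ev2 \<phi> b * ev1 \<psi> b"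

text \<open>The linear term of the expansion of \<open>ma\<close> at b, hence its differential;
  \<open>qma\<close> is the quadratic term, where only the vertical parts of the covectors
  enter.\<close>

definition dma :: "c5 \<Rightarrow> c5 \<Rightarrow> real^4 \<Rightarrow> real^4 \<Rightarrow> real" where
  "dma \<phi> \<psi> b \<delta> = (snd \<phi> \<bullet> lower \<delta>) * ev2 \<psi> b + ev1 \<phi> b * (snd \<psi> \<bullet> upper \<delta>)
     - (snd \<phi> \<bullet> upper \<delta>) * ev1 \<psi> b - ev2 \<phi> b * (snd \<psi> \<bullet> lower \<delta>)"

definition qma :: "real^3 \<Rightarrow> real^3 \<Rightarrow> real^4 \<Rightarrow> real" where
  "qma l m \<delta> = (l \<bullet> lower \<delta>) * (m \<bullet> upper \<delta>) - (l \<bullet> upper \<delta>) * (m \<bullet> lower \<delta>)"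

abbreviation indep2 :: "'a::real_vector \<Rightarrow> 'a \<Rightarrow> bool" where
  "indep2 \<phi> \<psi> \<equiv> \<forall>s t. s *\<^sub>R \<phi> + t *\<^sub>R \<psi> = 0 \<longrightarrow> s = 0 \<and> t = 0"

lemma inner_3: "(x::real^3) \<bullet> y = x$1 * y$1 + x$2 * y$2 + x$3 * y$3"
  by (simp add: inner_vec_def sum_3)

lemma inner_2: "(x::real^2) \<bullet> y = x$1 * y$1 + x$2 * y$2"
  by (simp add: inner_vec_def sum_2)

lemma ma_expansion:
  "ma \<phi> \<psi> (b + t *\<^sub>R \<delta>) = ma \<phi> \<psi> b + t * dma \<phi> \<psi> b \<delta> + t^2 * qma (snd \<phi>) (snd \<psi>) \<delta>"
proof -
  have "ev1 \<phi> (b + t *\<^sub>R \<delta>) = ev1 \<phi> b + t * (snd \<phi> \<bullet> lower \<delta>)" "ev2 \<phi> (b + t *\<^sub>R \<delta>) = ev2 \<phi> b + t * (snd \<phi> \<bullet> upper \<delta>)" for \<phi>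
    by (simp_all add: ev1_def ev2_def linear_add[OF linear_lower] linear_scale[OF linear_lower]
        linear_add[OF linear_upper] linear_scale[OF linear_upper] inner_add_right)
  then show ?thesis
    by (simp add: ma_def dma_def qma_def algebra_simps power2_eq_square)
qed

text \<open>The components of the second cross product are the 2 by 2 minors of the Hankel matrix of
  \<open>\<delta>\<close>, that is, the quadrics through the twisted cubic; the first one holds the
  coefficients.\<close>

lemma qma_cross: "qma l m \<delta> = (cross3 l m) \<bullet> (cross3 (lower \<delta>) (upper \<delta>))"
  by (simp add: qma_def dot_cross)

lemma indep2_iff_cross: "indep2 l m \<longleftrightarrow> cross3 l m \<noteq> 0" for l m :: "real^3"
proof
  assume i: "indep2 l m"
  show "cross3 l m \<noteq> 0"
  proof
    assume c: "cross3 l m = 0"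
    have "(m \<bullet> m) *\<^sub>R l + (- (l \<bullet> m)) *\<^sub>R m = 0"
    proof -
      have "cross3 m (cross3 l m) = (m \<bullet> m) *\<^sub>R l - (m \<bullet> l) *\<^sub>R m" by (rule Lagrange)
      then show ?thesis using c by (simp add: inner_commute cross_zero_right)
    qed
    then have "m = 0" using i by (metis inner_eq_zero_iff)
    then show False using i[THEN spec, of 0, THEN spec, of 1] by simp
  qed
next
  assume c: "cross3 l m \<noteq> 0"
  show "indep2 l m"
  proof (intro allI impI)
    fix s t assume e: "s *\<^sub>R l + t *\<^sub>R m = 0"
    have "cross3 (s *\<^sub>R l + t *\<^sub>R m) m = s *\<^sub>R (cross3 l m)" "cross3 l (s *\<^sub>R l + t *\<^sub>R m) = t *\<^sub>R (cross3 l m)"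
      by (simp_all add: cross_add_left cross_add_right cross_mult_left cross_mult_right)
    then show "s = 0 \<and> t = 0" using c unfolding e by (metis cross_zero_left cross_zero_right scaleR_eq_0_iff)
  qed
qed

text \<open>Geometrically, a quadric containing a hyperplane is reducible, whereas the twisted cubic
  is irreducible and spans the space, so no nonzero quadric through it is reducible. The proof
  evaluates the quadric at explicit vectors of the hyperplane until all three coefficients
  vanish.\<close>

lemma qma_not_zero_on_hyperplane:
  assumes i: "indep2 l m" and c: "c \<noteq> 0" and q: "\<And>\<delta>. c \<bullet> \<delta> = 0 \<Longrightarrow> qma l m \<delta> = 0"
  shows False
proof -
  define v1 v2 v3 where "v1 = cross3 l m $ 1" and "v2 = cross3 l m $ 2" and "v3 = cross3 l m $ 3"
  then have v: "cross3 l m = vector [v1, v2, v3]"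
    by (simp add: vec_eq_iff forall_3)
  have q': "v1 * (y * w - z * z) + v2 * (z * y - x * w) + v3 * (x * z - y * y) = 0"
    if "c$1 * x + c$2 * y + c$3 * z + c$4 * w = 0" for x y z w
  proof -
    define \<delta> :: "real^4" where "\<delta> = (\<chi> i. if i = 1 then x else if i = 2 then y else if i = 3 then z else w)"
    have d: "\<delta> $ 1 = x" "\<delta> $ 2 = y" "\<delta> $ 3 = z" "\<delta> $ 4 = w" by (simp_all add: \<delta>_def)
    have "c \<bullet> \<delta> = 0" using that d by (simp add: inner_vec_def sum_4)
    from q[OF this] show ?thesis
      unfolding qma_cross v by (simp add: inner_3 cross3_def d mult.commute)
  qed
  have v0: "v1 \<noteq> 0 \<or> v2 \<noteq> 0 \<or> v3 \<noteq> 0"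
    using i v unfolding indep2_iff_cross by (auto simp: vec_eq_iff forall_3)
  have c0: "c$1 \<noteq> 0 \<or> c$2 \<noteq> 0 \<or> c$3 \<noteq> 0 \<or> c$4 \<noteq> 0"
    using c by (auto simp: vec_eq_iff forall_4)
  show False
  proof (cases "c$1 = 0")
    case False
    have "v3 = 0" using q'[of "- c$2" "c$1" 0 0] False by simp
    moreover have "v1 = 0" using q'[of "- c$3" 0 "c$1" 0] False \<open>v3 = 0\<close> by simp
    moreover have "v2 = 0" using q'[of "- (c$2 + c$3)/c$1" 1 1 0] False \<open>v3 = 0\<close> \<open>v1 = 0\<close> by (simp add: field_simps)
    ultimately show False using v0 by simp
  next
    case c1: True
    show False
    proof (cases "c$4 = 0")
      case False
      have "v1 = 0" using q'[of 0 0 "- c$4" "c$3"] False by simp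
      moreover have "v3 = 0" using q'[of 0 "- c$4" 0 "c$2"] False \<open>v1 = 0\<close> by simp
      moreover have "v2 = 0" using q'[of 0 1 1 "- (c$2 + c$3)/c$4"] False \<open>v3 = 0\<close> \<open>v1 = 0\<close> by (simp add: field_simps)
      ultimately show False using v0 by simp
    next
      case True
      have v2: "v2 = 0" using q'[of 1 0 0 1] c1 True by simp
      \<comment> \<open>Here the hyperplane contains the first and last axes, so x and w remain free
        and the coefficients can be compared.\<close>
      have *: "v1 * (c$3 * w - c$2 * c$2) - v3 * (x * c$2 + c$3 * c$3) = 0" for x w
        using q'[of x "c$3" "- c$2" w] c1 True v2 by (simp add: algebra_simps)
      have "v1 * c$3 = 0" using *[of 1 0] *[of 0 0] by algebra
      moreover have "v3 * c$2 = 0" using *[of 0 1] *[of 0 0] by algebra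
      moreover have "v1 * (c$2 * c$2) + v3 * (c$3 * c$3) = 0" using *[of 0 0] by (simp add: algebra_simps)
      ultimately show False using v0 v2 c0 c1 True by (cases "c$2 = 0"; cases "c$3 = 0") auto
    qed
  qed
qed

lemma orthogonal_pair:
  fixes a b k h :: real
  assumes "(k, h) \<noteq> 0" "a * k + b * h = 0"
  obtains r where "a = - h * r" "b = k * r"
proof (cases "k = 0")
  case True
  then show thesis using assms that[of "- a / h"] by (auto simp: zero_prod_def)
next
  case False
  then show thesis using assms(2) that[of "b / k"] by (simp add: field_simps eq_neg_iff_add_eq_0)
qed

lemma ev_linear: "ev1 (s *\<^sub>R \<phi> + t *\<^sub>R \<psi>) b = s * ev1 \<phi> b + t * ev1 \<psi> b"
  "ev2 (s *\<^sub>R \<phi> + t *\<^sub>R \<psi>) b = s * ev2 \<phi> b + t * ev2 \<psi> b"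
  by (simp_all add: ev1_def ev2_def inner_add_left algebra_simps)

lemma ev_zero_imp_zero: "snd \<phi> = 0 \<Longrightarrow> ev1 \<phi> b = 0 \<Longrightarrow> ev2 \<phi> b = 0 \<Longrightarrow> \<phi> = 0"
  by (cases \<phi>) (simp add: ev1_def ev2_def zero_prod_def vec_eq_iff[of _ "0 :: real^2"] forall_2)

text \<open>Both rows of the value matrix annihilate (k, h), so they are r and r' times (-h, k).
  Then \<open>r' \<phi> - r \<psi>\<close> kills the plane, and substituting the rows into
  \<open>dma\<close> leaves only its vertical part. That part is nonzero: a covector killing the
  plane and all vertical vectors is zero, against independence.\<close>

lemma rank_one_derivative:
  assumes i: "indep2 \<phi> \<psi>" and kh: "(k, h) \<noteq> (0 :: real \<times> real)"
    and ker: "ev1 \<phi> b * k + ev2 \<phi> b * h = 0" "ev1 \<psi> b * k + ev2 \<psi> b * h = 0"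
    and nz: "(ev1 \<phi> b, ev2 \<phi> b, ev1 \<psi> b, ev2 \<psi> b) \<noteq> 0"
  shows "\<exists>s t. s *\<^sub>R snd \<phi> + t *\<^sub>R snd \<psi> \<noteq> 0
    \<and> ev1 (s *\<^sub>R \<phi> + t *\<^sub>R \<psi>) b = 0 \<and> ev2 (s *\<^sub>R \<phi> + t *\<^sub>R \<psi>) b = 0
    \<and> (\<forall>\<delta>. dma \<phi> \<psi> b \<delta> = (s *\<^sub>R snd \<phi> + t *\<^sub>R snd \<psi>) \<bullet> (k *\<^sub>R lower \<delta> + h *\<^sub>R upper \<delta>))"
proof -
  obtain r where r: "ev1 \<phi> b = - h * r" "ev2 \<phi> b = k * r" using orthogonal_pair[OF kh ker(1)] .
  obtain r' where r': "ev1 \<psi> b = - h * r'" "ev2 \<psi> b = k * r'" using orthogonal_pair[OF kh ker(2)] .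
  have rr: "\<not> (r' = 0 \<and> - r = 0)" using nz r r' by (auto simp: zero_prod_def)
  have e: "ev1 (r' *\<^sub>R \<phi> + (- r) *\<^sub>R \<psi>) b = 0" "ev2 (r' *\<^sub>R \<phi> + (- r) *\<^sub>R \<psi>) b = 0"
    unfolding ev_linear r r' by simp_all
  then have "snd (r' *\<^sub>R \<phi> + (- r) *\<^sub>R \<psi>) \<noteq> 0" using i rr ev_zero_imp_zero by blast
  then show ?thesis
    using e by (intro exI[of _ r'] exI[of _ "- r"])
      (simp add: dma_def r r' inner_add_left inner_add_right inner_diff_left algebra_simps)
qed

section \<open>Characteristic lines coming from the quadratic factor of the symbol\<close>

lemma real_polynomial_nth:
  "real_polynomial_function (\<lambda>v::c5. fst v $ i)" "real_polynomial_function (\<lambda>v::c5. snd v $ j)"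
  by (auto intro!: real_polynomial_function.intros(1) bounded_linear_compose[OF bounded_linear_vec_nth]
      bounded_linear_fst bounded_linear_snd)

lemmas poly_intros = real_polynomial_nth real_polynomial_function.intros(2-4) real_polynomial_function_diff
  real_polynomial_function_minus real_polynomial_function_power

text \<open>The form m1 X^2 + m2 X Y + m3 Y^2 vanishes at (h, -k), hence is divisible by k X + h Y;
  the quotient is \<open>\<alpha>\<close> X + \<open>\<beta>\<close> Y.\<close>

lemma binary_quadratic_factor:
  fixes m :: "real^3"
  assumes "(k, h) \<noteq> (0 :: real \<times> real)" "m$1 * h^2 - m$2 * h * k + m$3 * k^2 = 0"
  obtains \<alpha> \<beta> where "m$1 = k * \<alpha>" "m$2 = k * \<beta> + h * \<alpha>" "m$3 = h * \<beta>"
proof (cases "k = 0")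
  case True
  then show thesis using assms that[of "m$2 / h" "m$3 / h"] by (auto simp: zero_prod_def)
next
  case False
  then show thesis using assms(2)
    by (intro that[of "m$1 / k" "(m$2 - h * (m$1 / k)) / k"])
      (simp_all add: field_simps power2_eq_square)
qed

text \<open>A direction of the plane at b that is characteristic, but not because of its own linear factor:
  the covector killing the plane and D has a quadratic part vanishing at it.\<close>

definition second_char :: "c5 \<Rightarrow> c5 \<Rightarrow> c5 \<Rightarrow> bool" where
  "second_char \<phi> \<psi> v \<longleftrightarrow> (\<exists>b s t k h. v = (vector [k, h], k *\<^sub>R lower b + h *\<^sub>R upper b) \<and> (k, h) \<noteq> 0
     \<and> s *\<^sub>R snd \<phi> + t *\<^sub>R snd \<psi> \<noteq> 0
     \<and> ev1 (s *\<^sub>R \<phi> + t *\<^sub>R \<psi>) b = 0 \<and> ev2 (s *\<^sub>R \<phi> + t *\<^sub>R \<psi>) b = 0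
     \<and> (s *\<^sub>R snd \<phi> + t *\<^sub>R snd \<psi>) \<bullet> vector [h^2, - h * k, k^2] = 0)"

text \<open>The polynomial G keeps P(D) from lying in the closure of the other characteristic lines.\<close>

definition separated :: "c5 \<Rightarrow> c5 \<Rightarrow> bool" where
  "separated \<phi> \<psi> \<longleftrightarrow> (\<exists>G. homogeneous_polynomial G \<and> (\<exists>d. \<phi> \<bullet> d = 0 \<and> \<psi> \<bullet> d = 0 \<and> G d \<noteq> 0)
     \<and> (\<forall>v. second_char \<phi> \<psi> v \<longrightarrow> \<phi> \<bullet> v = 0 \<and> \<psi> \<bullet> v = 0 \<or> G v = 0))"

lemma inner_c5: "\<phi> \<bullet> (v::c5) = fst \<phi> $ 1 * fst v $ 1 + fst \<phi> $ 2 * fst v $ 2 + snd \<phi> \<bullet> snd v"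
  by (simp add: inner_prod_def inner_2)

text \<open>Eliminates the point b: once m is factored, m pairs with \<open>lower b\<close> and
  \<open>upper b\<close> only through the vector \<open>k lower b + h upper b\<close>, which is the
  vertical part of v. The conditions left involve v, the coefficients s, t and the second linear
  factor alone.\<close>

lemma second_charE:
  assumes "second_char \<phi> \<psi> v"
  obtains s t k h \<alpha> \<beta> m where "fst v = vector [k, h]" "(k, h) \<noteq> 0" "m = s *\<^sub>R snd \<phi> + t *\<^sub>R snd \<psi>" "m \<noteq> 0"
    "m$1 = k * \<alpha>" "m$2 = k * \<beta> + h * \<alpha>" "m$3 = h * \<beta>"
    "s * fst \<phi> $ 1 + t * fst \<psi> $ 1 + \<alpha> * snd v $ 1 + \<beta> * snd v $ 2 = 0"
    "s * fst \<phi> $ 2 + t * fst \<psi> $ 2 + \<alpha> * snd v $ 2 + \<beta> * snd v $ 3 = 0"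
    "s * (\<phi> \<bullet> v) + t * (\<psi> \<bullet> v) = 0"
proof -
  obtain b s t k h where *: "v = (vector [k, h], k *\<^sub>R lower b + h *\<^sub>R upper b)" "(k, h) \<noteq> 0"
     "s *\<^sub>R snd \<phi> + t *\<^sub>R snd \<psi> \<noteq> 0"
     "ev1 (s *\<^sub>R \<phi> + t *\<^sub>R \<psi>) b = 0" "ev2 (s *\<^sub>R \<phi> + t *\<^sub>R \<psi>) b = 0"
     "(s *\<^sub>R snd \<phi> + t *\<^sub>R snd \<psi>) \<bullet> vector [h^2, - h * k, k^2] = 0"
    using assms unfolding second_char_def by blast
  define m where "m = s *\<^sub>R snd \<phi> + t *\<^sub>R snd \<psi>"
  have "m$1 * h^2 - m$2 * h * k + m$3 * k^2 = 0"
    using *(6) unfolding m_def[symmetric] by (simp add: inner_3)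
  from binary_quadratic_factor[OF *(2) this] obtain \<alpha> \<beta>
    where m: "m$1 = k * \<alpha>" "m$2 = k * \<beta> + h * \<alpha>" "m$3 = h * \<beta>" .
  have e: "s * fst \<phi> $ 1 + t * fst \<psi> $ 1 + m \<bullet> lower b = 0" "s * fst \<phi> $ 2 + t * fst \<psi> $ 2 + m \<bullet> upper b = 0"
    using *(4,5) by (simp_all add: ev1_def ev2_def m_def)
  have e': "s * fst \<phi> $ 1 + t * fst \<psi> $ 1 + \<alpha> * snd v $ 1 + \<beta> * snd v $ 2 = 0"
    "s * fst \<phi> $ 2 + t * fst \<psi> $ 2 + \<alpha> * snd v $ 2 + \<beta> * snd v $ 3 = 0"
    using e by (simp_all add: inner_3 m *(1) algebra_simps)
  have "s * (\<phi> \<bullet> v) + t * (\<psi> \<bullet> v) = (s * fst \<phi> $ 1 + t * fst \<psi> $ 1) * k + (s * fst \<phi> $ 2 + t * fst \<psi> $ 2) * h + m \<bullet> snd v"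
    by (simp add: inner_c5 m_def *(1) inner_add_left algebra_simps)
  also have "\<dots> = k * (s * fst \<phi> $ 1 + t * fst \<psi> $ 1 + m \<bullet> lower b) + h * (s * fst \<phi> $ 2 + t * fst \<psi> $ 2 + m \<bullet> upper b)"
    by (simp add: *(1) inner_add_right algebra_simps)
  also have "\<dots> = 0" unfolding e by simp
  finally show thesis using that[of k h m s t \<alpha> \<beta>] * m e' m_def by simp
qed

text \<open>\<open>\<psi>\<close> has no vertical part, so D lies over the single horizontal
  direction (p, q), and every m is a multiple of \<open>snd \<phi>\<close>. Second characteristic
  directions are thus roots of one fixed binary quadratic Q. If Q does not vanish at (p, q), it
  separates; otherwise the root (p, q) is split off, because vectors over it lie in D anyway, and
  the other linear factor separates.\<close>

lemma separated_degenerate: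
  assumes m0: "snd \<phi> \<noteq> 0" and psi: "snd \<psi> = 0" "\<psi> \<noteq> 0"
  shows "separated \<phi> \<psi>"
proof -
  define p q where "p = - fst \<psi> $ 2" and "q = fst \<psi> $ 1"
  define m0 where "m0 = snd \<phi>"
  have pq: "(p, q) \<noteq> 0" using psi by (auto simp: p_def q_def zero_prod_def prod_eq_iff vec_eq_iff forall_2)
  \<comment> \<open>A vector of D over (p, q): its vertical part is the multiple of
    \<open>m0\<close> that makes \<open>\<phi>\<close> vanish.\<close>
  define d :: c5 where "d = (vector [p, q], (- (fst \<phi> $ 1 * p + fst \<phi> $ 2 * q) / (m0 \<bullet> m0)) *\<^sub>R m0)"
  have d: "\<phi> \<bullet> d = 0" "\<psi> \<bullet> d = 0" "fst d $ 1 = p" "fst d $ 2 = q"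
    using m0 psi by (simp_all add: inner_c5 d_def m0_def p_def q_def)
  have on_D: "\<phi> \<bullet> v = 0 \<and> \<psi> \<bullet> v = 0"
    if "p * fst v $ 2 - q * fst v $ 1 = 0" "s * (\<phi> \<bullet> v) + t * (\<psi> \<bullet> v) = 0" "s \<noteq> 0" for v s t
  proof -
    have "\<psi> \<bullet> v = 0" using that(1) psi by (simp add: inner_c5 p_def q_def)
    then show ?thesis using that by simp
  qed
  define Q where "Q v = m0$1 * (fst v $ 2)^2 - m0$2 * fst v $ 2 * fst v $ 1 + m0$3 * (fst v $ 1)^2" for v :: c5
  have sc: "Q v = 0 \<and> (\<exists>s t. s \<noteq> 0 \<and> s * (\<phi> \<bullet> v) + t * (\<psi> \<bullet> v) = 0) \<and> (fst v $ 1, fst v $ 2) \<noteq> 0" if v: "second_char \<phi> \<psi> v" for v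
  proof -
    from v obtain s t k h \<alpha> \<beta> m where *: "fst v = vector [k, h]" "(k, h) \<noteq> 0" "m = s *\<^sub>R snd \<phi> + t *\<^sub>R snd \<psi>" "m \<noteq> 0"
      "m$1 = k * \<alpha>" "m$2 = k * \<beta> + h * \<alpha>" "m$3 = h * \<beta>" "s * (\<phi> \<bullet> v) + t * (\<psi> \<bullet> v) = 0"
      by (rule second_charE)
    have s: "s \<noteq> 0" "m = s *\<^sub>R m0" using * psi by (auto simp: m0_def)
    then have "s * Q v = m$1 * h^2 - m$2 * h * k + m$3 * k^2" by (simp add: Q_def * algebra_simps)
    also have "\<dots> = 0" unfolding *(5-7) by algebra
    finally show ?thesis using * s by auto
  qed
  have homQ: "homogeneous_polynomial Q"
    unfolding homogeneous_polynomial_def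
  proof
    show "real_polynomial_function Q" unfolding Q_def by (intro poly_intros)
    show "\<exists>d. \<forall>t v. Q (t *\<^sub>R v) = t ^ d * Q v"
      by (intro exI[of _ 2]) (simp add: Q_def power_mult_distrib algebra_simps power2_eq_square)
  qed
  show ?thesis
  proof (cases "Q d = 0")
    case False
    then show ?thesis unfolding separated_def using homQ d sc by blast
  next
    case True
    then have "m0$1 * q^2 - m0$2 * q * p + m0$3 * p^2 = 0" by (simp add: Q_def d)
    from binary_quadratic_factor[OF pq this] obtain \<alpha> \<beta>
      where m: "m0$1 = p * \<alpha>" "m0$2 = p * \<beta> + q * \<alpha>" "m0$3 = q * \<beta>" .
    have Q: "Q v = (p * fst v $ 2 - q * fst v $ 1) * (\<alpha> * fst v $ 2 - \<beta> * fst v $ 1)" for v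
      unfolding Q_def m by algebra
    define G where "G v = \<alpha> * fst v $ 2 - \<beta> * fst v $ 1" for v :: c5
    show ?thesis
    proof (cases "G d = 0")
      case False
      have "homogeneous_polynomial G"
        unfolding homogeneous_polynomial_def
      proof
        show "real_polynomial_function G" unfolding G_def by (intro poly_intros)
        show "\<exists>d. \<forall>t v. G (t *\<^sub>R v) = t ^ d * G v"
          by (intro exI[of _ 1]) (simp add: G_def algebra_simps)
      qed
      moreover have "\<phi> \<bullet> v = 0 \<and> \<psi> \<bullet> v = 0 \<or> G v = 0" if "second_char \<phi> \<psi> v" for v
        using sc[OF that] on_D[of v] Q by (auto simp: G_def)
      ultimately show ?thesis unfolding separated_def using d False by blast
    next
      case True
      \<comment> \<open>Now (p, q) is a double root of Q, so every second characteristic vector lies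
        in D and the constant 1 can serve as G.\<close>
      have ab: "(\<alpha>, \<beta>) \<noteq> 0"
        using m m0 by (auto simp: m0_def zero_prod_def vec_eq_iff forall_3)
      have "\<phi> \<bullet> v = 0 \<and> \<psi> \<bullet> v = 0" if v: "second_char \<phi> \<psi> v" for v
      proof -
        have "p * fst v $ 2 - q * fst v $ 1 = 0"
        proof (rule ccontr)
          assume "p * fst v $ 2 - q * fst v $ 1 \<noteq> 0"
          then have 1: "\<alpha> * fst v $ 2 - \<beta> * fst v $ 1 = 0" using sc[OF v] Q by simp
          have 2: "\<alpha> * q - \<beta> * p = 0" using True by (simp add: G_def d)
          have "\<alpha> * (p * fst v $ 2 - q * fst v $ 1) = 0" "\<beta> * (p * fst v $ 2 - q * fst v $ 1) = 0"
            using 1 2 by algebra+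
          then show False using ab \<open>p * fst v $ 2 - q * fst v $ 1 \<noteq> 0\<close> by (simp add: zero_prod_def)
        qed
        then show ?thesis using on_D sc[OF v] by blast
      qed
      moreover have "homogeneous_polynomial (\<lambda>v::c5. 1)"
        unfolding homogeneous_polynomial_def by (auto intro: exI[of _ 0] poly_intros)
      ultimately show ?thesis unfolding separated_def using d(1,2) zero_neq_one by (metis (no_types, lifting))
    qed
  qed
qed

text \<open>Eliminating the second linear factor \<open>(\<alpha>, \<beta>)\<close> of the quadratic part gives a quadric G. It
  restricts to D as a multiple of the linear form K; if K vanishes, the vertical vector w of D is a square,
  all quadratic parts share its root, and this root supplies a linear G.\<close>

lemma separated_nondegenerate:
  assumes ind: "indep2 (snd \<phi>) (snd \<psi>)"
  shows "separated \<phi> \<psi>"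
proof -
  define l l' where "l = snd \<phi>" and "l' = snd \<psi>"
  define w where "w = cross3 l l'"
  have w0: "w \<noteq> 0" using ind unfolding indep2_iff_cross w_def l_def l'_def .
  have solve: "\<exists>P. l \<bullet> P = x \<and> l' \<bullet> P = y" for x y
  proof -
    \<comment> \<open>The vectors \<open>cross3 l' w\<close> and \<open>cross3 w l\<close> form, up
      to the factor \<open>w \<bullet> w\<close>, a basis dual to l, l'.\<close>
    define P where "P = (inverse (w \<bullet> w)) *\<^sub>R (x *\<^sub>R (cross3 l' w) + y *\<^sub>R (cross3 w l))"
    have "l \<bullet> (cross3 l' w) = w \<bullet> w" "l \<bullet> (cross3 w l) = 0" "l' \<bullet> (cross3 l' w) = 0" "l' \<bullet> (cross3 w l) = w \<bullet> w"
      unfolding w_def by (simp_all add: cross3_def inner_3 algebra_simps)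
    then have "l \<bullet> P = x" "l' \<bullet> P = y"
      using w0 by (simp_all add: P_def inner_add_right)
    then show ?thesis by blast
  qed
  obtain P where P: "l \<bullet> P = - fst \<phi> $ 1" "l' \<bullet> P = - fst \<psi> $ 1" using solve by blast
  obtain R where R: "l \<bullet> R = - fst \<phi> $ 2" "l' \<bullet> R = - fst \<psi> $ 2" using solve by blast
  have lw: "l \<bullet> w = 0" "l' \<bullet> w = 0" by (simp_all add: w_def dot_cross_self)
  \<comment> \<open>D is the graph of (k, h) |-> k P + h R, thickened by the vertical vector
    w.\<close>
  define D where "D k h \<tau> = (vector [k, h] :: real^2, k *\<^sub>R P + h *\<^sub>R R + \<tau> *\<^sub>R w)" for k h \<tau>
  have D: "\<phi> \<bullet> D k h \<tau> = 0" "\<psi> \<bullet> D k h \<tau> = 0" for k h \<tau>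
    using P R lw by (simp_all add: inner_c5 D_def inner_add_right l_def l'_def)
  \<comment> \<open>These vanish exactly if P and R overlap like \<open>lower b\<close> and
    \<open>upper b\<close> for a common b, so they measure how far the graph is from a Lagrangian
    plane.\<close>
  define \<kappa> \<mu> where "\<kappa> = P$2 - R$1" and "\<mu> = P$3 - R$2"
  have sc: "\<exists>k h \<alpha> \<beta>. fst v = vector [k, h] \<and> (\<alpha>, \<beta>) \<noteq> 0
       \<and> \<alpha> * (k * w$1 + h * w$2) + \<beta> * (k * w$2 + h * w$3) = 0
       \<and> \<alpha> * (k * P$1 + h * P$2 - snd v $ 1) + \<beta> * (k * P$2 + h * P$3 - snd v $ 2) = 0
       \<and> \<alpha> * (k * R$1 + h * R$2 - snd v $ 2) + \<beta> * (k * R$2 + h * R$3 - snd v $ 3) = 0"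
    if v: "second_char \<phi> \<psi> v" for v
  proof -
    from v obtain s t k h \<alpha> \<beta> m where *: "fst v = vector [k, h]" "(k, h) \<noteq> 0" "m = s *\<^sub>R snd \<phi> + t *\<^sub>R snd \<psi>" "m \<noteq> 0"
      and m: "m$1 = k * \<alpha>" "m$2 = k * \<beta> + h * \<alpha>" "m$3 = h * \<beta>"
      and e: "s * fst \<phi> $ 1 + t * fst \<psi> $ 1 + \<alpha> * snd v $ 1 + \<beta> * snd v $ 2 = 0"
        "s * fst \<phi> $ 2 + t * fst \<psi> $ 2 + \<alpha> * snd v $ 2 + \<beta> * snd v $ 3 = 0"
      by (rule second_charE)
    have "m \<bullet> w = 0" "m \<bullet> P = - (s * fst \<phi> $ 1 + t * fst \<psi> $ 1)" "m \<bullet> R = - (s * fst \<phi> $ 2 + t * fst \<psi> $ 2)"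
      using P R lw by (simp_all add: *(3) inner_add_left l_def[symmetric] l'_def[symmetric])
    then have "\<alpha> * (k * w$1 + h * w$2) + \<beta> * (k * w$2 + h * w$3) = 0"
       "\<alpha> * (k * P$1 + h * P$2 - snd v $ 1) + \<beta> * (k * P$2 + h * P$3 - snd v $ 2) = 0"
       "\<alpha> * (k * R$1 + h * R$2 - snd v $ 2) + \<beta> * (k * R$2 + h * R$3 - snd v $ 3) = 0"
      using e by (simp_all add: inner_3 m algebra_simps)
    moreover have "(\<alpha>, \<beta>) \<noteq> 0" using * m by (auto simp: zero_prod_def vec_eq_iff forall_3)
    ultimately show ?thesis using * by blast
  qed
  define K where "K k h \<tau> = k * (\<kappa> * w$2 - \<mu> * w$1) + h * (\<kappa> * w$3 - \<mu> * w$2) + \<tau> * (w$2 * w$2 - w$1 * w$3)" for k h \<tau>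
  show ?thesis
  proof (cases "\<forall>k h \<tau>. K k h \<tau> = 0")
    case False
    define G where "G v = (fst v $ 1 * w$1 + fst v $ 2 * w$2) * (fst v $ 1 * P$2 + fst v $ 2 * P$3 - snd v $ 2)
        - (fst v $ 1 * w$2 + fst v $ 2 * w$3) * (fst v $ 1 * P$1 + fst v $ 2 * P$2 - snd v $ 1)" for v :: c5
    have GD: "G (D k h \<tau>) = - h * K k h \<tau>" for k h \<tau>
      unfolding G_def D_def K_def \<kappa>_def \<mu>_def by simp algebra
    have "\<exists>k \<tau>. K k 1 \<tau> \<noteq> 0"
    proof (rule ccontr)
      assume "\<not> ?thesis"
      then have "K 0 1 0 = 0" "K 1 1 0 = 0" "K 0 1 1 = 0" by auto
      then show False using False by (simp add: K_def)
    qed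
    then obtain k \<tau> where "G (D k 1 \<tau>) \<noteq> 0" using GD by auto
    moreover have "homogeneous_polynomial G"
      unfolding homogeneous_polynomial_def
    proof
      show "real_polynomial_function G" unfolding G_def by (intro poly_intros)
      show "\<exists>d. \<forall>t v. G (t *\<^sub>R v) = t ^ d * G v"
        by (intro exI[of _ 2]) (simp add: G_def algebra_simps power2_eq_square)
    qed
    moreover have "G v = 0" if v: "second_char \<phi> \<psi> v" for v
    proof -
      obtain k h \<alpha> \<beta> where *: "fst v = vector [k, h]" "(\<alpha>, \<beta>) \<noteq> 0"
       "\<alpha> * (k * w$1 + h * w$2) + \<beta> * (k * w$2 + h * w$3) = 0"
       "\<alpha> * (k * P$1 + h * P$2 - snd v $ 1) + \<beta> * (k * P$2 + h * P$3 - snd v $ 2) = 0"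
        using sc[OF v] by blast
      have "\<alpha> * G v = 0" "\<beta> * G v = 0" using *(3,4) unfolding G_def *(1) vector_2 by algebra+
      then show ?thesis using *(2) by (auto simp: zero_prod_def)
    qed
    ultimately show ?thesis unfolding separated_def using D by blast
  next
    case True
    have K: "\<kappa> * w$2 = \<mu> * w$1" "\<kappa> * w$3 = \<mu> * w$2" "w$2 * w$2 = w$1 * w$3"
      using True[THEN spec, of 1, THEN spec, of 0, THEN spec, of 0] True[THEN spec, of 0, THEN spec, of 1, THEN spec, of 0]
        True[THEN spec, of 0, THEN spec, of 0, THEN spec, of 1] by (simp_all add: K_def)
    \<comment> \<open>Since w1 w3 = w2^2, w is a signed square \<open>\<epsilon>\<close> (x^2, x y,
      y^2), and the other two relations make (\<open>\<kappa>\<close>, \<open>\<mu>\<close>)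
      proportional to (x, y).\<close>
    obtain x y \<epsilon> where xy: "(x, y) \<noteq> (0 :: real \<times> real)" "\<epsilon> \<noteq> 0" "w$1 = \<epsilon> * x * x" "w$2 = \<epsilon> * x * y" "w$3 = \<epsilon> * y * y" "\<kappa> * y = \<mu> * x"
    proof (cases "w$1 = 0")
      case True
      then have "w$2 = 0" "w$3 \<noteq> 0" using K w0 by (auto simp: vec_eq_iff forall_3)
      then show thesis using that[of 0 1 "w$3"] True K by (simp add: zero_prod_def)
    next
      case False
      then show thesis using that[of "w$1" "w$2" "1 / w$1"] K by (simp add: zero_prod_def field_simps)
    qed
    define G where "G v = fst v $ 1 * x + fst v $ 2 * y" for v :: c5
    have "G (D x y 0) = x * x + y * y" by (simp add: G_def D_def)
    then have "G (D x y 0) \<noteq> 0" using xy(1) by (auto simp: zero_prod_def sum_squares_eq_zero_iff)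
    moreover have "homogeneous_polynomial G"
      unfolding homogeneous_polynomial_def
    proof
      show "real_polynomial_function G" unfolding G_def by (intro poly_intros)
      show "\<exists>d. \<forall>t v. G (t *\<^sub>R v) = t ^ d * G v"
        by (intro exI[of _ 1]) (simp add: G_def algebra_simps)
    qed
    moreover have "\<phi> \<bullet> v = 0 \<and> \<psi> \<bullet> v = 0 \<or> G v = 0" if v: "second_char \<phi> \<psi> v" for v
    proof (cases "G v = 0")
      case False
      obtain k h \<alpha> \<beta> where *: "fst v = vector [k, h]" "(\<alpha>, \<beta>) \<noteq> 0"
       and 1: "\<alpha> * (k * w$1 + h * w$2) + \<beta> * (k * w$2 + h * w$3) = 0"
       and 2: "\<alpha> * (k * P$1 + h * P$2 - snd v $ 1) + \<beta> * (k * P$2 + h * P$3 - snd v $ 2) = 0"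
       and 3: "\<alpha> * (k * R$1 + h * R$2 - snd v $ 2) + \<beta> * (k * R$2 + h * R$3 - snd v $ 3) = 0"
        using sc[OF v] by blast
      define c where "c = snd v - k *\<^sub>R P - h *\<^sub>R R"
      \<comment> \<open>The pairing of m with the square w splits into its values at (x, y). Away
        from G = 0 this fixes (\<open>\<alpha>\<close>, \<open>\<beta>\<close>) up to scale, and the
        other two equations then force the defect c of v from the graph to be a multiple of
        w.\<close>
      have "\<epsilon> * G v * (\<alpha> * x + \<beta> * y) = 0" using 1 unfolding G_def *(1) vector_2 xy by algebra
      then have ab: "\<alpha> * x + \<beta> * y = 0" using False xy(2) by simp
      then obtain r where r: "\<alpha> = - y * r" "\<beta> = x * r" using orthogonal_pair[OF xy(1)] by blast
      then have r0: "r \<noteq> 0" using *(2) by (auto simp: zero_prod_def)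
      have "r * (y * c$1 - x * c$2) = 0" "r * (y * c$2 - x * c$3) = 0"
        using 2 3 xy(6) unfolding r c_def \<kappa>_def \<mu>_def by (simp, algebra)+
      then have c: "y * c$1 = x * c$2" "y * c$2 = x * c$3" using r0 by simp_all
      obtain \<tau> where \<tau>: "c = \<tau> *\<^sub>R w"
      proof (cases "x = 0")
        case True
        then have "y \<noteq> 0" using xy by (simp add: zero_prod_def)
        then have "c$1 = 0" "c$2 = 0" using c True by auto
        then have "c = (c$3 / (\<epsilon> * y * y)) *\<^sub>R w" using \<open>y \<noteq> 0\<close> xy(2) True by (simp add: vec_eq_iff forall_3 xy)
        then show thesis using that by blast
      next
        case False
        then have "c = (c$1 / (\<epsilon> * x * x)) *\<^sub>R w"
          using xy(2) c by (simp add: vec_eq_iff forall_3 xy field_simps)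
        then show thesis using that by blast
      qed
      have "v = D k h \<tau>" using *(1) \<tau> by (simp add: D_def prod_eq_iff c_def algebra_simps)
      then show ?thesis using D by simp
    qed simp
    ultimately show ?thesis unfolding separated_def using D by blast
  qed
qed

text \<open>Kernel and second characteristics depend only on the span of the two covectors. If their
  vertical parts are dependent, a rotation and scaling of the pair makes one of them horizontal,
  which is the degenerate case; n is the determinant of this change of basis.\<close>

lemma separated:
  assumes ind: "indep2 \<phi> \<psi>" and nz: "snd \<phi> \<noteq> 0 \<or> snd \<psi> \<noteq> 0"
  shows "separated \<phi> \<psi>"
proof (cases "indep2 (snd \<phi>) (snd \<psi>)")
  case True
  then show ?thesis by (rule separated_nondegenerate)
next
  case False
  then obtain s0 t0 where st: "s0 *\<^sub>R snd \<phi> + t0 *\<^sub>R snd \<psi> = 0" "\<not> (s0 = 0 \<and> t0 = 0)" by blast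
  define n where "n = s0 * s0 + t0 * t0"
  have n: "n \<noteq> 0" using st by (auto simp: n_def sum_squares_eq_zero_iff)
  define \<phi>' \<psi>' where "\<phi>' = (- t0) *\<^sub>R \<phi> + s0 *\<^sub>R \<psi>" and "\<psi>' = s0 *\<^sub>R \<phi> + t0 *\<^sub>R \<psi>"
  have inv: "n *\<^sub>R \<phi> = s0 *\<^sub>R \<psi>' - t0 *\<^sub>R \<phi>'" "n *\<^sub>R \<psi> = t0 *\<^sub>R \<psi>' + s0 *\<^sub>R \<phi>'"
    by (simp_all add: \<phi>'_def \<psi>'_def n_def algebra_simps)
  have ker: "\<phi>' \<bullet> v = 0 \<and> \<psi>' \<bullet> v = 0 \<longleftrightarrow> \<phi> \<bullet> v = 0 \<and> \<psi> \<bullet> v = 0" for v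
  proof
    assume "\<phi>' \<bullet> v = 0 \<and> \<psi>' \<bullet> v = 0"
    then have "(n *\<^sub>R \<phi>) \<bullet> v = 0 \<and> (n *\<^sub>R \<psi>) \<bullet> v = 0" unfolding inv by (simp add: inner_add_left inner_diff_left)
    then show "\<phi> \<bullet> v = 0 \<and> \<psi> \<bullet> v = 0" using n by simp
  qed (simp add: \<phi>'_def \<psi>'_def inner_add_left inner_diff_left)
  have "snd \<psi>' = 0" using st by (simp add: \<psi>'_def)
  moreover have "\<psi>' \<noteq> 0" using ind st unfolding \<psi>'_def by blast
  moreover have "snd \<phi>' \<noteq> 0"
  proof
    assume "snd \<phi>' = 0"
    then have "snd (n *\<^sub>R \<phi>) = 0" "snd (n *\<^sub>R \<psi>) = 0" unfolding inv using \<open>snd \<psi>' = 0\<close> by simp_all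
    then show False using n nz by simp
  qed
  ultimately have sep: "separated \<phi>' \<psi>'" by (intro separated_degenerate)
  have "second_char \<phi>' \<psi>' v" if sc: "second_char \<phi> \<psi> v" for v
  proof -
    have comb: "s *\<^sub>R \<phi> + t *\<^sub>R \<psi> = ((s0 * t - t0 * s) / n) *\<^sub>R \<phi>' + ((s0 * s + t0 * t) / n) *\<^sub>R \<psi>'" for s t
    proof -
      have "n *\<^sub>R (s *\<^sub>R \<phi> + t *\<^sub>R \<psi>) = s *\<^sub>R (n *\<^sub>R \<phi>) + t *\<^sub>R (n *\<^sub>R \<psi>)" by (simp add: algebra_simps)
      also have "\<dots> = n *\<^sub>R (((s0 * t - t0 * s) / n) *\<^sub>R \<phi>' + ((s0 * s + t0 * t) / n) *\<^sub>R \<psi>')"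
        unfolding inv scaleR_add_right[of n] scaleR_scaleR times_divide_eq_right nonzero_mult_div_cancel_left[OF n]
        by (simp add: algebra_simps)
      finally show ?thesis using n by simp
    qed
    have "s *\<^sub>R snd \<phi> + t *\<^sub>R snd \<psi> = ((s0 * t - t0 * s) / n) *\<^sub>R snd \<phi>' + ((s0 * s + t0 * t) / n) *\<^sub>R snd \<psi>'" for s t
      using arg_cong[OF comb[of s t], of snd] by simp
    then show ?thesis using sc comb unfolding second_char_def by metis
  qed
  then show ?thesis using sep ker unfolding separated_def by meson
qed

subsection \<open>Planes, derivatives and characteristic directions\<close>

definition MA :: "(j2 \<Rightarrow> c5) \<Rightarrow> (j2 \<Rightarrow> c5) \<Rightarrow> j3 \<Rightarrow> real" where
  "MA \<Phi> \<Psi> y = ma (\<Phi> (fst y)) (\<Psi> (fst y)) (snd y)"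

abbreviation plane_vec :: "j3 \<Rightarrow> real \<Rightarrow> real \<Rightarrow> j2" where
  "plane_vec y k h \<equiv> k *\<^sub>R \<xi>1 y + h *\<^sub>R \<xi>2 y"

abbreviation null_dir :: "c5 \<Rightarrow> c5 \<Rightarrow> real^4 \<Rightarrow> real \<Rightarrow> real \<Rightarrow> bool" where
  "null_dir \<phi> \<psi> b k h \<equiv> ev1 \<phi> b * k + ev2 \<phi> b * h = 0 \<and> ev1 \<psi> b * k + ev2 \<psi> b * h = 0"

abbreviation evals :: "c5 \<Rightarrow> c5 \<Rightarrow> real^4 \<Rightarrow> real \<times> real \<times> real \<times> real" where
  "evals \<phi> \<psi> b \<equiv> (ev1 \<phi> b, ev2 \<phi> b, ev1 \<psi> b, ev2 \<psi> b)"

lemma inner_coords_plane_vec: "\<phi> \<bullet> coords (plane_vec y k h) = ev1 \<phi> (snd y) * k + ev2 \<phi> (snd y) * h"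
  unfolding coords_Lag2 by (simp add: inner_c5 ev1_def ev2_def inner_add_right algebra_simps)

lemma plane_vec_in_C1: "plane_vec y k h \<in> C1 (fst y)"
  using Lag2_subset_C1 mem_Lag2 by blast

lemma plane_vec_mem:
  assumes "annihilates \<phi> \<psi> (fst y) Dz"
  shows "plane_vec y k h \<in> Dz \<longleftrightarrow> null_dir \<phi> \<psi> (snd y) k h"
  using assms plane_vec_in_C1[of k y h] by (simp add: annihilates_def inner_coords_plane_vec)

lemma null_dir_exists:
  assumes "ma \<phi> \<psi> b = 0"
  obtains k h where "(k, h) \<noteq> 0" "null_dir \<phi> \<psi> b k h"
proof (cases "ev1 \<phi> b = 0 \<and> ev2 \<phi> b = 0")
  case True
  show thesis
  proof (cases "ev1 \<psi> b = 0 \<and> ev2 \<psi> b = 0")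
    case True
    then show thesis using that[of 1 0] \<open>ev1 \<phi> b = 0 \<and> ev2 \<phi> b = 0\<close> by (simp add: zero_prod_def)
  next
    case False
    then show thesis using that[of "ev2 \<psi> b" "- ev1 \<psi> b"] \<open>ev1 \<phi> b = 0 \<and> ev2 \<phi> b = 0\<close>
      by (auto simp: zero_prod_def)
  qed
next
  case False
  then show thesis using that[of "ev2 \<phi> b" "- ev1 \<phi> b"] assms
    by (auto simp: zero_prod_def ma_def algebra_simps)
qed

lemma null_dir_imp_ma:
  assumes "(k, h) \<noteq> 0" "null_dir \<phi> \<psi> b k h"
  shows "ma \<phi> \<psi> b = 0"
proof -
  have "k * ma \<phi> \<psi> b = 0" "h * ma \<phi> \<psi> b = 0" using assms(2) unfolding ma_def by algebra+
  then show ?thesis using assms(1) by (auto simp: zero_prod_def)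
qed

lemma Lag2_meets_iff:
  assumes "annihilates \<phi> \<psi> (fst y) Dz"
  shows "Lag2 y \<inter> Dz \<noteq> {0} \<longleftrightarrow> ma \<phi> \<psi> (snd y) = 0"
proof
  have "plane_vec y 0 0 \<in> Dz" unfolding plane_vec_mem[OF assms] by simp
  then have z: "0 \<in> Lag2 y \<inter> Dz" unfolding mem_Lag2 by (auto simp: Lag2_def span_0)
  {
    assume "Lag2 y \<inter> Dz \<noteq> {0}"
    then obtain \<nu> where "\<nu> \<in> Lag2 y" "\<nu> \<in> Dz" "\<nu> \<noteq> 0" using z by blast
    then obtain k h where "plane_vec y k h \<noteq> 0" "plane_vec y k h \<in> Dz" unfolding mem_Lag2 by blast
    then have "(k, h) \<noteq> 0" "null_dir \<phi> \<psi> (snd y) k h"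
      unfolding plane_vec_mem[OF assms] xi_comb_eq_0 by (auto simp: zero_prod_def)
    then show "ma \<phi> \<psi> (snd y) = 0" by (rule null_dir_imp_ma)
  next
    assume "ma \<phi> \<psi> (snd y) = 0"
    then obtain k h where "(k, h) \<noteq> 0" "null_dir \<phi> \<psi> (snd y) k h" by (rule null_dir_exists)
    then have "plane_vec y k h \<in> Lag2 y \<inter> Dz" "plane_vec y k h \<noteq> 0"
      unfolding Int_iff plane_vec_mem[OF assms] xi_comb_eq_0 mem_Lag2 by (auto simp: zero_prod_def)
    then show "Lag2 y \<inter> Dz \<noteq> {0}" by blast
  }
qed

text \<open>A nonzero 2 by 2 matrix has a kernel of dimension at most one, so the null direction
  already given exhausts the intersection.\<close>

lemma Lag2_inter_eq_span:
  assumes ann: "annihilates \<phi> \<psi> (fst y) Dz" and nz: "evals \<phi> \<psi> (snd y) \<noteq> 0"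
    and kh: "(k, h) \<noteq> 0" "null_dir \<phi> \<psi> (snd y) k h"
  shows "Lag2 y \<inter> Dz = span {plane_vec y k h}"
proof
  show "Lag2 y \<inter> Dz \<subseteq> span {plane_vec y k h}"
  proof
    fix \<nu> assume "\<nu> \<in> Lag2 y \<inter> Dz"
    then obtain k' h' where \<nu>1: "\<nu> = plane_vec y k' h'" and "\<nu> \<in> Dz" unfolding Int_iff mem_Lag2 by blast
    then have \<nu>: "\<nu> = plane_vec y k' h'" "null_dir \<phi> \<psi> (snd y) k' h'"
      using plane_vec_mem[OF ann] by simp_all
    obtain r where r: "ev1 \<phi> (snd y) = - h * r" "ev2 \<phi> (snd y) = k * r" using kh orthogonal_pair by metis
    obtain r' where r': "ev1 \<psi> (snd y) = - h * r'" "ev2 \<psi> (snd y) = k * r'" using kh orthogonal_pair by metis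
    have "r * (k * h' - h * k') = 0" "r' * (k * h' - h * k') = 0"
      using \<nu>(2) unfolding r r' by algebra+
    moreover have "r \<noteq> 0 \<or> r' \<noteq> 0" using nz r r' by (auto simp: zero_prod_def)
    ultimately have "(- h') * k + k' * h = 0" by (auto simp: algebra_simps)
    then obtain q where "- h' = - h * q" "k' = k * q" using orthogonal_pair[OF kh(1)] by metis
    then have "\<nu> = q *\<^sub>R plane_vec y k h" by (simp add: \<nu> algebra_simps)
    then show "\<nu> \<in> span {plane_vec y k h}" by (simp add: span_base span_scale)
  qed
  have "subspace Dz"
    using ann subspace_C1[of "fst y"] unfolding annihilates_def
    by (auto simp: subspace_def linear_add[OF linear_coords] linear_scale[OF linear_coords] linear_0[OF linear_coords] inner_add_right)
  then show "span {plane_vec y k h} \<subseteq> Lag2 y \<inter> Dz"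
    using kh plane_vec_mem[OF ann] by (intro span_minimal subspace_inter) (auto simp: mem_Lag2 simp flip: Lag2_def, simp add: Lag2_def)
qed

section \<open>Smoothness and fibre derivatives of the determinant\<close>

lemma smooth_on_ev:
  assumes "open V" "smooth_on V \<Phi>"
  shows "smooth_on (fst -` V) (\<lambda>y::j3. ev1 (\<Phi> (fst y)) (snd y))"
    and "smooth_on (fst -` V) (\<lambda>y::j3. ev2 (\<Phi> (fst y)) (snd y))"
proof -
  have o: "open (fst -` V :: j3 set)" using assms(1) by (rule open_vimage_fst)
  have \<Phi>: "smooth_on (fst -` V) (\<lambda>y::j3. \<Phi> (fst y))"
    by (rule smooth_on_compose_linear[OF assms(1) bounded_linear_fst assms(2)])
  have lin: "bounded_linear (\<lambda>y::j3. (0, lower (snd y)) :: c5)" "bounded_linear (\<lambda>y::j3. (0, upper (snd y)) :: c5)"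
    by (auto intro!: linear_linear[THEN iffD2] linearI simp: linear_add[OF linear_lower] linear_scale[OF linear_lower]
        linear_add[OF linear_upper] linear_scale[OF linear_upper])
  have "ev1 \<phi> b = \<phi> \<bullet> ((axis 1 1, 0) + (0, lower b))" "ev2 \<phi> b = \<phi> \<bullet> ((axis 2 1, 0) + (0, upper b))" for \<phi> b
    by (simp_all add: ev1_def ev2_def inner_c5 axis_def)
  then show "smooth_on (fst -` V) (\<lambda>y::j3. ev1 (\<Phi> (fst y)) (snd y))"
    and "smooth_on (fst -` V) (\<lambda>y::j3. ev2 (\<Phi> (fst y)) (snd y))"
    using smooth_on_inner[OF o \<Phi> smooth_on_add[OF o smooth_on_const smooth_on_linear[OF lin(1)]]]
      smooth_on_inner[OF o \<Phi> smooth_on_add[OF o smooth_on_const smooth_on_linear[OF lin(2)]]]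
    by (simp_all only:)
qed

lemma smooth_on_MA:
  assumes "open V" "smooth_on V \<Phi>" "smooth_on V \<Psi>"
  shows "smooth_on (fst -` V) (MA \<Phi> \<Psi>)"
  using smooth_on_ev[OF assms(1,2)] smooth_on_ev[OF assms(1,3)] open_vimage_fst[OF assms(1)]
  unfolding MA_def ma_def by (intro smooth_intros)

lemma MA_fibre_derivative:
  assumes "open V" "smooth_on V \<Phi>" "smooth_on V \<Psi>" "fst y \<in> V"
  shows "frechet_derivative (MA \<Phi> \<Psi>) (at y) (0, \<delta>) = dma (\<Phi> (fst y)) (\<Psi> (fst y)) (snd y) \<delta>"
proof -
  have "MA \<Phi> \<Psi> differentiable (at (y + 0 *\<^sub>R (0, \<delta>)))"
    using smooth_on_imp_differentiable[OF smooth_on_MA[OF assms(1-3)]] assms(4) by simp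
  from directional_derivative[OF this]
  have "((\<lambda>s. MA \<Phi> \<Psi> (y + s *\<^sub>R (0, \<delta>))) has_real_derivative frechet_derivative (MA \<Phi> \<Psi>) (at y) (0, \<delta>)) (at 0)"
    by (simp only: scaleR_zero_left add_0_right)
  moreover have "((\<lambda>s. MA \<Phi> \<Psi> (y + s *\<^sub>R (0, \<delta>))) has_real_derivative dma (\<Phi> (fst y)) (\<Psi> (fst y)) (snd y) \<delta>) (at 0)"
    unfolding MA_def by (auto intro!: derivative_eq_intros simp: ma_expansion)
  ultimately show ?thesis by (rule DERIV_unique)
qed

lemma fibre_derivative_sum:
  assumes "F differentiable (at (y::j3))"
  shows "frechet_derivative F (at y) (0, \<delta>) = (\<chi> i. fibre_deriv F y i) \<bullet> \<delta>"
proof -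
  have lin: "linear (frechet_derivative F (at y))" using assms by (rule linear_frechet_derivative)
  have l2: "linear (\<lambda>\<delta>. frechet_derivative F (at y) (0, \<delta>))"
    using linear_add[OF lin, of "(0,_)" "(0,_)"] linear_scale[OF lin, of _ "(0,_)"]
    by (intro linearI) simp_all
  have "\<delta> = (\<Sum>i\<in>UNIV. \<delta> $ i *\<^sub>R axis i 1)"
    using basis_expansion[of \<delta>] by (simp add: scalar_mult_eq_scaleR)
  then have "frechet_derivative F (at y) (0, \<delta>) = (\<Sum>i\<in>UNIV. \<delta> $ i * fibre_deriv F y i)"
    using linear_sum[OF l2, of "\<lambda>i. \<delta> $ i *\<^sub>R axis i 1" UNIV] linear_scale[OF l2]
    by (simp add: fibre_deriv_def)
  then show ?thesis by (simp add: inner_vec_def mult.commute)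
qed

lemma fibre_restriction:
  assumes "(F :: j3 \<Rightarrow> real) differentiable (at (z, b))"
  shows "(\<lambda>b. F (z, b)) differentiable (at b)"
    "frechet_derivative (\<lambda>b. F (z, b)) (at b) \<delta> = frechet_derivative F (at (z, b)) (0, \<delta>)"
proof -
  have "((\<lambda>b. (z, b)) has_derivative (\<lambda>\<delta>. (0, \<delta>))) (at b)" by (auto intro!: derivative_eq_intros)
  moreover have "(F has_derivative frechet_derivative F (at (z, b))) (at (z, b))"
    using assms frechet_derivative_works by blast
  ultimately have d: "((\<lambda>b. F (z, b)) has_derivative (\<lambda>\<delta>. frechet_derivative F (at (z, b)) (0, \<delta>))) (at b)"
    by (rule has_derivative_compose)
  then show "(\<lambda>b. F (z, b)) differentiable (at b)" by (auto simp: differentiable_def)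
  show "frechet_derivative (\<lambda>b. F (z, b)) (at b) \<delta> = frechet_derivative F (at (z, b)) (0, \<delta>)"
    using frechet_derivative_at[OF d] by metis
qed

text \<open>If the plane were contained in the 3-dimensional space, the fibre of the Monge-Ampere equation
  would be a quadric cone with vertex b; such a cone contains no hyperplane.\<close>

lemma smooth_point_evals:
  assumes y: "y \<in> smooth_points E" and ind: "indep2 \<phi> \<psi>"
    and W0: "open W0" "y \<in> W0" "\<And>b. (fst y, b) \<in> E \<inter> W0 \<Longrightarrow> ma \<phi> \<psi> b = 0"
  shows "evals \<phi> \<psi> (snd y) \<noteq> 0"
proof
  assume z: "evals \<phi> \<psi> (snd y) = 0"
  then have ev: "ev1 \<phi> (snd y) = 0" "ev2 \<phi> (snd y) = 0" "ev1 \<psi> (snd y) = 0" "ev2 \<psi> (snd y) = 0"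
    by (simp_all add: zero_prod_def)
  obtain z b where yz: "y = (z, b)" by fastforce
  obtain W F i where W: "y \<in> W" "open W" "smooth_on W F" "E \<inter> W = {y\<in>W. F y = 0}"
    and i: "fibre_deriv F y i \<noteq> 0" and yE: "y \<in> E"
    using y unfolding smooth_points_def local_equation_def by blast
  have Fd: "F differentiable (at (z, b))" using smooth_on_imp_differentiable[OF W(3,1)] by (simp add: yz)
  have mab: "ma \<phi> \<psi> (b + \<delta>) = qma (snd \<phi>) (snd \<psi>) \<delta>" for \<delta>
    using ma_expansion[of \<phi> \<psi> b 1 \<delta>] ev by (simp add: yz ma_def dma_def)
  have ind': "indep2 (snd \<phi>) (snd \<psi>)"
  proof (intro allI impI)
    fix s t assume "s *\<^sub>R snd \<phi> + t *\<^sub>R snd \<psi> = 0"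
    then have "s *\<^sub>R \<phi> + t *\<^sub>R \<psi> = 0" using ev by (intro ev_zero_imp_zero[of _ "snd y"]) (simp_all add: ev_linear)
    then show "s = 0 \<and> t = 0" using ind by blast
  qed
  define c where "c = (\<chi> i. fibre_deriv F y i)"
  have c: "c \<noteq> 0" using i by (auto simp: c_def vec_eq_iff)
  have dF: "frechet_derivative (\<lambda>b. F (z, b)) (at b) \<delta> = c \<bullet> \<delta>" for \<delta>
    using fibre_restriction(2)[OF Fd] fibre_derivative_sum[OF Fd] by (simp add: c_def yz)
  define W' where "W' = {b. (z, b) \<in> W \<inter> W0}"
  have W': "W' = (\<lambda>b. (z, b)) -` (W \<inter> W0)" by (auto simp: W'_def)
  have oW': "open W'"
    unfolding W' using W W0 by (intro continuous_open_vimage) (auto intro!: continuous_intros)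
  have "qma (snd \<phi>) (snd \<psi>) \<delta> = 0" if "c \<bullet> \<delta> = 0" for \<delta>
  proof (rule zero_set_tangent_cone[OF oW', of b "\<lambda>b. F (z, b)" c])
    show "b \<in> W'" using W W0 by (simp add: W'_def yz)
    show "continuous_on W' (\<lambda>b. F (z, b))"
      by (rule continuous_on_compose2[OF smooth_on_imp_continuous_on[OF W(3)]])
        (auto simp: W'_def intro!: continuous_intros)
    show "(\<lambda>b. F (z, b)) differentiable at b" by (rule fibre_restriction(1)[OF Fd])
    show "F (z, b) = 0" using yE W by (auto simp: yz)
    show "frechet_derivative (\<lambda>b. F (z, b)) (at b) c \<noteq> 0" using c by (simp add: dF)
    show "continuous_on UNIV (qma (snd \<phi>) (snd \<psi>))"
      unfolding qma_def by (intro continuous_intros linear_continuous_on linear_linear[THEN iffD2] linear_lower linear_upper)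
    show "qma (snd \<phi>) (snd \<psi>) \<delta> = 0" if "t > 0" "qma (snd \<phi>) (snd \<psi>) (t *\<^sub>R \<delta>) = 0" for t \<delta>
      using that by (simp add: qma_def linear_scale[OF linear_lower] linear_scale[OF linear_upper])
    show "qma (snd \<phi>) (snd \<psi>) \<delta> = 0" if "b + \<delta> \<in> W'" "F (z, b + \<delta>) = 0" for \<delta>
    proof -
      have "(fst y, b + \<delta>) \<in> E \<inter> W0" using that W(4) by (auto simp: W'_def yz)
      from W0(3)[OF this] show ?thesis by (simp add: mab)
    qed
    show "frechet_derivative (\<lambda>b. F (z, b)) (at b) \<delta> = 0" using that by (simp add: dF)
  qed
  then show False using qma_not_zero_on_hyperplane[OF ind' c] by blast
qed

text \<open>F vanishes along any curve in the fibre of E near its starting point. This converts the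
  tangency in \<open>characteristic\<close>, which is phrased with curves, into a linear condition
  on the derivative.\<close>

lemma tangent_fibre_derivative:
  fixes F :: "j3 \<Rightarrow> real"
  assumes W: "open W" "smooth_on W F" "E \<inter> W = {y\<in>W. F y = 0}" and y: "(z, b) \<in> W"
    and \<delta>: "\<delta> \<in> tangent_vectors (fibre E z) b"
  shows "frechet_derivative F (at (z, b)) (0, \<delta>) = 0"
proof -
  obtain \<gamma> \<epsilon> where \<gamma>: "\<epsilon> > 0" "\<gamma> 0 = b" "\<And>t. t \<in> {-\<epsilon><..<\<epsilon>} \<Longrightarrow> (z, \<gamma> t) \<in> E"
     "(\<gamma> has_vector_derivative \<delta>) (at 0)"
    using \<delta> unfolding tangent_vectors_def fibre_def by blast
  have Fd: "F differentiable (at (z, b))" using smooth_on_imp_differentiable[OF W(2) y] .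
  have d: "(\<gamma> has_derivative (\<lambda>t. t *\<^sub>R \<delta>)) (at 0)" using \<gamma>(4) by (simp add: has_vector_derivative_def)
  have f: "((\<lambda>b. F (z, b)) has_derivative (\<lambda>\<delta>. frechet_derivative F (at (z, b)) (0, \<delta>))) (at (\<gamma> 0))"
    using fibre_restriction[OF Fd] frechet_derivative_works[of "\<lambda>b. F (z, b)" "at b"] \<gamma>(2)
    by (metis (no_types, lifting) ext)
  have "((\<lambda>t. F (z, \<gamma> t)) has_derivative (\<lambda>t. frechet_derivative F (at (z, b)) (0, t *\<^sub>R \<delta>))) (at 0)"
    by (rule has_derivative_compose[OF d f])
  moreover have "((\<lambda>t. F (z, \<gamma> t)) has_derivative (\<lambda>t. 0)) (at 0)"
  proof (rule has_derivative_transform_eventually[where f = "\<lambda>t. 0"])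
    have "isCont \<gamma> 0" using d has_derivative_continuous by blast
    then have "((\<lambda>t. (z, \<gamma> t)) \<longlongrightarrow> (z, b)) (at 0)"
      using \<gamma>(2) by (auto simp: isCont_def intro!: tendsto_intros)
    then have "\<forall>\<^sub>F t in at 0. (z, \<gamma> t) \<in> W" using W(1) y by (rule topological_tendstoD)
    moreover have "\<forall>\<^sub>F t in at 0. t \<in> {-\<epsilon><..<\<epsilon>}"
      using \<gamma>(1) eventually_nhds_in_open[of "{-\<epsilon><..<\<epsilon>}" 0] by (auto simp: eventually_at_filter elim: eventually_mono)
    ultimately show "\<forall>\<^sub>F t in at 0. 0 = F (z, \<gamma> t)"
      by eventually_elim (use \<gamma>(3) W(3) in auto)
    show "0 = F (z, \<gamma> 0)" using \<gamma>(1,2) \<gamma>(3)[of 0] W(3) y by auto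
  qed auto
  ultimately have "(\<lambda>t::real. frechet_derivative F (at (z, b)) (0, t *\<^sub>R \<delta>)) = (\<lambda>t. 0)"
    by (rule has_derivative_unique)
  from fun_cong[OF this, of 1] show ?thesis by simp
qed

section \<open>The prolongation of a line and its tangent directions\<close>

lemma plane_vec_shift:
  assumes "k *\<^sub>R lower b' + h *\<^sub>R upper b' = k *\<^sub>R lower b + h *\<^sub>R upper b"
  shows "plane_vec (z, b') k h = plane_vec (z, b) k h"
proof (rule inj_onD[OF coords_inj_on_C1[of z]])
  show "coords (plane_vec (z, b') k h) = coords (plane_vec (z, b) k h)"
    unfolding coords_Lag2 using assms by simp
qed (use plane_vec_in_C1[of k "(z, _)" h] in simp_all)

lemma plane_vec_in_Lag2:
  assumes "plane_vec (z, b) k h \<in> Lag2 (z, b')"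
  shows "k *\<^sub>R lower b' + h *\<^sub>R upper b' = k *\<^sub>R lower b + h *\<^sub>R upper b"
proof -
  obtain k' h' where "coords (plane_vec (z, b) k h) = coords (plane_vec (z, b') k' h')"
    using assms unfolding mem_Lag2 by metis
  then have "k' = k" "h' = h" "k *\<^sub>R lower b + h *\<^sub>R upper b = k' *\<^sub>R lower b' + h' *\<^sub>R upper b'"
    unfolding coords_Lag2 by (auto simp: vec_eq_iff[of "vector _"] forall_2)
  then show ?thesis by simp
qed

lemma affine_curve_tangent:
  assumes "\<epsilon> > 0" "\<And>t. \<bar>t\<bar> < \<epsilon> \<Longrightarrow> b + t *\<^sub>R \<delta> \<in> S"
  shows "\<delta> \<in> tangent_vectors S (b :: 'e::real_normed_vector)"
  unfolding tangent_vectors_def mem_Collect_eq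
proof (intro exI conjI ballI)
  show "smooth_on {-\<epsilon><..<\<epsilon>} (\<lambda>t. b + t *\<^sub>R \<delta>)"
    by (intro smooth_intros smooth_on_linear) (auto intro: bounded_linear_scaleR_left)
  show "((\<lambda>t. b + t *\<^sub>R \<delta>) has_vector_derivative \<delta>) (at 0)"
    by (auto intro!: derivative_eq_intros simp: has_vector_derivative_def)
  show "b + t *\<^sub>R \<delta> \<in> S" if "t \<in> {-\<epsilon><..<\<epsilon>}" for t
    using that by (intro assms(2)) auto
qed (use assms(1) in simp_all)

text \<open>The planes containing the line form an affine subspace of the fibre: the horizontal
  components of the vector fix its coefficients k, h in every such plane, leaving a linear equation
  for the vertical components.\<close>

lemma tangent_prolong_line:
  "\<delta> \<in> tangent_vectors (prolong_line z (span {plane_vec (z, b) k h})) b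
    \<longleftrightarrow> k *\<^sub>R lower \<delta> + h *\<^sub>R upper \<delta> = 0"
proof
  assume "\<delta> \<in> tangent_vectors (prolong_line z (span {plane_vec (z, b) k h})) b"
  then obtain \<gamma> \<epsilon> where \<gamma>: "\<epsilon> > 0" "\<And>t. t \<in> {-\<epsilon><..<\<epsilon>} \<Longrightarrow> \<gamma> t \<in> prolong_line z (span {plane_vec (z, b) k h})"
    "(\<gamma> has_vector_derivative \<delta>) (at 0)"
    unfolding tangent_vectors_def by blast
  define L where "L b = k *\<^sub>R lower b + h *\<^sub>R upper b" for b
  have "linear L" unfolding L_def
    by (intro linear_compose_add linear_compose_scale_right linear_lower linear_upper)
  then have "bounded_linear L" by (simp add: linear_linear)
  then have "((\<lambda>t. L (\<gamma> t)) has_vector_derivative L \<delta>) (at 0)"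
    using \<gamma>(3) by (rule bounded_linear.has_vector_derivative)
  moreover have "((\<lambda>t. L (\<gamma> t)) has_vector_derivative 0) (at 0)"
  proof (rule has_vector_derivative_transform_within_open[where f = "\<lambda>t. L b" and S = "{-\<epsilon><..<\<epsilon>}"])
    show "L b = L (\<gamma> t)" if "t \<in> {-\<epsilon><..<\<epsilon>}" for t
    proof -
      have "plane_vec (z, b) k h \<in> Lag2 (z, \<gamma> t)"
        using \<gamma>(2)[OF that] span_base[of "plane_vec (z, b) k h"] by (auto simp: prolong_line_def)
      from plane_vec_in_Lag2[OF this] show ?thesis by (simp add: L_def)
    qed
  qed (use \<gamma>(1) in auto)
  ultimately have "L \<delta> = 0" by (rule vector_derivative_unique_at)
  then show "k *\<^sub>R lower \<delta> + h *\<^sub>R upper \<delta> = 0" by (simp add: L_def)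
next
  assume \<delta>: "k *\<^sub>R lower \<delta> + h *\<^sub>R upper \<delta> = 0"
  show "\<delta> \<in> tangent_vectors (prolong_line z (span {plane_vec (z, b) k h})) b"
  proof (rule affine_curve_tangent)
    fix t :: real
    have "k *\<^sub>R lower (b + t *\<^sub>R \<delta>) + h *\<^sub>R upper (b + t *\<^sub>R \<delta>)
      = k *\<^sub>R lower b + h *\<^sub>R upper b + t *\<^sub>R (k *\<^sub>R lower \<delta> + h *\<^sub>R upper \<delta>)"
      by (simp add: linear_add[OF linear_lower] linear_scale[OF linear_lower]
          linear_add[OF linear_upper] linear_scale[OF linear_upper] algebra_simps)
    then have "plane_vec (z, b + t *\<^sub>R \<delta>) k h = plane_vec (z, b) k h"
      using \<delta> by (intro plane_vec_shift) simp
    then have "plane_vec (z, b) k h \<in> Lag2 (z, b + t *\<^sub>R \<delta>)" unfolding mem_Lag2 by metis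
    then show "b + t *\<^sub>R \<delta> \<in> prolong_line z (span {plane_vec (z, b) k h})"
      by (simp add: prolong_line_def Lag2_def span_minimal)
  qed (rule zero_less_one)
qed

subsection \<open>Projective varieties\<close>

lemma polynomial_zero_on_line:
  fixes f :: "'e::euclidean_space \<Rightarrow> real"
  assumes "real_polynomial_function f" "infinite {t. f (x + t *\<^sub>R y) = 0}"
  shows "f (x + s *\<^sub>R y) = 0"
proof -
  have "polynomial_function (\<lambda>t::real. x + t *\<^sub>R y)"
    by (intro polynomial_function_add polynomial_function_const polynomial_function_bounded_linear
        bounded_linear_scaleR_left)
  from real_polynomial_function_compose[OF this assms(1)]
  obtain a n where "f \<circ> (\<lambda>t. x + t *\<^sub>R y) = (\<lambda>t. \<Sum>i\<le>n. a i * t ^ i)"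
    using real_polynomial_function_imp_sum by blast
  then have a: "f (x + t *\<^sub>R y) = (\<Sum>i\<le>n. a i * t ^ i)" for t
    by (metis comp_apply)
  have "\<forall>i\<le>n. a i = 0"
    using assms(2) polyfun_roots_finite[of a _ n] unfolding a by blast
  then show ?thesis unfolding a by simp
qed

text \<open>On the line joining a nonzero of f to a nonzero of g, one of the two polynomials has
  infinitely many zeros and hence vanishes on the whole line, including its own nonzero.\<close>

lemma polynomial_product_zero:
  fixes f g :: "'e::euclidean_space \<Rightarrow> real"
  assumes f: "real_polynomial_function f" and g: "real_polynomial_function g" and T: "subspace T"
    and fg: "\<And>w. w \<in> T \<Longrightarrow> f w = 0 \<or> g w = 0"
  shows "(\<forall>w\<in>T. f w = 0) \<or> (\<forall>w\<in>T. g w = 0)"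
proof (rule ccontr)
  assume "\<not> ?thesis"
  then obtain d e where de: "d \<in> T" "f d \<noteq> 0" "e \<in> T" "g e \<noteq> 0" by blast
  have "d + t *\<^sub>R (e - d) \<in> T" for t
    using de T by (intro subspace_add subspace_scale subspace_diff)
  then have "{t. f (d + t *\<^sub>R (e - d)) = 0} \<union> {t. g (d + t *\<^sub>R (e - d)) = 0} = UNIV"
    using fg by blast
  then have "infinite {t. f (d + t *\<^sub>R (e - d)) = 0} \<or> infinite {t. g (d + t *\<^sub>R (e - d)) = 0}"
    by (metis finite_Un infinite_UNIV_char_0)
  then show False
    using polynomial_zero_on_line[OF f, of d "e - d" 0] polynomial_zero_on_line[OF g, of d "e - d" 1] de
    by auto
qed

lemma homogeneous_mult:
  "homogeneous_polynomial f \<Longrightarrow> homogeneous_polynomial g \<Longrightarrow> homogeneous_polynomial (\<lambda>v. f v * g v)"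
  unfolding homogeneous_polynomial_def
proof (elim conjE exE, intro conjI)
  fix d d' assume h: "\<forall>t v. f (t *\<^sub>R v) = t ^ d * f v" "\<forall>t v. g (t *\<^sub>R v) = t ^ d' * g v"
  show "\<exists>d. \<forall>t v. f (t *\<^sub>R v) * g (t *\<^sub>R v) = t ^ d * (f v * g v)"
    by (intro exI[of _ "d + d'"]) (simp add: h power_add)
qed (auto intro: real_polynomial_function.intros)

lemma homogeneous_linear: "homogeneous_polynomial (\<lambda>v. n \<bullet> v)"
  unfolding homogeneous_polynomial_def
  by (auto intro!: real_polynomial_function.intros bounded_linear_inner_right exI[of _ 1])

lemma proj_spaceD: "H \<in> proj_space S \<Longrightarrow> subspace H" "H \<in> proj_space S \<Longrightarrow> 0 \<in> H" "H \<in> proj_space S \<Longrightarrow> H \<subseteq> S"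
  by (auto simp: proj_space_def subspace_0)

lemma proj_space_mono: "S \<subseteq> T \<Longrightarrow> proj_space S \<subseteq> proj_space T"
  by (auto simp: proj_space_def)

lemma line_in_proj_space:
  assumes "subspace S" "v \<in> S" "v \<noteq> 0"
  shows "span {v} \<in> proj_space S"
  using assms by (auto simp: proj_space_def span_minimal dim_insert intro: subspace_span)

lemma proj_space_line:
  assumes "H \<in> proj_space S"
  obtains v where "v \<in> S" "v \<noteq> 0" "H = span {v}"
proof -
  have H: "subspace H" "dim H = 1" "H \<subseteq> S" using assms by (auto simp: proj_space_def)
  obtain v where v: "v \<in> H" "v \<noteq> 0"
    using H(2) dim_eq_0[of H] by auto
  have "span {v} = H"
    using v H by (intro subspace_dim_equal) (auto simp: span_minimal dim_insert)
  then show thesis using that v H by blast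
qed

lemma proj_variety_proj_space:
  assumes T: "subspace T" "T \<subseteq> S"
  shows "proj_variety S (proj_space T)"
  unfolding proj_variety_def
proof (intro exI conjI ballI)
  let ?Q = "(\<lambda>n v. n \<bullet> v) ` (T\<^sup>\<bottom>)"
  show "homogeneous_polynomial f" if "f \<in> ?Q" for f
    using that homogeneous_linear by blast
  show "proj_space T = {H \<in> proj_space S. \<forall>f\<in>?Q. \<forall>v\<in>H. f v = 0}"
  proof (intro set_eqI iffI)
    fix H assume "H \<in> proj_space T"
    then show "H \<in> {H \<in> proj_space S. \<forall>f\<in>?Q. \<forall>v\<in>H. f v = 0}"
      using T by (auto simp: proj_space_def orthogonal_comp_def orthogonal_def inner_commute)
  next
    fix H assume H: "H \<in> {H \<in> proj_space S. \<forall>f\<in>?Q. \<forall>v\<in>H. f v = 0}"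
    then have "H \<subseteq> (T\<^sup>\<bottom>)\<^sup>\<bottom>"
      by (auto simp: orthogonal_comp_def[of "T\<^sup>\<bottom>"] orthogonal_def)
    then show "H \<in> proj_space T" using H T by (auto simp: proj_space_def orthogonal_comp_self)
  qed
qed

lemma proj_variety_Int: "proj_variety S X \<Longrightarrow> proj_variety S Y \<Longrightarrow> proj_variety S (X \<inter> Y)"
  unfolding proj_variety_def
proof (elim exE conjE)
  fix Q Q' assume "\<forall>f\<in>Q. homogeneous_polynomial f" "\<forall>f\<in>Q'. homogeneous_polynomial f"
    "X = {H \<in> proj_space S. \<forall>f\<in>Q. \<forall>v\<in>H. f v = 0}" "Y = {H \<in> proj_space S. \<forall>f\<in>Q'. \<forall>v\<in>H. f v = 0}"
  then show "\<exists>Q. (\<forall>f\<in>Q. homogeneous_polynomial f) \<and> X \<inter> Y = {H \<in> proj_space S. \<forall>f\<in>Q. \<forall>v\<in>H. f v = 0}"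
    by (intro exI[of _ "Q \<union> Q'"]) blast
qed

lemma proj_variety_Un: "proj_variety S X \<Longrightarrow> proj_variety S Y \<Longrightarrow> proj_variety S (X \<union> Y)"
  unfolding proj_variety_def
proof (elim exE conjE)
  fix Q Q' assume Q: "\<forall>f\<in>Q. homogeneous_polynomial f" "\<forall>f\<in>Q'. homogeneous_polynomial f"
    and XY: "X = {H \<in> proj_space S. \<forall>f\<in>Q. \<forall>v\<in>H. f v = 0}" "Y = {H \<in> proj_space S. \<forall>f\<in>Q'. \<forall>v\<in>H. f v = 0}"
  let ?R = "{\<lambda>v. f v * g v | f g. f \<in> Q \<and> g \<in> Q'}"
  have "H \<in> X \<union> Y" if H: "H \<in> proj_space S" "\<forall>f\<in>?R. \<forall>v\<in>H. f v = 0" for H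
  proof (rule ccontr)
    assume "H \<notin> X \<union> Y"
    then obtain f g where fg: "f \<in> Q" "g \<in> Q'" "\<not> (\<forall>v\<in>H. f v = 0)" "\<not> (\<forall>v\<in>H. g v = 0)"
      using H(1) XY by blast
    have "(\<lambda>v. f v * g v) \<in> ?R" using fg by blast
    from bspec[OF H(2) this] have "\<forall>v\<in>H. f v * g v = 0" .
    \<comment> \<open>The equations hold pointwise on H, so a product might vanish with the factors
      sharing the work; H is a subspace, so one factor vanishes on all of it.\<close>
    then show False
      using polynomial_product_zero[of f g H] Q fg proj_spaceD(1)[OF H(1)]
      by (auto simp: homogeneous_polynomial_def)
  qed
  then have "X \<union> Y = {H \<in> proj_space S. \<forall>f\<in>?R. \<forall>v\<in>H. f v = 0}"
    using XY by auto
  moreover have "\<forall>f\<in>?R. homogeneous_polynomial f" using Q homogeneous_mult by blast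
  ultimately show "\<exists>Q. (\<forall>f\<in>Q. homogeneous_polynomial f) \<and> X \<union> Y = {H \<in> proj_space S. \<forall>f\<in>Q. \<forall>v\<in>H. f v = 0}"
    by blast
qed

lemma zariski_closure_superset: "X \<subseteq> zariski_closure S X"
  by (auto simp: zariski_closure_def)

lemma zariski_closure_minimal: "proj_variety S Y \<Longrightarrow> X \<subseteq> Y \<Longrightarrow> zariski_closure S X \<subseteq> Y"
  by (auto simp: zariski_closure_def)

lemma zariski_closure_mono: "X \<subseteq> Y \<Longrightarrow> zariski_closure S X \<subseteq> zariski_closure S Y"
  by (auto simp: zariski_closure_def)

section \<open>Linear subvarieties: irreducibility, maximality and density\<close>

lemma irreducible_proj_space:
  assumes T: "subspace T" "T \<subseteq> S" "T \<noteq> {0}"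
  shows "irreducible_variety S (proj_space T)"
  unfolding irreducible_variety_def
proof (intro conjI allI impI)
  show "proj_variety S (proj_space T)" using T by (intro proj_variety_proj_space)
  obtain v where "v \<in> T" "v \<noteq> 0" using T subspace_0 by blast
  then show "proj_space T \<noteq> {}" using line_in_proj_space T by blast
  fix Y Z assume YZ: "proj_variety S Y \<and> proj_variety S Z \<and> proj_space T = Y \<union> Z"
  then obtain Q Q' where Q: "\<forall>f\<in>Q. homogeneous_polynomial f" "\<forall>f\<in>Q'. homogeneous_polynomial f"
    and Y: "Y = {H \<in> proj_space S. \<forall>f\<in>Q. \<forall>v\<in>H. f v = 0}" and Z: "Z = {H \<in> proj_space S. \<forall>f\<in>Q'. \<forall>v\<in>H. f v = 0}"
    unfolding proj_variety_def by blast
  show "proj_space T = Y \<or> proj_space T = Z"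
  proof (rule ccontr)
    assume "\<not> ?thesis"
    then obtain H H' where H: "H \<in> proj_space T" "H \<notin> Y" "H' \<in> proj_space T" "H' \<notin> Z" using YZ by blast
    then obtain f g where f: "f \<in> Q" "\<not> (\<forall>v\<in>H. f v = 0)" and g: "g \<in> Q'" "\<not> (\<forall>v\<in>H'. g v = 0)"
      using Y Z proj_space_mono[OF T(2)] by blast
    have "f w = 0 \<or> g w = 0" if "w \<in> T" for w
    proof -
      obtain K where "K \<in> proj_space T" "w \<in> K"
      proof (cases "w = 0")
        case True
        then show thesis using that H(1) proj_spaceD(2) by blast
      next
        case False
        then show thesis using that line_in_proj_space[OF T(1) \<open>w \<in> T\<close>] by (meson insertI1 span_base)
      qed
      then show ?thesis using YZ Y Z f(1) g(1) by blast
    qed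
    then have "(\<forall>w\<in>T. f w = 0) \<or> (\<forall>w\<in>T. g w = 0)"
      using Q f g T(1) by (intro polynomial_product_zero) (auto simp: homogeneous_polynomial_def)
    then show False using f g H proj_spaceD(3) by blast
  qed
qed

text \<open>The closure of L lies in the union of P(T) and the variety G = 0, so an irreducible X'
  between P(T) and the closure lies in one of them. It cannot be the second, which misses a line of
  P(T).\<close>

lemma irreducible_component_proj_space:
  assumes T: "subspace T" "T \<subseteq> S" "T \<noteq> {0}"
    and sub: "proj_space T \<subseteq> zariski_closure S L"
    and G: "homogeneous_polynomial G" "d \<in> T" "G d \<noteq> 0"
    and L: "\<And>H. H \<in> L \<Longrightarrow> H \<in> proj_space S \<and> (H \<in> proj_space T \<or> (\<forall>v\<in>H. G v = 0))"
  shows "irreducible_component S (zariski_closure S L) (proj_space T)"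
  unfolding irreducible_component_def
proof (intro conjI allI impI sub)
  show irr: "irreducible_variety S (proj_space T)" using T by (rule irreducible_proj_space)
  define Z where "Z = {H \<in> proj_space S. \<forall>f\<in>{G}. \<forall>v\<in>H. f v = 0}"
  have Z: "proj_variety S Z" unfolding Z_def proj_variety_def using G(1) by blast
  have PT: "proj_variety S (proj_space T)" using T by (intro proj_variety_proj_space)
  fix X' assume X': "irreducible_variety S X' \<and> proj_space T \<subseteq> X' \<and> X' \<subseteq> zariski_closure S L"
  have "zariski_closure S L \<subseteq> proj_space T \<union> Z"
    by (rule zariski_closure_minimal[OF proj_variety_Un[OF PT Z]]) (use L in \<open>auto simp: Z_def\<close>)
  then have "X' = (X' \<inter> proj_space T) \<union> (X' \<inter> Z)" using X' by blast
  then have "X' = X' \<inter> proj_space T \<or> X' = X' \<inter> Z"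
    using X' PT Z proj_variety_Int unfolding irreducible_variety_def by metis
  moreover have "X' \<noteq> X' \<inter> Z"
  proof
    assume "X' = X' \<inter> Z"
    then have *: "proj_space T \<subseteq> Z" using X' by blast
    obtain v where v: "v \<in> T" "v \<noteq> 0" using T subspace_0 by blast
    show False
    \<comment> \<open>A constant G may be nonzero at d = 0; then any line of T, which contains 0,
      gives the contradiction.\<close>
    proof (cases "d = 0")
      case True
      then have "d \<in> span {v}" by (simp add: span_0)
      then show False using * line_in_proj_space[OF T(1) v] G(3) unfolding Z_def by blast
    next
      case False
      have "d \<in> span {d}" by (simp add: span_base)
      then show False using * line_in_proj_space[OF T(1) G(2) False] G(3) unfolding Z_def by blast
    qed
  qed
  ultimately show "X' = proj_space T" using X' by blast
qed

text \<open>An equation satisfied by A vanishes at infinitely many points of the line from d0 to e,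
  hence on all of it; t = 1 gives the value at e.\<close>

lemma proj_space_subset_zariski_closure:
  assumes T: "subspace T" "T \<subseteq> S" and d0: "d0 \<in> T"
    and near: "\<And>e. e \<in> T \<Longrightarrow> \<forall>\<^sub>F t in at 0. \<exists>H\<in>A. d0 + t *\<^sub>R (e - d0) \<in> H"
  shows "proj_space T \<subseteq> zariski_closure S A"
proof
  fix H assume H: "H \<in> proj_space T"
  show "H \<in> zariski_closure S A"
    unfolding zariski_closure_def
  proof (intro InterI, elim CollectE conjE)
    fix Y assume "proj_variety S Y" and AY: "A \<subseteq> Y"
    then obtain Q where Q: "\<forall>f\<in>Q. homogeneous_polynomial f" and Y: "Y = {H \<in> proj_space S. \<forall>f\<in>Q. \<forall>v\<in>H. f v = 0}"
      unfolding proj_variety_def by blast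
    have "f e = 0" if "f \<in> Q" "e \<in> T" for f e
    proof -
      have "\<forall>\<^sub>F t in at 0. f (d0 + t *\<^sub>R (e - d0)) = 0"
        using near[OF that(2)] by eventually_elim (use AY Y that in blast)
      then obtain \<epsilon> where \<epsilon>: "\<epsilon> > 0" "\<And>t. t \<noteq> 0 \<Longrightarrow> \<bar>t\<bar> < \<epsilon> \<Longrightarrow> f (d0 + t *\<^sub>R (e - d0)) = 0"
        unfolding eventually_at by (auto simp: dist_real_def)
      then have "{0<..<\<epsilon>} \<subseteq> {t. f (d0 + t *\<^sub>R (e - d0)) = 0}" by auto
      then have "infinite {t. f (d0 + t *\<^sub>R (e - d0)) = 0}"
        using \<epsilon>(1) infinite_Ioo infinite_super by blast
      then have "f (d0 + 1 *\<^sub>R (e - d0)) = 0"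
        using Q that(1) by (intro polynomial_zero_on_line) (auto simp: homogeneous_polynomial_def)
      then show ?thesis by simp
    qed
    then show "H \<in> Y"
      using H T Y proj_space_mono[OF T(2)] proj_spaceD(3)[OF H] by blast
  qed
qed

subsection \<open>Comparison with the Monge-Ampere equation near a smooth point\<close>

definition frame :: "(j2 \<Rightarrow> j2 set) \<Rightarrow> j2 set \<Rightarrow> (j2 \<Rightarrow> c5) \<Rightarrow> (j2 \<Rightarrow> c5) \<Rightarrow> bool" where
  "frame D V \<Phi> \<Psi> \<longleftrightarrow> open V \<and> smooth_on V \<Phi> \<and> smooth_on V \<Psi>
     \<and> (\<forall>z\<in>V. annihilates (\<Phi> z) (\<Psi> z) z (D z))"

lemma frame_annihilates: "frame D V \<Phi> \<Psi> \<Longrightarrow> z \<in> V \<Longrightarrow> annihilates (\<Phi> z) (\<Psi> z) z (D z)"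
  by (simp add: frame_def)

lemma frame_indep: "frame D V \<Phi> \<Psi> \<Longrightarrow> z \<in> V \<Longrightarrow> indep2 (\<Phi> z) (\<Psi> z)"
  by (simp add: frame_def annihilates_def)

lemma distribution3_frame:
  assumes "distribution3 U D" "z0 \<in> U"
  shows "\<exists>V \<Phi> \<Psi>. frame D V \<Phi> \<Psi> \<and> V \<subseteq> U \<and> z0 \<in> V"
proof (rule distribution3_annihilators[OF assms])
  fix V \<Phi> \<Psi>
  assume "open V" "z0 \<in> V" "V \<subseteq> U" "smooth_on V \<Phi>" "smooth_on V \<Psi>"
    "\<And>z. z \<in> V \<Longrightarrow> annihilates (\<Phi> z) (\<Psi> z) z (D z)"
  then have "frame D V \<Phi> \<Psi> \<and> V \<subseteq> U \<and> z0 \<in> V" by (simp add: frame_def)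
  then show ?thesis by blast
qed

lemma E_of_iff_MA:
  assumes "frame D V \<Phi> \<Psi>" "V \<subseteq> U" "fst y \<in> V"
  shows "y \<in> E_of U D \<longleftrightarrow> MA \<Phi> \<Psi> y = 0"
  using Lag2_meets_iff[OF frame_annihilates[OF assms(1,3)]] assms by (auto simp: E_of_def MA_def)

lemma open_evals_nonzero:
  assumes "frame D V \<Phi> \<Psi>" "open W" "W \<subseteq> fst -` V"
  shows "open {y\<in>W. evals (\<Phi> (fst y)) (\<Psi> (fst y)) (snd y) \<noteq> 0}"
proof -
  have V: "open V" "smooth_on V \<Phi>" "smooth_on V \<Psi>" using assms by (auto simp: frame_def)
  have "continuous_on W (\<lambda>y::j3. evals (\<Phi> (fst y)) (\<Psi> (fst y)) (snd y))"
    using smooth_on_ev[OF V(1,2), THEN smooth_on_imp_continuous_on] smooth_on_ev[OF V(1,3), THEN smooth_on_imp_continuous_on]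
      assms(3) by (intro continuous_on_Pair; blast intro: continuous_on_subset)
  from continuous_open_preimage[OF this assms(2), of "- {0}"] show ?thesis
    by (simp add: vimage_def Int_def open_Compl)
qed

text \<open>The single inclusion of E in \<open>E_of U D\<close> is enough for the value matrix to
  be nonzero at y0, and this is an open condition. Hence the lemma serves both directions of the
  equivalence.\<close>

lemma local_structure:
  assumes fr: "frame D V \<Phi> \<Psi>" "V \<subseteq> U" and y0: "y0 \<in> smooth_points E" "fst y0 \<in> V"
    and W: "open W" "y0 \<in> W" "E \<inter> W \<subseteq> E_of U D"
  shows "\<exists>W'. open W' \<and> y0 \<in> W' \<and> W' \<subseteq> W \<inter> fst -` V
    \<and> (\<forall>y\<in>W'. evals (\<Phi> (fst y)) (\<Psi> (fst y)) (snd y) \<noteq> 0)"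
proof (intro exI conjI)
  let ?W = "W \<inter> fst -` V"
  have oV: "open V" using fr by (simp add: frame_def)
  then have oW: "open ?W" using W(1) by (intro open_Int open_vimage_fst)
  show "open {y\<in>?W. evals (\<Phi> (fst y)) (\<Psi> (fst y)) (snd y) \<noteq> 0}"
    by (intro open_evals_nonzero[OF fr(1)] oW) auto
  have "evals (\<Phi> (fst y0)) (\<Psi> (fst y0)) (snd y0) \<noteq> 0"
  proof (rule smooth_point_evals[OF y0(1) frame_indep[OF fr(1) y0(2)] oW])
    show "y0 \<in> ?W" using W y0 by simp
    fix b assume b: "(fst y0, b) \<in> E \<inter> ?W"
    then have "(fst y0, b) \<in> E_of U D" using W(3) by blast
    then show "ma (\<Phi> (fst y0)) (\<Psi> (fst y0)) b = 0"
      using E_of_iff_MA[OF fr, of "(fst y0, b)"] y0(2) by (simp add: MA_def)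
  qed
  then show "y0 \<in> {y\<in>?W. evals (\<Phi> (fst y)) (\<Psi> (fst y)) (snd y) \<noteq> 0}" using W y0 by simp
qed auto

text \<open>These are the coefficients of the product of k X + h Y and m1 X^2 + m2 X Y + m3 Y^2. The
  next lemma is the absence of zero divisors among binary forms.\<close>

lemma rank_one_components:
  assumes "\<And>\<delta>. dma \<phi> \<psi> b \<delta> = m \<bullet> (k *\<^sub>R lower \<delta> + h *\<^sub>R upper \<delta>)"
  shows "dma \<phi> \<psi> b (axis 1 1) = k * m$1" "dma \<phi> \<psi> b (axis 2 1) = k * m$2 + h * m$1"
    "dma \<phi> \<psi> b (axis 3 1) = k * m$3 + h * m$2" "dma \<phi> \<psi> b (axis 4 1) = h * m$3"
  unfolding assms by (simp_all add: inner_3 axis_def)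

lemma rank_one_nonzero:
  assumes "\<And>\<delta>. dma \<phi> \<psi> b \<delta> = m \<bullet> (k *\<^sub>R lower \<delta> + h *\<^sub>R upper \<delta>)" "m \<noteq> 0" "(k, h) \<noteq> 0"
  shows "\<exists>i. dma \<phi> \<psi> b (axis i 1) \<noteq> 0"
proof (rule ccontr)
  assume "\<not> ?thesis"
  then have "k * m$1 = 0" "k * m$2 + h * m$1 = 0" "k * m$3 + h * m$2 = 0" "h * m$3 = 0"
    using rank_one_components[OF assms(1)] by metis+
  then have "m = 0" using assms(3) by (cases "k = 0") (auto simp: zero_prod_def vec_eq_iff forall_3)
  then show False using assms(2) by simp
qed

lemma MA_fibre_deriv:
  assumes "frame D V \<Phi> \<Psi>" "fst y \<in> V"
  shows "fibre_deriv (MA \<Phi> \<Psi>) y i = dma (\<Phi> (fst y)) (\<Psi> (fst y)) (snd y) (axis i 1)"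
  unfolding fibre_deriv_def using assms by (intro MA_fibre_derivative) (auto simp: frame_def)

text \<open>The comparison of zero sets needs one direction in which both functions have nonzero
  derivative.\<close>

lemma common_nonzero_direction:
  fixes c c' :: "'a::real_inner"
  assumes "c \<noteq> 0" "c' \<noteq> 0"
  obtains \<delta> where "c \<bullet> \<delta> \<noteq> 0" "c' \<bullet> \<delta> \<noteq> 0"
proof (cases "c \<bullet> c' = 0")
  case True
  then show thesis using that[of "c + c'"] assms by (simp add: inner_add_right inner_commute)
next
  case False
  then show thesis using that[of c] assms by (simp add: inner_commute)
qed

text \<open>Only the inclusion of the lines \<open>\<Lambda> y\<close> in D matters: it gives one inclusion of hypersurfaces,
  and both are regular at the given point.\<close>

lemma linear_component_imp_E_of:
  assumes D: "distribution3 U D" and U: "open U" and lf: "linear_factor E U \<Lambda>"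
    and V_I: "\<And>z. z \<in> U \<Longrightarrow> V_I E \<Lambda> z = proj_space (D z)"
    and y0: "y0 \<in> smooth_points E" "fst y0 \<in> U"
  shows "\<exists>W. open W \<and> y0 \<in> W \<and> E \<inter> W = E_of U D \<inter> W"
proof -
  obtain W F k h where W: "y0 \<in> W" "local_equation E W F"
    and F: "\<And>y. y \<in> E \<inter> W \<Longrightarrow> (\<exists>i. fibre_deriv F y i \<noteq> 0) \<and> (k y \<noteq> 0 \<or> h y \<noteq> 0)
       \<and> \<Lambda> y = span {k y *\<^sub>R \<xi>1 y + h y *\<^sub>R \<xi>2 y}"
    using lf y0 unfolding linear_factor_def by (metis (no_types, lifting))
  have Wo: "open W" "smooth_on W F" "E \<inter> W = {y\<in>W. F y = 0}" using W by (auto simp: local_equation_def)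
  have incl: "E \<inter> (W \<inter> fst -` U) \<subseteq> E_of U D"
  proof
    fix y assume y: "y \<in> E \<inter> (W \<inter> fst -` U)"
    then have yU: "fst y \<in> U" and yW: "y \<in> E \<inter> W" by auto
    have "y \<in> smooth_points E" using F[OF yW] yW W unfolding smooth_points_def by blast
    then have "\<Lambda> y \<in> factor_lines E \<Lambda> (fst y)" unfolding factor_lines_def by (metis (mono_tags, lifting) mem_Collect_eq prod.collapse)
    then have "\<Lambda> y \<in> proj_space (D (fst y))"
      using zariski_closure_superset V_I[OF yU] unfolding V_I_def by blast
    then have "plane_vec y (k y) (h y) \<in> D (fst y)"
      using proj_spaceD(3)[of "\<Lambda> y"] F[OF yW] span_base[of "plane_vec y (k y) (h y)"] by auto
    moreover have "plane_vec y (k y) (h y) \<noteq> 0" using F[OF yW] by (simp add: xi_comb_eq_0)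
    moreover have "plane_vec y (k y) (h y) \<in> Lag2 y" using mem_Lag2 by blast
    ultimately show "y \<in> E_of U D" using yU unfolding E_of_def by blast
  qed
  obtain V \<Phi> \<Psi> where fr: "frame D V \<Phi> \<Psi>" "V \<subseteq> U" and yV: "fst y0 \<in> V"
    using distribution3_frame[OF D y0(2)] by blast
  have "open (W \<inter> fst -` U)" "y0 \<in> W \<inter> fst -` U" using Wo U W y0 by (auto intro: open_Int open_vimage_fst)
  from local_structure[OF fr y0(1) yV this incl] obtain W' where W': "open W'" "y0 \<in> W'" "W' \<subseteq> W \<inter> fst -` U" "W' \<subseteq> fst -` V"
    and nz: "\<forall>y\<in>W'. evals (\<Phi> (fst y)) (\<Psi> (fst y)) (snd y) \<noteq> 0" by blast
  let ?G = "MA \<Phi> \<Psi>"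
  have G: "smooth_on W' ?G" using smooth_on_subset[OF smooth_on_MA[of V \<Phi> \<Psi>] W'(4)] fr(1) by (simp add: frame_def)
  have imp: "?G y = 0" if "y \<in> W'" "F y = 0" for y
  proof -
    have "y \<in> W" "fst y \<in> V" "fst y \<in> U" using that(1) W'(3,4) by auto
    moreover from this have "y \<in> E" using that(2) Wo(3) by blast
    ultimately show ?thesis using incl E_of_iff_MA[OF fr] by blast
  qed
  have y0E: "y0 \<in> E" using y0 by (simp add: smooth_points_def)
  then have F0: "F y0 = 0" using W Wo(3) by blast
  have "ma (\<Phi> (fst y0)) (\<Psi> (fst y0)) (snd y0) = 0" using imp[OF W'(2) F0] by (simp add: MA_def)
  then obtain a b where ab: "(a, b) \<noteq> 0" "null_dir (\<Phi> (fst y0)) (\<Psi> (fst y0)) (snd y0) a b" by (rule null_dir_exists)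
  obtain j where j: "fibre_deriv ?G y0 j \<noteq> 0"
    using rank_one_derivative[OF frame_indep[OF fr(1) yV] ab(1) conjunct1[OF ab(2)] conjunct2[OF ab(2)] bspec[OF nz W'(2)]]
      rank_one_nonzero[OF _ _ ab(1)] unfolding MA_fibre_deriv[OF fr(1) yV] by blast
  obtain i where i: "fibre_deriv F y0 i \<noteq> 0" using F[of y0] y0E W by blast
  obtain \<delta> where \<delta>: "(\<chi> i. fibre_deriv F y0 i) \<bullet> \<delta> \<noteq> 0" "(\<chi> i. fibre_deriv ?G y0 i) \<bullet> \<delta> \<noteq> 0"
  proof (rule common_nonzero_direction)
    show "(\<chi> i. fibre_deriv F y0 i) \<noteq> 0" "(\<chi> i. fibre_deriv ?G y0 i) \<noteq> 0"
      using i j by (auto simp: vec_eq_iff)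
  qed
  have F': "smooth_on W' F" using Wo(2) W'(3) smooth_on_subset by blast
  have "\<exists>W''. open W'' \<and> y0 \<in> W'' \<and> W'' \<subseteq> W' \<and> (\<forall>y\<in>W''. ?G y = 0 \<longrightarrow> F y = 0)"
  proof (rule zero_set_comparison[OF W'(1,2) F' G F0 imp])
    show "frechet_derivative F (at y0) (0, \<delta>) \<noteq> 0"
      using fibre_derivative_sum[OF smooth_on_imp_differentiable[OF F' W'(2)]] \<delta> by simp
    show "frechet_derivative ?G (at y0) (0, \<delta>) \<noteq> 0"
      using fibre_derivative_sum[OF smooth_on_imp_differentiable[OF G W'(2)]] \<delta> by simp
  qed
  then obtain W'' where W'': "open W''" "y0 \<in> W''" "W'' \<subseteq> W'" "\<And>y. y \<in> W'' \<Longrightarrow> ?G y = 0 \<Longrightarrow> F y = 0" by blast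
  have "E \<inter> W'' = E_of U D \<inter> W''"
  proof (intro set_eqI iffI)
    fix y assume "y \<in> E \<inter> W''"
    then show "y \<in> E_of U D \<inter> W''" using incl W''(3) W'(3) by blast
  next
    fix y assume y: "y \<in> E_of U D \<inter> W''"
    then have "fst y \<in> V" "y \<in> W" using W''(3) W'(3,4) by auto
    then have "?G y = 0" using E_of_iff_MA[OF fr] y by blast
    then have "F y = 0" using W''(4) y by blast
    then show "y \<in> E \<inter> W''" using Wo(3) \<open>y \<in> W\<close> y by blast
  qed
  then show ?thesis using W'' by blast
qed

definition locally_eq :: "j3 set \<Rightarrow> j2 set \<Rightarrow> (j2 \<Rightarrow> j2 set) \<Rightarrow> bool" where
  "locally_eq E U D \<longleftrightarrow> (\<forall>y\<in>smooth_points E. fst y \<in> U \<longrightarrow>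
     (\<exists>W. open W \<and> y \<in> W \<and> E \<inter> W = E_of U D \<inter> W))"

text \<open>Agreement with \<open>E_of U D\<close> makes the determinant a defining function, and a
  nonzero value matrix makes it regular not just at y0 but at all points of E nearby.\<close>

lemma local_MA_equation:
  assumes fr: "frame D V \<Phi> \<Psi>" "V \<subseteq> U" and le: "locally_eq E U D"
    and y0: "y0 \<in> smooth_points E" "fst y0 \<in> V"
  shows "\<exists>W. y0 \<in> W \<and> local_equation E W (MA \<Phi> \<Psi>) \<and> W \<subseteq> fst -` V
    \<and> (\<forall>y\<in>W. evals (\<Phi> (fst y)) (\<Psi> (fst y)) (snd y) \<noteq> 0)
    \<and> (\<forall>y\<in>E \<inter> W. \<exists>i. fibre_deriv (MA \<Phi> \<Psi>) y i \<noteq> 0)"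
proof -
  obtain W0 where W0: "open W0" "y0 \<in> W0" "E \<inter> W0 = E_of U D \<inter> W0"
    using le y0 fr(2) unfolding locally_eq_def by blast
  then have "E \<inter> W0 \<subseteq> E_of U D" by blast
  from local_structure[OF fr y0 W0(1,2) this] obtain W where W: "open W" "y0 \<in> W" "W \<subseteq> W0" "W \<subseteq> fst -` V"
    and nz: "\<forall>y\<in>W. evals (\<Phi> (fst y)) (\<Psi> (fst y)) (snd y) \<noteq> 0" by blast
  have eq: "E \<inter> W = {y\<in>W. MA \<Phi> \<Psi> y = 0}"
    using W0(3) W(3,4) E_of_iff_MA[OF fr] by blast
  have "smooth_on W (MA \<Phi> \<Psi>)" using smooth_on_subset[OF smooth_on_MA[of V \<Phi> \<Psi>] W(4)] fr(1) by (simp add: frame_def)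
  then have "local_equation E W (MA \<Phi> \<Psi>)" using W(1) eq by (simp add: local_equation_def)
  moreover have "\<forall>y\<in>E \<inter> W. \<exists>i. fibre_deriv (MA \<Phi> \<Psi>) y i \<noteq> 0"
  proof
    fix y assume y: "y \<in> E \<inter> W"
    have yV: "fst y \<in> V" "y \<in> W" using y W by auto
    have "ma (\<Phi> (fst y)) (\<Psi> (fst y)) (snd y) = 0" using y eq by (auto simp: MA_def)
    then obtain a b where ab: "(a, b) \<noteq> 0" "null_dir (\<Phi> (fst y)) (\<Psi> (fst y)) (snd y) a b" by (rule null_dir_exists)
    show "\<exists>i. fibre_deriv (MA \<Phi> \<Psi>) y i \<noteq> 0"
      using rank_one_derivative[OF frame_indep[OF fr(1) yV(1)] ab(1) conjunct1[OF ab(2)] conjunct2[OF ab(2)] bspec[OF nz yV(2)]]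
        rank_one_nonzero[OF _ _ ab(1)] unfolding MA_fibre_deriv[OF fr(1) yV(1)] by blast
  qed
  ultimately show ?thesis using W nz by blast
qed

text \<open>Take the row of the value matrix that is nonzero at y0 and rotate it by a right angle.
  It is orthogonal to its own row identically, and to the other row exactly where the determinant
  vanishes. Choosing the row at y0 keeps (k, h) smooth.\<close>

lemma smooth_null_direction:
  assumes fr: "frame D V \<Phi> \<Psi>" and W: "open W" "y0 \<in> W" "W \<subseteq> fst -` V"
    and nz: "evals (\<Phi> (fst y0)) (\<Psi> (fst y0)) (snd y0) \<noteq> 0"
  shows "\<exists>W' k h. open W' \<and> y0 \<in> W' \<and> W' \<subseteq> W \<and> smooth_on W' k \<and> smooth_on W' h \<and> (\<forall>y\<in>W'. (k y, h y) \<noteq> 0)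
    \<and> (\<forall>y\<in>W'. MA \<Phi> \<Psi> y = 0 \<longrightarrow> null_dir (\<Phi> (fst y)) (\<Psi> (fst y)) (snd y) (k y) (h y))"
proof -
  have V: "open V" "smooth_on V \<Phi>" "smooth_on V \<Psi>" using fr by (auto simp: frame_def)
  have *: "\<exists>W' k h. open W' \<and> y0 \<in> W' \<and> W' \<subseteq> W \<and> smooth_on W' k \<and> smooth_on W' h \<and> (\<forall>y\<in>W'. (k y, h y) \<noteq> 0)
     \<and> (\<forall>y\<in>W'. k y = ev2 (\<Theta> (fst y)) (snd y) \<and> h y = - ev1 (\<Theta> (fst y)) (snd y))"
    if \<Theta>: "smooth_on V \<Theta>" "(ev1 (\<Theta> (fst y0)) (snd y0), ev2 (\<Theta> (fst y0)) (snd y0)) \<noteq> 0" for \<Theta>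
  proof -
    let ?k = "\<lambda>y::j3. ev2 (\<Theta> (fst y)) (snd y)" and ?h = "\<lambda>y::j3. - ev1 (\<Theta> (fst y)) (snd y)"
    have sm: "smooth_on W ?k" "smooth_on W ?h"
      using smooth_on_ev[OF V(1) \<Theta>(1)] W smooth_on_subset smooth_on_minus by blast+
    have "continuous_on W (\<lambda>y. (?k y, ?h y))"
      using sm by (intro continuous_on_Pair smooth_on_imp_continuous_on)
    from continuous_open_preimage[OF this W(1), of "- {0}"]
    have o: "open {y\<in>W. (?k y, ?h y) \<noteq> 0}" by (simp add: vimage_def Int_def open_Compl)
    show ?thesis
    proof (rule exI[of _ "{y\<in>W. (?k y, ?h y) \<noteq> 0}"], rule exI[of _ ?k], rule exI[of _ ?h], intro conjI o)
      show "y0 \<in> {y \<in> W. (?k y, ?h y) \<noteq> 0}" using W \<Theta> by (auto simp: zero_prod_def)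
      show "smooth_on {y \<in> W. (?k y, ?h y) \<noteq> 0} ?k" "smooth_on {y \<in> W. (?k y, ?h y) \<noteq> 0} ?h"
        by (rule smooth_on_subset[OF sm(1)], blast) (rule smooth_on_subset[OF sm(2)], blast)
    qed auto
  qed
  have "(ev1 (\<Phi> (fst y0)) (snd y0), ev2 (\<Phi> (fst y0)) (snd y0)) \<noteq> 0 \<or> (ev1 (\<Psi> (fst y0)) (snd y0), ev2 (\<Psi> (fst y0)) (snd y0)) \<noteq> 0"
    using nz by (auto simp: zero_prod_def)
  then show ?thesis
  proof
    assume "(ev1 (\<Phi> (fst y0)) (snd y0), ev2 (\<Phi> (fst y0)) (snd y0)) \<noteq> 0"
    from *[OF V(2) this] obtain W' k h where W': "open W'" "y0 \<in> W'" "W' \<subseteq> W" "smooth_on W' k" "smooth_on W' h" "\<forall>y\<in>W'. (k y, h y) \<noteq> 0"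
      and kh: "\<forall>y\<in>W'. k y = ev2 (\<Phi> (fst y)) (snd y) \<and> h y = - ev1 (\<Phi> (fst y)) (snd y)" by blast
    have "\<forall>y\<in>W'. MA \<Phi> \<Psi> y = 0 \<longrightarrow> null_dir (\<Phi> (fst y)) (\<Psi> (fst y)) (snd y) (k y) (h y)"
    proof (intro ballI impI)
      fix y assume y: "y \<in> W'" "MA \<Phi> \<Psi> y = 0"
      show "null_dir (\<Phi> (fst y)) (\<Psi> (fst y)) (snd y) (k y) (h y)"
        using bspec[OF kh y(1)] y(2) by (simp add: MA_def ma_def mult.commute)
    qed
    then show ?thesis using W' by blast
  next
    assume "(ev1 (\<Psi> (fst y0)) (snd y0), ev2 (\<Psi> (fst y0)) (snd y0)) \<noteq> 0"
    from *[OF V(3) this] obtain W' k h where W': "open W'" "y0 \<in> W'" "W' \<subseteq> W" "smooth_on W' k" "smooth_on W' h" "\<forall>y\<in>W'. (k y, h y) \<noteq> 0"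
      and kh: "\<forall>y\<in>W'. k y = ev2 (\<Psi> (fst y)) (snd y) \<and> h y = - ev1 (\<Psi> (fst y)) (snd y)" by blast
    have "\<forall>y\<in>W'. MA \<Phi> \<Psi> y = 0 \<longrightarrow> null_dir (\<Phi> (fst y)) (\<Psi> (fst y)) (snd y) (k y) (h y)"
    proof (intro ballI impI)
      fix y assume y: "y \<in> W'" "MA \<Phi> \<Psi> y = 0"
      show "null_dir (\<Phi> (fst y)) (\<Psi> (fst y)) (snd y) (k y) (h y)"
        using bspec[OF kh y(1)] y(2) by (simp add: MA_def ma_def mult.commute)
    qed
    then show ?thesis using W' by blast
  qed
qed

lemma linear_factor_E_of:
  assumes D: "distribution3 U D" and le: "locally_eq E U D"
  shows "linear_factor E U (\<lambda>y. Lag2 y \<inter> D (fst y))"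
  unfolding linear_factor_def
proof (intro ballI impI)
  fix y0 assume y0: "y0 \<in> smooth_points E" "fst y0 \<in> U"
  obtain V \<Phi> \<Psi> where fr: "frame D V \<Phi> \<Psi>" "V \<subseteq> U" and yV: "fst y0 \<in> V"
    using distribution3_frame[OF D y0(2)] by blast
  let ?F = "MA \<Phi> \<Psi>"
  obtain W where W: "y0 \<in> W" "local_equation E W ?F" "W \<subseteq> fst -` V"
    and nz: "\<forall>y\<in>W. evals (\<Phi> (fst y)) (\<Psi> (fst y)) (snd y) \<noteq> 0"
    and fd: "\<forall>y\<in>E \<inter> W. \<exists>i. fibre_deriv ?F y i \<noteq> 0"
    using local_MA_equation[OF fr le y0(1) yV] by blast
  have oW: "open W" using W(2) by (simp add: local_equation_def)
  obtain W' k h where W': "open W'" "y0 \<in> W'" "W' \<subseteq> W" "smooth_on W' k" "smooth_on W' h"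
    and kh: "\<forall>y\<in>W'. (k y, h y) \<noteq> 0"
      "\<forall>y\<in>W'. ?F y = 0 \<longrightarrow> null_dir (\<Phi> (fst y)) (\<Psi> (fst y)) (snd y) (k y) (h y)"
    using smooth_null_direction[OF fr(1) oW W(1,3) bspec[OF nz W(1)]] by blast
  have le': "local_equation E W' ?F"
    using W(2) W'(1,3) unfolding local_equation_def by (auto intro: smooth_on_subset)
  show "\<exists>W F k h. y0 \<in> W \<and> local_equation E W F \<and> smooth_on W k \<and> smooth_on W h \<and>
        (\<forall>y\<in>E \<inter> W. (\<exists>i. fibre_deriv F y i \<noteq> 0) \<and> (k y \<noteq> 0 \<or> h y \<noteq> 0)
           \<and> (\<exists>\<alpha> \<beta> \<gamma>. \<forall>s t. symbol F y s t =
                 (k y * s + h y * t) * (\<alpha> * s^2 + \<beta> * s * t + \<gamma> * t^2))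
           \<and> Lag2 y \<inter> D (fst y) = span {k y *\<^sub>R \<xi>1 y + h y *\<^sub>R \<xi>2 y})"
  proof (rule exI[of _ W'], rule exI[of _ ?F], rule exI[of _ k], rule exI[of _ h], intro conjI le' W' ballI)
    fix y assume y: "y \<in> E \<inter> W'"
    then have yV: "fst y \<in> V" "y \<in> W" "y \<in> W'" using W W' by auto
    have "?F y = 0" using y le' by (auto simp: local_equation_def)
    then have nd: "null_dir (\<Phi> (fst y)) (\<Psi> (fst y)) (snd y) (k y) (h y)" using kh(2) yV(3) by blast
    note kh = bspec[OF kh(1) yV(3)] and nz = bspec[OF nz yV(2)]
    show "\<exists>i. fibre_deriv ?F y i \<noteq> 0" using fd y W' by blast
    show "k y \<noteq> 0 \<or> h y \<noteq> 0" using kh by (auto simp: zero_prod_def)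
    show "Lag2 y \<inter> D (fst y) = span {plane_vec y (k y) (h y)}"
      using Lag2_inter_eq_span[OF frame_annihilates[OF fr(1) yV(1)] nz kh nd] .
    \<comment> \<open>The coefficients of the complementary quadratic factor of the symbol are the
      entries of m.\<close>
    obtain m where dm: "\<And>\<delta>. dma (\<Phi> (fst y)) (\<Psi> (fst y)) (snd y) \<delta> = m \<bullet> (k y *\<^sub>R lower \<delta> + h y *\<^sub>R upper \<delta>)"
      using rank_one_derivative[OF frame_indep[OF fr(1) yV(1)] kh conjunct1[OF nd] conjunct2[OF nd] nz] by blast
    have c: "fibre_deriv ?F y 1 = k y * m$1" "fibre_deriv ?F y 2 = k y * m$2 + h y * m$1"
      "fibre_deriv ?F y 3 = k y * m$3 + h y * m$2" "fibre_deriv ?F y 4 = h y * m$3"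
      unfolding MA_fibre_deriv[OF fr(1) yV(1)] by (rule rank_one_components[OF dm])+
    show "\<exists>\<alpha> \<beta> \<gamma>. \<forall>s t. symbol ?F y s t = (k y * s + h y * t) * (\<alpha> * s^2 + \<beta> * s * t + \<gamma> * t^2)"
      by (rule exI[of _ "m$1"], rule exI[of _ "m$2"], rule exI[of _ "m$3"], intro allI)
        (simp add: symbol_def c algebra_simps power2_eq_square power3_eq_cube)
  qed
qed

subsection \<open>The characteristic cone\<close>

text \<open>Three bidiagonal equations in four unknowns. Setting one end unknown to 0 makes the
  system triangular with h or k on the diagonal; the choice is made by which limit is nonzero, so
  the divisions are eventually legitimate and the solution tends to 0 with r.\<close>

lemma solve_contact_condition:
  fixes k h :: "real \<Rightarrow> real" and r :: "real \<Rightarrow> real^3"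
  assumes k: "(k \<longlongrightarrow> k0) (at 0)" and h: "(h \<longlongrightarrow> h0) (at 0)" and r: "(r \<longlongrightarrow> 0) (at 0)" and kh: "(k0, h0) \<noteq> 0"
  shows "\<exists>c. (c \<longlongrightarrow> 0) (at 0) \<and> (\<forall>\<^sub>F t in at 0. k t *\<^sub>R lower (c t) + h t *\<^sub>R upper (c t) = r t)"
proof -
  have r': "((\<lambda>t. r t $ i) \<longlongrightarrow> 0) (at 0)" for i using tendsto_vec_nth[OF r, of i] by simp
  define vec4 :: "real \<Rightarrow> real \<Rightarrow> real \<Rightarrow> real \<Rightarrow> real^4" where
    "vec4 x y z w = (\<chi> i. if i = 1 then x else if i = 2 then y else if i = 3 then z else w)" for x y z w
  have v: "vec4 x y z w $ 1 = x" "vec4 x y z w $ 2 = y" "vec4 x y z w $ 3 = z" "vec4 x y z w $ 4 = w" for x y z w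
    by (simp_all add: vec4_def)
  have tv: "((\<lambda>t. vec4 (x t) (y t) (z t) (w t)) \<longlongrightarrow> 0) (at 0)"
    if "(x \<longlongrightarrow> 0) (at 0)" "(y \<longlongrightarrow> 0) (at 0)" "(z \<longlongrightarrow> 0) (at 0)" "(w \<longlongrightarrow> 0) (at 0)"
    for x y z w :: "real \<Rightarrow> real"
  proof (rule vec_tendstoI)
    fix i :: 4
    show "((\<lambda>t. vec4 (x t) (y t) (z t) (w t) $ i) \<longlongrightarrow> 0 $ i) (at 0)"
      using exhaust_4[of i] that by (elim disjE) (simp_all add: v)
  qed
  show ?thesis
  proof (cases "k0 = 0")
    case True
    then have h0: "h0 \<noteq> 0" using kh by (simp add: zero_prod_def)
    define y where "y t = r t $ 1 / h t" for t
    define z where "z t = (r t $ 2 - k t * y t) / h t" for t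
    define w where "w t = (r t $ 3 - k t * z t) / h t" for t
    have y: "(y \<longlongrightarrow> 0) (at 0)" using tendsto_divide[OF r' h h0, of 1] by (simp add: y_def[abs_def])
    have z: "(z \<longlongrightarrow> 0) (at 0)"
      using tendsto_divide[OF tendsto_diff[OF r' tendsto_mult[OF k y]] h h0, of 2] by (simp add: z_def[abs_def])
    have w: "(w \<longlongrightarrow> 0) (at 0)"
      using tendsto_divide[OF tendsto_diff[OF r' tendsto_mult[OF k z]] h h0, of 3] by (simp add: w_def[abs_def])
    have "\<forall>\<^sub>F t in at 0. h t \<noteq> 0" using h h0 by (rule tendsto_imp_eventually_ne)
    then have "\<forall>\<^sub>F t in at 0. k t *\<^sub>R lower (vec4 0 (y t) (z t) (w t)) + h t *\<^sub>R upper (vec4 0 (y t) (z t) (w t)) = r t"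
      by eventually_elim (simp add: vec_eq_iff forall_3 v w_def z_def y_def)
    then show ?thesis using tv[OF tendsto_const y z w] by (intro exI[of _ "\<lambda>t. vec4 0 (y t) (z t) (w t)"]) simp
  next
    case k0: False
    define z where "z t = r t $ 3 / k t" for t
    define y where "y t = (r t $ 2 - h t * z t) / k t" for t
    define x where "x t = (r t $ 1 - h t * y t) / k t" for t
    have z: "(z \<longlongrightarrow> 0) (at 0)" using tendsto_divide[OF r' k k0, of 3] by (simp add: z_def[abs_def])
    have y: "(y \<longlongrightarrow> 0) (at 0)"
      using tendsto_divide[OF tendsto_diff[OF r' tendsto_mult[OF h z]] k k0, of 2] by (simp add: y_def[abs_def])
    have x: "(x \<longlongrightarrow> 0) (at 0)"
      using tendsto_divide[OF tendsto_diff[OF r' tendsto_mult[OF h y]] k k0, of 1] by (simp add: x_def[abs_def])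
    have "\<forall>\<^sub>F t in at 0. k t \<noteq> 0" using k k0 by (rule tendsto_imp_eventually_ne)
    then have "\<forall>\<^sub>F t in at 0. k t *\<^sub>R lower (vec4 (x t) (y t) (z t) 0) + h t *\<^sub>R upper (vec4 (x t) (y t) (z t) 0) = r t"
      by eventually_elim (simp add: vec_eq_iff forall_3 v x_def z_def y_def)
    then show ?thesis using tv[OF x y z tendsto_const] by (intro exI[of _ "\<lambda>t. vec4 (x t) (y t) (z t) 0"]) simp
  qed
qed

lemma fibre_local_structure:
  assumes fr: "frame D V \<Phi> \<Psi>" "V \<subseteq> U" and le: "locally_eq E U D"
    and z: "z \<in> V" and b: "(z, b) \<in> smooth_points E"
  shows "\<exists>W k h. open W \<and> (z, b) \<in> W \<and> E \<inter> W = {y\<in>W. MA \<Phi> \<Psi> y = 0} \<and> smooth_on W (MA \<Phi> \<Psi>)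
    \<and> E \<inter> W \<subseteq> smooth_points E
    \<and> evals (\<Phi> z) (\<Psi> z) b \<noteq> 0 \<and> (k, h) \<noteq> 0 \<and> null_dir (\<Phi> z) (\<Psi> z) b k h
    \<and> Lag2 (z, b) \<inter> D z = span {plane_vec (z, b) k h}"
proof -
  obtain W where W: "(z, b) \<in> W" "local_equation E W (MA \<Phi> \<Psi>)"
    and nz: "\<forall>y\<in>W. evals (\<Phi> (fst y)) (\<Psi> (fst y)) (snd y) \<noteq> 0"
    and fd: "\<forall>y\<in>E \<inter> W. \<exists>i. fibre_deriv (MA \<Phi> \<Psi>) y i \<noteq> 0"
    using local_MA_equation[OF fr le b] z by auto
  have Wo: "open W" "smooth_on W (MA \<Phi> \<Psi>)" "E \<inter> W = {y\<in>W. MA \<Phi> \<Psi> y = 0}"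
    using W(2) by (auto simp: local_equation_def)
  have sp: "E \<inter> W \<subseteq> smooth_points E"
    unfolding smooth_points_def using W(2) fd by blast
  have "(z, b) \<in> E" using b by (simp add: smooth_points_def)
  then have "MA \<Phi> \<Psi> (z, b) = 0" using Wo(3) W(1) by blast
  then have "ma (\<Phi> z) (\<Psi> z) b = 0" by (simp add: MA_def)
  then obtain k h where kh: "(k, h) \<noteq> 0" "null_dir (\<Phi> z) (\<Psi> z) b k h" by (rule null_dir_exists)
  have ev: "evals (\<Phi> z) (\<Psi> z) b \<noteq> 0" using bspec[OF nz W(1)] by simp
  have "Lag2 (z, b) \<inter> D z = span {plane_vec (z, b) k h}"
    using Lag2_inter_eq_span[of "\<Phi> z" "\<Psi> z" "(z, b)" "D z" k h] frame_annihilates[OF fr(1) z] ev kh by simp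
  then show ?thesis using Wo W(1) sp ev kh by blast
qed

abbreviation D_line :: "(j2 \<Rightarrow> j2 set) \<Rightarrow> j3 \<Rightarrow> j2 set" where
  "D_line D \<equiv> \<lambda>y. Lag2 y \<inter> D (fst y)"

text \<open>Moving b within the prolongation of the line keeps the same vector of D in the plane.
  The determinant therefore vanishes along this straight path, and near b the path lies in
  E.\<close>

lemma factor_line_characteristic:
  assumes fr: "frame D V \<Phi> \<Psi>" "V \<subseteq> U" and le: "locally_eq E U D"
    and z: "z \<in> V" and b: "(z, b) \<in> smooth_points E"
  shows "Lag2 (z, b) \<inter> D z \<in> char_lines E z"
proof -
  obtain W k h where W: "open W" "(z, b) \<in> W" "E \<inter> W = {y\<in>W. MA \<Phi> \<Psi> y = 0}"
    and kh: "(k, h) \<noteq> 0" "null_dir (\<Phi> z) (\<Psi> z) b k h"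
    and line: "Lag2 (z, b) \<inter> D z = span {plane_vec (z, b) k h}"
    using fibre_local_structure[OF fr le z b] by blast
  let ?\<nu> = "plane_vec (z, b) k h"
  have ann: "annihilates (\<Phi> z) (\<Psi> z) z (D z)" using frame_annihilates[OF fr(1) z] .
  have \<nu>: "?\<nu> \<noteq> 0" "?\<nu> \<in> Lag2 (z, b)" using kh xi_comb_eq_0[of k "(z, b)" h] mem_Lag2[of ?\<nu> "(z, b)"] by (auto simp: zero_prod_def)
  have "subspace (Lag2 (z, b))" by (simp add: Lag2_def)
  then have line_Lag: "span {?\<nu>} \<in> proj_space (Lag2 (z, b))" using line_in_proj_space \<nu> by blast
  then have "span {?\<nu>} \<in> proj_space (C1 z)"
    using proj_space_mono[OF Lag2_subset_C1[of "(z, b)"]] by auto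
  moreover have "characteristic E (z, b) (span {?\<nu>})"
    unfolding characteristic_def
  proof (intro conjI line_Lag subsetI)
    fix \<delta> assume "\<delta> \<in> tangent_vectors (prolong_line (fst (z, b)) (span {?\<nu>})) (snd (z, b))"
    then have \<delta>: "k *\<^sub>R lower \<delta> + h *\<^sub>R upper \<delta> = 0" using tangent_prolong_line by simp
    have inD: "ma (\<Phi> z) (\<Psi> z) (b + t *\<^sub>R \<delta>) = 0" for t
    proof -
      have "k *\<^sub>R lower (b + t *\<^sub>R \<delta>) + h *\<^sub>R upper (b + t *\<^sub>R \<delta>)
        = k *\<^sub>R lower b + h *\<^sub>R upper b + t *\<^sub>R (k *\<^sub>R lower \<delta> + h *\<^sub>R upper \<delta>)"
        by (simp add: linear_add[OF linear_lower] linear_scale[OF linear_lower]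
            linear_add[OF linear_upper] linear_scale[OF linear_upper] algebra_simps)
      then have "plane_vec (z, b + t *\<^sub>R \<delta>) k h = ?\<nu>" using \<delta> by (intro plane_vec_shift) simp
      moreover have "?\<nu> \<in> D z" using line span_base[of ?\<nu>] by blast
      ultimately have "plane_vec (z, b + t *\<^sub>R \<delta>) k h \<in> D z" by metis
      then have "null_dir (\<Phi> z) (\<Psi> z) (b + t *\<^sub>R \<delta>) k h"
        using plane_vec_mem[of "\<Phi> z" "\<Psi> z" "(z, b + t *\<^sub>R \<delta>)" "D z" k h] ann by simp
      then show ?thesis by (rule null_dir_imp_ma[OF kh(1)])
    qed
    have "isCont (\<lambda>t. (z, b + t *\<^sub>R \<delta>)) 0" by (intro continuous_intros)
    then have "\<forall>\<^sub>F t in nhds 0. (z, b + t *\<^sub>R \<delta>) \<in> W"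
      using W(1,2) by (auto simp: isCont_def eventually_nhds_conv_at dest: topological_tendstoD)
    then obtain \<epsilon> where \<epsilon>: "\<epsilon> > 0" "\<And>t. \<bar>t\<bar> < \<epsilon> \<Longrightarrow> (z, b + t *\<^sub>R \<delta>) \<in> W"
      by (auto simp: eventually_nhds_metric)
    have "\<delta> \<in> tangent_vectors (fibre E z) b"
    proof (rule affine_curve_tangent[OF \<epsilon>(1)])
      fix t :: real assume "\<bar>t\<bar> < \<epsilon>"
      from \<epsilon>(2)[OF this] have "(z, b + t *\<^sub>R \<delta>) \<in> E \<inter> W" unfolding W(3) using inD by (simp add: MA_def)
      then show "b + t *\<^sub>R \<delta> \<in> fibre E z" by (simp add: fibre_def)
    qed
    then show "\<delta> \<in> tangent_vectors (fibre E (fst (z, b))) (snd (z, b))" by simp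
  qed
  ultimately show ?thesis unfolding line char_lines_def using b by blast
qed

text \<open>The prolongation of a line has a one-dimensional tangent space, spanned by a cubic
  expression \<open>\<delta>\<close> in the coefficients of the line. The differential of the
  determinant at \<open>\<delta>\<close> is the symbol at the corresponding root, so either the
  linear or the quadratic factor vanishes there.\<close>

lemma char_lines_second:
  assumes fr: "frame D V \<Phi> \<Psi>" "V \<subseteq> U" and le: "locally_eq E U D"
    and z: "z \<in> V" and H: "H \<in> char_lines E z"
  obtains v where "H = span {v}" "v \<in> C1 z" "v \<noteq> 0" "v \<in> D z \<or> second_char (\<Phi> z) (\<Psi> z) (coords v)"
proof -
  obtain b where b: "(z, b) \<in> smooth_points E" and ch: "characteristic E (z, b) H"
    using H unfolding char_lines_def by blast
  obtain W k h where W: "open W" "(z, b) \<in> W" "E \<inter> W = {y\<in>W. MA \<Phi> \<Psi> y = 0}" "smooth_on W (MA \<Phi> \<Psi>)"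
    and ev: "evals (\<Phi> z) (\<Psi> z) b \<noteq> 0"
    and kh: "(k, h) \<noteq> 0" "null_dir (\<Phi> z) (\<Psi> z) b k h"
    and line: "Lag2 (z, b) \<inter> D z = span {plane_vec (z, b) k h}"
    using fibre_local_structure[OF fr le z b] by blast
  have "H \<in> proj_space (Lag2 (z, b))" using ch by (simp add: characteristic_def)
  then obtain v where v: "v \<in> Lag2 (z, b)" "v \<noteq> 0" "H = span {v}" by (rule proj_space_line)
  then obtain k' h' where v': "v = plane_vec (z, b) k' h'" unfolding mem_Lag2 by blast
  have kh': "(k', h') \<noteq> 0" using v(2) unfolding v' xi_comb_eq_0 by (auto simp: zero_prod_def)
  define \<rho> :: "real^3" where "\<rho> = vector [h'^2, - h' * k', k'^2]"
  \<comment> \<open>The point of the twisted cubic for (h', -k'): its Hankel rows are h' and -k'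
    times the same vector \<open>\<rho>\<close>, so k' and h' combine them to 0.\<close>
  define \<delta> :: "real^4" where "\<delta> = (\<chi> i. if i = 1 then h'^3 else if i = 2 then - (h'^2 * k') else if i = 3 then h' * k'^2 else - (k'^3))"
  have lo: "lower \<delta> = h' *\<^sub>R \<rho>" and up: "upper \<delta> = (- k') *\<^sub>R \<rho>"
    by (simp_all add: vec_eq_iff forall_3 \<delta>_def \<rho>_def power2_eq_square power3_eq_cube)
  have "\<delta> \<in> tangent_vectors (prolong_line z (span {plane_vec (z, b) k' h'})) b"
    unfolding tangent_prolong_line lo up by simp
  then have "\<delta> \<in> tangent_vectors (fibre E z) b"
    using ch unfolding characteristic_def v(3) v' by auto
  then have "frechet_derivative (MA \<Phi> \<Psi>) (at (z, b)) (0, \<delta>) = 0"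
    by (rule tangent_fibre_derivative[OF W(1,4,3,2)])
  then have d0: "dma (\<Phi> z) (\<Psi> z) b \<delta> = 0"
    using MA_fibre_derivative[of V \<Phi> \<Psi> "(z, b)" \<delta>] fr(1) z by (simp add: frame_def)
  obtain s t where st: "s *\<^sub>R snd (\<Phi> z) + t *\<^sub>R snd (\<Psi> z) \<noteq> 0"
    "ev1 (s *\<^sub>R \<Phi> z + t *\<^sub>R \<Psi> z) b = 0" "ev2 (s *\<^sub>R \<Phi> z + t *\<^sub>R \<Psi> z) b = 0"
    "dma (\<Phi> z) (\<Psi> z) b \<delta> = (s *\<^sub>R snd (\<Phi> z) + t *\<^sub>R snd (\<Psi> z)) \<bullet> (k *\<^sub>R lower \<delta> + h *\<^sub>R upper \<delta>)"
    using rank_one_derivative[OF frame_indep[OF fr(1) z] kh(1) conjunct1[OF kh(2)] conjunct2[OF kh(2)] ev] by blast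
  have "k *\<^sub>R lower \<delta> + h *\<^sub>R upper \<delta> = (k * h' - h * k') *\<^sub>R \<rho>"
    unfolding lo up by (simp add: algebra_simps)
  then have "(k * h' - h * k') * ((s *\<^sub>R snd (\<Phi> z) + t *\<^sub>R snd (\<Psi> z)) \<bullet> \<rho>) = 0" using st(4) d0 by simp
  then consider "k * h' - h * k' = 0" | "(s *\<^sub>R snd (\<Phi> z) + t *\<^sub>R snd (\<Psi> z)) \<bullet> \<rho> = 0"
    unfolding mult_eq_0_iff by blast
  then have "v \<in> D z \<or> second_char (\<Phi> z) (\<Psi> z) (coords v)"
  proof cases
    case 1
    then have "(- h') * k + k' * h = 0" by (simp add: algebra_simps)
    then obtain q where "- h' = - h * q" "k' = k * q" using orthogonal_pair[OF kh(1)] by blast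
    then have "v = q *\<^sub>R plane_vec (z, b) k h" by (simp add: v' algebra_simps)
    then have "v \<in> span {plane_vec (z, b) k h}" by (simp only: span_base span_scale insertI1)
    then show ?thesis using line by blast
  next
    case 2
    then have "second_char (\<Phi> z) (\<Psi> z) (vector [k', h'], k' *\<^sub>R lower b + h' *\<^sub>R upper b)"
      using st kh' unfolding second_char_def \<rho>_def by blast
    then show ?thesis unfolding v' coords_Lag2 by simp
  qed
  moreover have "v \<in> C1 z" using v(1) Lag2_subset_C1[of "(z, b)"] by auto
  ultimately show thesis using that v by blast
qed

text \<open>For a vector d(t) of D near d0, the fibre coordinate is corrected by a small c(t) so
  that the plane at b + c(t) contains d(t). This plane then meets D, so near b its point lies on E
  and is smooth there, and its D-line contains d(t).\<close>

lemma factor_lines_dense: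
  assumes fr: "frame D V \<Phi> \<Psi>" "V \<subseteq> U" and le: "locally_eq E U D"
    and z: "z \<in> V" and b: "(z, b) \<in> smooth_points E" and sub: "subspace (D z)" "D z \<subseteq> C1 z"
  shows "proj_space (D z) \<subseteq> V_I E (D_line D) z"
proof -
  obtain W k h where W: "open W" "(z, b) \<in> W" "E \<inter> W = {y\<in>W. MA \<Phi> \<Psi> y = 0}" "E \<inter> W \<subseteq> smooth_points E"
    and kh: "(k, h) \<noteq> 0" "null_dir (\<Phi> z) (\<Psi> z) b k h"
    and line: "Lag2 (z, b) \<inter> D z = span {plane_vec (z, b) k h}"
    using fibre_local_structure[OF fr le z b] by blast
  have ann: "annihilates (\<Phi> z) (\<Psi> z) z (D z)" using frame_annihilates[OF fr(1) z] .
  define d0 where "d0 = plane_vec (z, b) k h"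
  have d0: "d0 \<in> D z" using line span_base[of d0] unfolding d0_def by blast
  show ?thesis
    unfolding V_I_def
  proof (rule proj_space_subset_zariski_closure[OF sub d0])
    fix e assume e: "e \<in> D z"
    define d where "d t = d0 + t *\<^sub>R (e - d0)" for t
    have dD: "d t \<in> D z" for t
      unfolding d_def using e d0 sub(1) by (intro subspace_add subspace_scale subspace_diff)
    have "bounded_linear coords" using linear_coords by (simp add: linear_linear)
    moreover have "isCont d 0" unfolding d_def by (intro continuous_intros)
    ultimately have "isCont (\<lambda>t. coords (d t)) 0" by (rule bounded_linear.isCont)
    moreover have "coords (d 0) = (vector [k, h], k *\<^sub>R lower b + h *\<^sub>R upper b)"
      unfolding d_def d0_def scaleR_zero_left add_0_right coords_Lag2 by simp
    ultimately have lim: "((\<lambda>t. coords (d t)) \<longlongrightarrow> (vector [k, h], k *\<^sub>R lower b + h *\<^sub>R upper b)) (at 0)"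
      by (simp add: isCont_def)
    \<comment> \<open>kt and ht are the coefficients d(t) must have in a plane containing it; rt is
      the part of its vertical component that the plane at b fails to produce, to be supplied by
      c(t).\<close>
    define kt ht rt where "kt t = fst (coords (d t)) $ 1" and "ht t = fst (coords (d t)) $ 2"
      and "rt t = snd (coords (d t)) - kt t *\<^sub>R lower b - ht t *\<^sub>R upper b" for t
    have k: "(kt \<longlongrightarrow> k) (at 0)" using tendsto_vec_nth[OF tendsto_fst[OF lim], of 1] by (simp add: kt_def[abs_def])
    have h: "(ht \<longlongrightarrow> h) (at 0)" using tendsto_vec_nth[OF tendsto_fst[OF lim], of 2] by (simp add: ht_def[abs_def])
    have "(rt \<longlongrightarrow> (k *\<^sub>R lower b + h *\<^sub>R upper b) - k *\<^sub>R lower b - h *\<^sub>R upper b) (at 0)"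
      unfolding rt_def[abs_def] using tendsto_snd[OF lim] by (intro tendsto_intros k h) simp
    then have r: "(rt \<longlongrightarrow> 0) (at 0)" by simp
    obtain c where c: "(c \<longlongrightarrow> 0) (at 0)" "\<forall>\<^sub>F t in at 0. kt t *\<^sub>R lower (c t) + ht t *\<^sub>R upper (c t) = rt t"
      using solve_contact_condition[OF k h r kh(1)] by blast
    have "((\<lambda>t. (z, b + c t)) \<longlongrightarrow> (z, b + 0)) (at 0)" by (intro tendsto_intros c(1))
    then have inW: "\<forall>\<^sub>F t in at 0. (z, b + c t) \<in> W" using W(1,2) topological_tendstoD by fastforce
    have "((\<lambda>t. (kt t, ht t)) \<longlongrightarrow> (k, h)) (at 0)" by (intro tendsto_intros k h)
    then have ne: "\<forall>\<^sub>F t in at 0. (kt t, ht t) \<noteq> 0" using kh(1) by (rule tendsto_imp_eventually_ne)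
    show "\<forall>\<^sub>F t in at 0. \<exists>H\<in>factor_lines E (D_line D) z. d0 + t *\<^sub>R (e - d0) \<in> H"
      using c(2) inW ne
    proof eventually_elim
      case (elim t)
      have eq: "d t = plane_vec (z, b + c t) (kt t) (ht t)"
      proof (rule inj_onD[OF coords_inj_on_C1[of z]])
        have "kt t *\<^sub>R lower (b + c t) + ht t *\<^sub>R upper (b + c t) = kt t *\<^sub>R lower b + ht t *\<^sub>R upper b + rt t"
          unfolding elim(1)[symmetric] by (simp add: linear_add[OF linear_lower] linear_add[OF linear_upper] algebra_simps)
        also have "\<dots> = snd (coords (d t))" by (simp add: rt_def)
        finally show "coords (d t) = coords (plane_vec (z, b + c t) (kt t) (ht t))"
          unfolding coords_Lag2 by (simp add: prod_eq_iff vec_eq_iff[of "fst _"] forall_2 kt_def ht_def)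
        show "d t \<in> C1 z" using dD sub(2) by blast
        show "plane_vec (z, b + c t) (kt t) (ht t) \<in> C1 z" using plane_vec_in_C1[of "kt t" "(z, b + c t)" "ht t"] by simp
      qed
      have "null_dir (\<Phi> z) (\<Psi> z) (b + c t) (kt t) (ht t)"
        using dD[of t] plane_vec_mem[of "\<Phi> z" "\<Psi> z" "(z, b + c t)" "D z" "kt t" "ht t"] ann unfolding eq by simp
      then have "ma (\<Phi> z) (\<Psi> z) (b + c t) = 0" by (rule null_dir_imp_ma[OF elim(3)])
      then have "(z, b + c t) \<in> E \<inter> W" unfolding W(3) using elim(2) by (simp add: MA_def)
      then have "(z, b + c t) \<in> smooth_points E" using W(4) by blast
      then have "D_line D (z, b + c t) \<in> factor_lines E (D_line D) z" unfolding factor_lines_def by blast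
      moreover have "d t \<in> D_line D (z, b + c t)"
        using dD[of t] mem_Lag2[of "d t" "(z, b + c t)"] eq by auto
      ultimately show ?case unfolding d_def by blast
    qed
  qed
qed

lemma E_of_imp_linear_component:
  assumes D: "distribution3 U D" and le: "locally_eq E U D" and z: "z \<in> U"
    and ne: "(z, b) \<in> smooth_points E"
  shows "irreducible_component (C1 z) (char_cone E z) (V_I E (D_line D) z)"
    and "V_I E (D_line D) z = proj_space (D z)"
proof -
  obtain V \<Phi> \<Psi> where fr: "frame D V \<Phi> \<Psi>" "V \<subseteq> U" and zV: "z \<in> V"
    using distribution3_frame[OF D z] by blast
  have Dz: "subspace (D z)" "dim (D z) = 3" "D z \<subseteq> C1 z" using D z by (auto simp: distribution3_def)
  then have D0: "D z \<noteq> {0}" by auto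
  have ann: "annihilates (\<Phi> z) (\<Psi> z) z (D z)" using frame_annihilates[OF fr(1) zV] .
  have factor: "factor_lines E (D_line D) z \<subseteq> proj_space (D z)"
  proof
    fix H assume "H \<in> factor_lines E (D_line D) z"
    then obtain b where b: "(z, b) \<in> smooth_points E" "H = Lag2 (z, b) \<inter> D z"
      unfolding factor_lines_def by auto
    then have "H \<in> proj_space (C1 z)"
      using factor_line_characteristic[OF fr le zV b(1)] by (auto simp: char_lines_def)
    then show "H \<in> proj_space (D z)" using b(2) by (auto simp: proj_space_def)
  qed
  have "V_I E (D_line D) z \<subseteq> proj_space (D z)"
    unfolding V_I_def using proj_variety_proj_space[OF Dz(1,3)] factor by (rule zariski_closure_minimal)
  then show eq: "V_I E (D_line D) z = proj_space (D z)"
    using factor_lines_dense[OF fr le zV ne Dz(1,3)] by blast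
  have "factor_lines E (D_line D) z \<subseteq> char_lines E z"
    using factor_line_characteristic[OF fr le zV] unfolding factor_lines_def by auto
  then have sub: "proj_space (D z) \<subseteq> zariski_closure (C1 z) (char_lines E z)"
    unfolding eq[symmetric] V_I_def by (rule zariski_closure_mono)
  \<comment> \<open>If both vertical parts vanished, the determinant would be constant on the fibre
    and could not be regular at a point of E.\<close>
  have nz: "snd (\<Phi> z) \<noteq> 0 \<or> snd (\<Psi> z) \<noteq> 0"
  proof -
    obtain W k h where ev: "evals (\<Phi> z) (\<Psi> z) b \<noteq> 0"
      and kh: "(k, h) \<noteq> 0" "null_dir (\<Phi> z) (\<Psi> z) b k h"
      using fibre_local_structure[OF fr le zV ne] by blast
    have "\<exists>s t. s *\<^sub>R snd (\<Phi> z) + t *\<^sub>R snd (\<Psi> z) \<noteq> 0"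
      using rank_one_derivative[OF frame_indep[OF fr(1) zV] kh(1) conjunct1[OF kh(2)] conjunct2[OF kh(2)] ev] by blast
    then show ?thesis by auto
  qed
  from separated[OF frame_indep[OF fr(1) zV] nz] obtain G d
    where G: "homogeneous_polynomial G" and d: "\<Phi> z \<bullet> d = 0" "\<Psi> z \<bullet> d = 0" "G d \<noteq> 0"
      and sc: "\<And>v. second_char (\<Phi> z) (\<Psi> z) v \<Longrightarrow> \<Phi> z \<bullet> v = 0 \<and> \<Psi> z \<bullet> v = 0 \<or> G v = 0"
    unfolding separated_def by blast
  have hom: "homogeneous_polynomial (\<lambda>\<nu>. G (coords \<nu>))"
  proof -
    have "polynomial_function coords"
      using linear_coords by (intro polynomial_function_bounded_linear) (simp add: linear_linear)
    then have "real_polynomial_function (G \<circ> coords)"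
      using G real_polynomial_function_compose unfolding homogeneous_polynomial_def by blast
    moreover obtain n where "\<And>t v. G (t *\<^sub>R v) = t ^ n * G v"
      using G unfolding homogeneous_polynomial_def by blast
    then have "\<forall>t \<nu>. G (coords (t *\<^sub>R \<nu>)) = t ^ n * G (coords \<nu>)"
      unfolding linear_scale[OF linear_coords] by blast
    ultimately show ?thesis
      unfolding homogeneous_polynomial_def o_def by blast
  qed
  have "irreducible_component (C1 z) (zariski_closure (C1 z) (char_lines E z)) (proj_space (D z))"
  proof (rule irreducible_component_proj_space[OF Dz(1,3) D0 sub hom])
    \<comment> \<open>Separation was proved in the five coordinates of C1; \<open>lift\<close>
      carries its witness back to the distribution, and G is pulled back along
      \<open>coords\<close>.\<close>
    show "lift z d \<in> D z" using ann d by (simp add: annihilates_def C1_eq_range_lift)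
    show "G (coords (lift z d)) \<noteq> 0" using d by simp
    fix H assume H: "H \<in> char_lines E z"
    then have "H \<in> proj_space (C1 z)" by (simp add: char_lines_def)
    moreover have "H \<in> proj_space (D z) \<or> (\<forall>v\<in>H. G (coords v) = 0)"
    proof (rule char_lines_second[OF fr le zV H])
      fix v assume v: "H = span {v}" "v \<in> C1 z" "v \<noteq> 0" "v \<in> D z \<or> second_char (\<Phi> z) (\<Psi> z) (coords v)"
      have "v \<in> D z \<or> G (coords v) = 0"
        using v(2,4) sc[of "coords v"] ann by (auto simp: annihilates_def)
      then show ?thesis
      proof
        assume "v \<in> D z"
        then show ?thesis using v line_in_proj_space[OF Dz(1)] by blast
      next
        assume "G (coords v) = 0"
        moreover obtain n where "\<And>t v. G (coords (t *\<^sub>R v)) = t ^ n * G (coords v)"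
          using hom unfolding homogeneous_polynomial_def by blast
        ultimately have "G (coords (t *\<^sub>R v)) = 0" for t by (metis mult_zero_right)
        then have "\<forall>w\<in>H. G (coords w) = 0" unfolding v(1) span_singleton by blast
        then show ?thesis ..
      qed
    qed
    ultimately show "H \<in> proj_space (C1 z) \<and> (H \<in> proj_space (D z) \<or> (\<forall>v\<in>H. G (coords v) = 0))" ..
  qed
  then show "irreducible_component (C1 z) (char_cone E z) (V_I E (D_line D) z)"
    unfolding eq char_cone_def .
qed

text \<open>A nonempty fibre in the closure of its smooth points contains one; this supplies, over
  every point of U, the starting line for the density argument.\<close>

lemma PDE_over_smooth_point:
  assumes "PDE_over \<Omega> E" "z \<in> \<Omega>"
  obtains b where "(z, b) \<in> smooth_points E"
proof -
  have "fibre (smooth_points E) z \<noteq> {}"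
    using assms unfolding PDE_over_def by (metis closure_empty subset_empty)
  then show thesis using that by (auto simp: fibre_def)
qed

theorem theorem3p4:
  fixes A :: "('m::{t2_space,second_countable_topology}, j1) chart set"
    and C :: "'m \<Rightarrow> ('m, j1) tvec set"
    and E :: "'m pt2 set"
  assumes "contact_manifold A C"
    and "third_order_PDE A C E"
  shows "locally_E_D A C E \<longleftrightarrow> char_cone_has_linear_component A C E"
proof
  assume L: "locally_E_D A C E"
  show "char_cone_has_linear_component A C E"
    unfolding char_cone_has_linear_component_def
  proof
    fix m1 assume "m1 \<in> M1 A C"
    from bspec[OF L[unfolded locally_E_D_def, folded locally_eq_def] this]
    obtain c z U D where c: "contact_chart A C c" "z \<in> dom1 c" "point1 A c z = m1"
      "open U" "z \<in> U" "U \<subseteq> dom1 c" and D: "distribution3 U D"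
      and le: "locally_eq (in_coords A C c E) U D"
      by (elim exE conjE)
    have "PDE_over (dom1 c) (in_coords A C c E)"
      using assms(2) c(1) unfolding third_order_PDE_def by blast
    then have comp: "irreducible_component (C1 z') (char_cone (in_coords A C c E) z')
          (V_I (in_coords A C c E) (D_line D) z')
        \<and> V_I (in_coords A C c E) (D_line D) z' = proj_space (D z')" if "z' \<in> U" for z'
    proof (rule PDE_over_smooth_point[OF _ subsetD[OF c(6) that]])
      fix b assume "(z', b) \<in> smooth_points (in_coords A C c E)"
      from E_of_imp_linear_component[OF D le that this] show ?thesis by (rule conjI)
    qed
    show "\<exists>c z U \<Lambda> D.
     contact_chart A C c \<and> z \<in> dom1 c \<and> point1 A c z = m1
     \<and> open U \<and> z \<in> U \<and> U \<subseteq> dom1 c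
     \<and> linear_factor (in_coords A C c E) U \<Lambda> \<and> distribution3 U D
     \<and> (\<forall>z'\<in>U. irreducible_component (C1 z') (char_cone (in_coords A C c E) z')
                    (V_I (in_coords A C c E) \<Lambda> z')
          \<and> V_I (in_coords A C c E) \<Lambda> z' = proj_space (D z'))"
      \<comment> \<open>The chosen linear factor is the line in which the plane meets D; chart,
        neighbourhood and distribution are kept.\<close>
      by (rule exI[of _ c], rule exI[of _ z], rule exI[of _ U], rule exI[of _ "D_line D"], rule exI[of _ D])
        (intro conjI c D ballI comp linear_factor_E_of[OF D le])
  qed
next
  assume R: "char_cone_has_linear_component A C E"
  show "locally_E_D A C E"
    unfolding locally_E_D_def
  proof
    fix m1 assume "m1 \<in> M1 A C"
    from bspec[OF R[unfolded char_cone_has_linear_component_def] this]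
    obtain c z U \<Lambda> D where c: "contact_chart A C c" "z \<in> dom1 c" "point1 A c z = m1"
      "open U" "z \<in> U" "U \<subseteq> dom1 c"
      and lf: "linear_factor (in_coords A C c E) U \<Lambda>" and D: "distribution3 U D"
      and V: "\<forall>z'\<in>U. irreducible_component (C1 z') (char_cone (in_coords A C c E) z') (V_I (in_coords A C c E) \<Lambda> z')
        \<and> V_I (in_coords A C c E) \<Lambda> z' = proj_space (D z')"
      by (elim exE conjE)
    have "V_I (in_coords A C c E) \<Lambda> z' = proj_space (D z')" if "z' \<in> U" for z'
      using bspec[OF V that] by (rule conjunct2)
    note eq = linear_component_imp_E_of[OF D c(4) lf this]
    show "\<exists>c z U D. contact_chart A C c \<and> z \<in> dom1 c \<and> point1 A c z = m1
     \<and> open U \<and> z \<in> U \<and> U \<subseteq> dom1 c \<and> distribution3 U D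
     \<and> (\<forall>y\<in>smooth_points (in_coords A C c E). fst y \<in> U \<longrightarrow>
          (\<exists>W. open W \<and> y \<in> W \<and> in_coords A C c E \<inter> W = E_of U D \<inter> W))"
      by (rule exI[of _ c], rule exI[of _ z], rule exI[of _ U], rule exI[of _ D])
        (intro conjI c D ballI impI eq)
  qed
qed

end
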